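(* Let $E$ be a Dedekind complete real Banach lattice such that its centre $\mathcal Z(E)$ is normal. Take $T\in\mathcal Z(E_{\mathbb C})$, with spectral measure $\mu_T$ and functional calculus $\rho_T$. (1) The functional calculus $\rho_T\colon B(\sigma(T),\mathbb C)\to\mathcal Z(E_{\mathbb C})$ of $T$ is a unital $\ast$-homomorphism such that $\rho_T(\mathrm{id})=T$, where $\mathrm{id}$ is the identity function on $\sigma(T)$. (2) $\rho_T$ establishes an isomorphism between $C(\sigma(T),\mathbb C)$ and the closed unital subalgebra of $\mathcal Z(E_{\mathbb C})$ that is generated by $T$ and $\overline T$. (3) $\sigma(\rho_T(f))=f(\sigma(T))$ for $f\in C(\sigma(T),\mathbb C)$. (4) For $f\in B(\sigma(T),\mathbb C)$, $\rho_T(f)=0$ if and only if $f=0$ $\mu_T$-almost everywhere. (5) Suppose that $(f_n)_{n=1}^\infty\subseteq B(\sigma(T),\mathbb C)$ is a $\mu_T$-almost everywhere uniformly bounded sequence which is $\mu_T$-almost everywhere convergent to $f\in B(\sigma(T),\mathbb C)$. Then $(\rho_T(f_n))_n$ is $\sigma$-order convergent to $\rho_T(f)$ in $\mathcal Z(E_{\mathbb C})$, and $(\rho_T(f_n)z)_n$ is $\sigma$-order convergent to $\rho_T(f)z$ in $E_{\mathbb C}$ for every $z\in E_{\mathbb C}$.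
   Context: Operators are linear; $I$ is the identity operator. For a Dedekind complete real Banach lattice $E$, the complexification $E_{\mathbb C}=E+iE$ carries the modulus $|x+iy|=\sup_{\theta}(x\cos\theta+y\sin\theta)$ and the norm $\lVert z\rVert=\lVert\,|z|\,\rVert$. $L_r(E)$ is the Dedekind complete vector lattice of regular operators on $E$, $L_r(E_{\mathbb C})=L_r(E)+iL_r(E)$, and for $T=R+iS$ with $R,S\in L_r(E)$, $|T|=\sup_\theta(R\cos\theta+S\sin\theta)$ and $\overline T=R-iS$. The centres are $\mathcal Z(E)=\{T\in L_r(E):|T|\le\lambda I\text{ for some }\lambda\ge0\}$ (a Dedekind complete vector lattice and an algebra under composition) and $\mathcal Z(E_{\mathbb C})=\{T\in L_r(E_{\mathbb C}):|T|\le\lambda I\text{ for some }\lambda\ge0\}=\mathcal Z(E)+i\mathcal Z(E)$, which is a unital commutative $\mathrm C^\ast$-algebra with involution $T\mapsto\overline T$ and norm $\inf\{\lambda\ge0:|T|\le\lambda I\}$ (equal to the operator norm). Isomorphisms between $\mathrm C^\ast$-algebras are $\ast$-isomorphisms. $\sigma(T)$ is the spectrum of $T$ as a bounded operator on $E_{\mathbb C}$, which coincides with its spectrum in $\mathcal Z(E_{\mathbb C})$. A real vector lattice is normal when its order continuous dual separates its points. $\mathcal B(\cdot)$ denotes the Borel $\sigma$-algebra and $B(\sigma(T),\mathbb C)$ the bounded Borel measurable functions on $\sigma(T)$. In a complex vector lattice $F_{\mathbb C}$, a sequence $(z_n)$ is $\sigma$-order convergent to $z$ when there is a sequence $(u_n)$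 in $F$ with $u_n\downarrow0$ and $|z_n-z|\le u_n$ for all $n$. Measures and integrals: let $F=\mathcal Z(E)$. An $F$-valued measure on a $\sigma$-algebra $\Omega$ is a map $\mu\colon\Omega\to F^+$ with $\mu(\emptyset)=0$ and $\mu(\bigcup_n\Delta_n)=\sup_N\sum_{n=1}^N\mu(\Delta_n)$ for pairwise disjoint sequences $(\Delta_n)$; it is spectral when $\mu(\Delta_1\cap\Delta_2)=\mu(\Delta_1)\mu(\Delta_2)$ for all $\Delta_1,\Delta_2\in\Omega$. A property holds $\mu$-almost everywhere when it holds outside a set in $\Omega$ of $\mu$-measure $0$. The order integral of $\varphi=\sum_{i=1}^n r_i\chi_{\Delta_i}$ with $r_i\ge0$, $\Delta_i\in\Omega$ is $\sum_i r_i\mu(\Delta_i)$; for bounded measurable $f\ge0$, $\int^o f\,d\mu=\sup_n\int^o\varphi_n\,d\mu$ for any sequence of such functions $\varphi_n\uparrow f$ pointwise (independent of the choice); this extends to bounded measurable real $f$ via $f^+$ and $f^-$ and to bounded measurable complex $f$ via real and imaginary parts, with values in $F_{\mathbb C}$. For $E$ with normal centre and $T\in\mathcal Z(E_{\mathbb C})$, the spectral measure of $T$ is the unique spectral measure $\mu_T\colon\mathcal B(\sigma(T))\to\mathcal Z(E)^+$ with $\mu_T(\sigma(T))=I$ and $T=\int^o_{\sigma(T)}\mathrm{id}\,d\mu_T$. Its functional calculus is $\rho_T(f)=\int^o_{\sigma(T)}f\,d\mu_T$ for $f\in B(\sigma(T),\mathbb C)$. *)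

theory Defs
  imports "HOL-Analysis.Analysis" "HOL-Library.Lattice_Algebras" "HOL-Library.Lub_Glb"
begin

section \<open>Vector lattices and Dedekind complete Banach lattices\<close>

class vector_lattice = ordered_real_vector + lattice_ab_group_add

class dc_banach_lattice = banach + vector_lattice + lattice_ab_group_add_abs +
  conditionally_complete_lattice +
  assumes norm_mono_abs: "\<bar>x\<bar> \<le> \<bar>y\<bar> \<Longrightarrow> norm x \<le> norm y"


section \<open>Regular operators\<close>

definition positive_op :: "('a::vector_lattice \<Rightarrow> 'a) \<Rightarrow> bool" where
  "positive_op P \<longleftrightarrow> linear P \<and> (\<forall>x\<ge>0. 0 \<le> P x)"

definition regular_op :: "('a::vector_lattice \<Rightarrow> 'a) \<Rightarrow> bool" where
  "regular_op T \<longleftrightarrow> (\<exists>P Q. positive_op P \<and> positive_op Q \<and> T = (\<lambda>x. P x - Q x))"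

lemma positive_op_zero: "positive_op (\<lambda>_. 0)"
  by (simp add: positive_op_def linear_zero)

lemma positive_op_id: "positive_op (\<lambda>x. x)"
  by (simp add: positive_op_def linear_ident)

lemma positive_op_add: "positive_op P \<Longrightarrow> positive_op Q \<Longrightarrow> positive_op (\<lambda>x. P x + Q x)"
  by (simp add: positive_op_def linear_compose_add)

lemma positive_op_scale: "positive_op P \<Longrightarrow> 0 \<le> c \<Longrightarrow> positive_op (\<lambda>x. c *\<^sub>R P x)"
  by (simp add: positive_op_def linear_compose_scale_right scaleR_nonneg_nonneg)

lemma positive_op_comp: "positive_op P \<Longrightarrow> positive_op Q \<Longrightarrow> positive_op (\<lambda>x. P (Q x))"
  using linear_compose[of Q P] by (simp add: positive_op_def o_def)

lemma regular_opI: "positive_op P \<Longrightarrow> positive_op Q \<Longrightarrow> regular_op (\<lambda>x. P x - Q x)"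
  unfolding regular_op_def by blast

lemma regular_op_linear: "regular_op T \<Longrightarrow> linear T"
  unfolding regular_op_def positive_op_def using linear_compose_sub by blast

lemma regular_op_positive: "positive_op P \<Longrightarrow> regular_op P"
  using regular_opI[of P "\<lambda>_. 0"] positive_op_zero by simp

lemma regular_op_add:
  assumes "regular_op S" "regular_op T"
  shows "regular_op (\<lambda>x. S x + T x)"
proof -
  obtain P Q P' Q' where *: "positive_op P" "positive_op Q" "positive_op P'" "positive_op Q'"
    "S = (\<lambda>x. P x - Q x)" "T = (\<lambda>x. P' x - Q' x)"
    using assms unfolding regular_op_def by blast
  have "(\<lambda>x. S x + T x) = (\<lambda>x. (P x + P' x) - (Q x + Q' x))"
    by (simp add: * algebra_simps)
  then show ?thesis
    using regular_opI[OF positive_op_add[OF *(1) *(3)] positive_op_add[OF *(2) *(4)]] by simp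
qed

lemma regular_op_uminus:
  assumes "regular_op S"
  shows "regular_op (\<lambda>x. - S x)"
proof -
  obtain P Q where *: "positive_op P" "positive_op Q" "S = (\<lambda>x. P x - Q x)"
    using assms unfolding regular_op_def by blast
  then have "(\<lambda>x. - S x) = (\<lambda>x. Q x - P x)"
    by simp
  then show ?thesis
    using regular_opI[OF *(2) *(1)] by simp
qed

lemma regular_op_scale:
  assumes "regular_op S"
  shows "regular_op (\<lambda>x. c *\<^sub>R S x)"
proof -
  obtain P Q where *: "positive_op P" "positive_op Q" "S = (\<lambda>x. P x - Q x)"
    using assms unfolding regular_op_def by blast
  show ?thesis
  proof (cases "0 \<le> c")
    case True
    have "(\<lambda>x. c *\<^sub>R S x) = (\<lambda>x. c *\<^sub>R P x - c *\<^sub>R Q x)"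
      by (simp add: * algebra_simps)
    then show ?thesis
      using regular_opI[OF positive_op_scale[OF *(1) True] positive_op_scale[OF *(2) True]] by simp
  next
    case False
    then have c: "0 \<le> - c"
      by simp
    have "(\<lambda>x. c *\<^sub>R S x) = (\<lambda>x. (- c) *\<^sub>R Q x - (- c) *\<^sub>R P x)"
      by (simp add: * algebra_simps)
    then show ?thesis
      using regular_opI[OF positive_op_scale[OF *(2) c] positive_op_scale[OF *(1) c]] by simp
  qed
qed

lemma regular_op_comp:
  assumes "regular_op S" "regular_op T"
  shows "regular_op (\<lambda>x. S (T x))"
proof -
  obtain P Q P' Q' where *: "positive_op P" "positive_op Q" "positive_op P'" "positive_op Q'"
    "S = (\<lambda>x. P x - Q x)" "T = (\<lambda>x. P' x - Q' x)"
    using assms unfolding regular_op_def by blast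
  have lin: "linear P" "linear Q"
    using * by (auto simp: positive_op_def)
  have "(\<lambda>x. S (T x)) = (\<lambda>x. (P (P' x) + Q (Q' x)) - (P (Q' x) + Q (P' x)))"
    by (simp add: * linear_diff[OF lin(1)] linear_diff[OF lin(2)] algebra_simps)
  then show ?thesis
    using regular_opI[OF positive_op_add[OF positive_op_comp[OF *(1) *(3)] positive_op_comp[OF *(2) *(4)]]
        positive_op_add[OF positive_op_comp[OF *(1) *(4)] positive_op_comp[OF *(2) *(3)]]] by simp
qed

lemma positive_cone_generating:
  fixes x :: "'a::vector_lattice"
  shows "x = sup x 0 - sup (- x) 0"
proof -
  have "sup x 0 = x + sup (- x) 0"
    by (simp add: add_sup_distrib_left sup_commute)
  then show ?thesis
    by (metis add_diff_cancel_right')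
qed

typedef (overloaded) 'a regop = "{T :: 'a::vector_lattice \<Rightarrow> 'a. regular_op T}"
  morphisms rapply Regop
  using regular_op_positive[OF positive_op_zero] by blast

setup_lifting type_definition_regop

lemma linear_rapply: "linear (rapply T)"
  using rapply regular_op_linear by blast

instantiation regop :: (vector_lattice) ordered_real_vector
begin

lift_definition zero_regop :: "'a regop" is "\<lambda>_. 0"
  by (rule regular_op_positive[OF positive_op_zero])
lift_definition plus_regop :: "'a regop \<Rightarrow> 'a regop \<Rightarrow> 'a regop" is "\<lambda>S T x. S x + T x"
  by (rule regular_op_add)
lift_definition uminus_regop :: "'a regop \<Rightarrow> 'a regop" is "\<lambda>T x. - T x"
  by (rule regular_op_uminus)
definition minus_regop :: "'a regop \<Rightarrow> 'a regop \<Rightarrow> 'a regop" where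
  "minus_regop S T = S + - T"
lift_definition scaleR_regop :: "real \<Rightarrow> 'a regop \<Rightarrow> 'a regop" is "\<lambda>c T x. c *\<^sub>R T x"
  by (rule regular_op_scale)
lift_definition less_eq_regop :: "'a regop \<Rightarrow> 'a regop \<Rightarrow> bool" is "\<lambda>S T. \<forall>x\<ge>0. S x \<le> T x" .
definition less_regop :: "'a regop \<Rightarrow> 'a regop \<Rightarrow> bool" where
  "less_regop S T \<longleftrightarrow> S \<le> T \<and> \<not> T \<le> S"

instance
proof
  fix S T U :: "'a regop" and a b :: real
  show "S + T + U = S + (T + U)" "S + T = T + S" "0 + S = S" "- S + S = 0"
    by (transfer, simp add: algebra_simps)+
  show "S - T = S + - T"
    by (simp add: minus_regop_def)
  show "a *\<^sub>R (S + T) = a *\<^sub>R S + a *\<^sub>R T" "(a + b) *\<^sub>R S = a *\<^sub>R S + b *\<^sub>R S"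
    "a *\<^sub>R b *\<^sub>R S = (a * b) *\<^sub>R S" "1 *\<^sub>R S = S"
    by (transfer, simp add: algebra_simps)+
  show "S < T \<longleftrightarrow> S \<le> T \<and> \<not> T \<le> S"
    by (simp add: less_regop_def)
  show "S \<le> S"
    by transfer simp
  show "S \<le> T \<Longrightarrow> T \<le> U \<Longrightarrow> S \<le> U"
    by transfer (blast intro: order_trans)
  show "S = T" if "S \<le> T" "T \<le> S"
  proof -
    have *: "rapply S x = rapply T x" if "0 \<le> x" for x
      using \<open>S \<le> T\<close> \<open>T \<le> S\<close> that by (simp add: less_eq_regop.rep_eq order.antisym)
    have "rapply S x = rapply T x" for x
    proof -
      have "rapply S (sup x 0 - sup (- x) 0) = rapply T (sup x 0 - sup (- x) 0)"
        unfolding linear_diff[OF linear_rapply] by (simp only: * sup.cobounded2)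
      then show ?thesis
        by (simp only: positive_cone_generating[of x, symmetric])
    qed
    then show ?thesis
      by (simp add: rapply_inject[symmetric] fun_eq_iff)
  qed
  show "S \<le> T \<Longrightarrow> U + S \<le> U + T"
    by transfer simp
  show "S \<le> T \<Longrightarrow> 0 \<le> a \<Longrightarrow> a *\<^sub>R S \<le> a *\<^sub>R T"
    by transfer (simp add: scaleR_left_mono)
  show "a \<le> b \<Longrightarrow> 0 \<le> S \<Longrightarrow> a *\<^sub>R S \<le> b *\<^sub>R S"
    by transfer (simp add: scaleR_right_mono)
qed

end

text \<open>Multiplication of regular operators is composition.  The class \<open>ring_1\<close> would exclude the
  zero lattice, hence \<open>ring\<close> together with \<open>monoid_mult\<close>.\<close>

instantiation regop :: (vector_lattice) "{ring, monoid_mult}"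
begin

lift_definition one_regop :: "'a regop" is "\<lambda>x. x"
  by (rule regular_op_positive[OF positive_op_id])
lift_definition times_regop :: "'a regop \<Rightarrow> 'a regop \<Rightarrow> 'a regop" is "\<lambda>S T x. S (T x)"
  by (rule regular_op_comp)

instance
proof
  fix S T U :: "'a regop"
  show "S * T * U = S * (T * U)" "1 * S = S" "S * 1 = S" "(S + T) * U = S * U + T * U"
    by (transfer, simp)+
  show "S * (T + U) = S * T + S * U"
    by transfer (simp add: linear_add[OF regular_op_linear])
qed

end


section \<open>Complexification\<close>

datatype 'a complexification = Cplx (re: 'a) (im: 'a)

lemma complexification_eqI: "re z = re w \<Longrightarrow> im z = im w \<Longrightarrow> z = w"
  by (simp add: complexification.expand)

instantiation complexification :: (ab_group_add) ab_group_add
begin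

definition "0 = Cplx 0 0"
definition "z + w = Cplx (re z + re w) (im z + im w)"
definition "- z = Cplx (- re z) (- im z)"
definition "z - w = Cplx (re z - re w) (im z - im w)"

instance
  by standard (auto simp: zero_complexification_def plus_complexification_def
      uminus_complexification_def minus_complexification_def algebra_simps)

end

instantiation complexification :: (real_vector) real_vector
begin

definition "c *\<^sub>R z = Cplx (c *\<^sub>R re z) (c *\<^sub>R im z)"

instance
  by standard (auto simp: plus_complexification_def scaleR_complexification_def algebra_simps)

end

instantiation complexification :: (ring) ring
begin

definition "z * w = Cplx (re z * re w - im z * im w) (re z * im w + im z * re w)"

instance
  by standard (auto simp: plus_complexification_def times_complexification_def algebra_simps)

end

instantiation complexification :: ("{ring, monoid_mult}") monoid_mult
begin

definition "1 = Cplx 1 0"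

instance
  by standard (auto simp: one_complexification_def times_complexification_def)

end

lemma complexification_simps [simp]:
  "re 0 = 0" "im 0 = 0"
  "re (z + w) = re z + re w" "im (z + w) = im z + im w"
  "re (- z) = - re z" "im (- z) = - im z"
  "re (z - w) = re z - re w" "im (z - w) = im z - im w"
  by (simp_all add: zero_complexification_def plus_complexification_def
      uminus_complexification_def minus_complexification_def)

lemma complexification_scaleR_simps [simp]:
  "re (c *\<^sub>R z) = c *\<^sub>R re z" "im (c *\<^sub>R z) = c *\<^sub>R im z"
  by (simp_all add: scaleR_complexification_def)

definition scaleC :: "complex \<Rightarrow> 'a::real_vector complexification \<Rightarrow> 'a complexification"
  (infixr \<open>*\<^sub>C\<close> 75) where
  "c *\<^sub>C z = Cplx (Re c *\<^sub>R re z - Im c *\<^sub>R im z) (Re c *\<^sub>R im z + Im c *\<^sub>R re z)"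

definition cconj :: "'a::real_vector complexification \<Rightarrow> 'a complexification" where
  "cconj z = Cplx (re z) (- im z)"

text \<open>The modulus of \<open>x + iy\<close> is the supremum of all \<open>cos \<theta> x + sin \<theta> y\<close>.  It is stated for
  ordered vector spaces, so that it covers both a Dedekind complete Banach lattice \<open>E\<close> and the
  space \<open>'a regop\<close> of regular operators on it.  The supremum exists in both cases; for \<open>E\<close> this is
  \<open>modulus_isLub\<close> below, for the regular operators it is the Riesz-Kantorovich theorem.\<close>

definition modulus :: "'a::ordered_real_vector complexification \<Rightarrow> 'a" where
  "modulus z = (THE m. isLub UNIV (range (\<lambda>\<theta>. cos \<theta> *\<^sub>R re z + sin \<theta> *\<^sub>R im z)) m)"

lemma isLub_UNIV_iff:
  "isLub UNIV A s \<longleftrightarrow> (\<forall>a\<in>A. a \<le> s) \<and> (\<forall>u. (\<forall>a\<in>A. a \<le> u) \<longrightarrow> s \<le> u)"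
  by (auto simp: isLub_def isUb_def leastP_def setle_def setge_def)

lemma scaleR_le_abs:
  fixes x :: "'a::dc_banach_lattice"
  assumes "\<bar>c\<bar> \<le> 1"
  shows "c *\<^sub>R x \<le> \<bar>x\<bar>"
proof -
  have *: "d *\<^sub>R y \<le> \<bar>y\<bar>" if "0 \<le> d" "d \<le> 1" for d and y :: 'a
  proof -
    have "d *\<^sub>R y \<le> d *\<^sub>R \<bar>y\<bar>"
      using that by (intro scaleR_left_mono abs_ge_self)
    also have "\<dots> \<le> 1 *\<^sub>R \<bar>y\<bar>"
      using that by (intro scaleR_right_mono) auto
    finally show ?thesis
      by simp
  qed
  show ?thesis
    using *[of c x] *[of "- c" "- x"] assms by (cases "0 \<le> c") auto
qed

lemma modulus_isLub:
  fixes z :: "'a::dc_banach_lattice complexification"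
  shows "isLub UNIV (range (\<lambda>\<theta>. cos \<theta> *\<^sub>R re z + sin \<theta> *\<^sub>R im z)) (modulus z)"
proof -
  define A where "A = range (\<lambda>\<theta>. cos \<theta> *\<^sub>R re z + sin \<theta> *\<^sub>R im z)"
  have "bdd_above A"
    unfolding A_def by (intro bdd_aboveI2[of _ _ "\<bar>re z\<bar> + \<bar>im z\<bar>"] add_mono scaleR_le_abs) auto
  then have "isLub UNIV A (Sup A)"
    unfolding isLub_UNIV_iff by (auto intro: cSup_upper cSup_least simp: A_def)
  moreover have "m = m'" if "isLub UNIV A m" "isLub UNIV A m'" for m m'
    using that unfolding isLub_UNIV_iff by (blast intro: order.antisym)
  ultimately show ?thesis
    unfolding modulus_def A_def[symmetric] by (metis theI)
qed

lemma modulus_upper: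
  fixes z :: "'a::dc_banach_lattice complexification"
  shows "cos \<theta> *\<^sub>R re z + sin \<theta> *\<^sub>R im z \<le> modulus z"
  using modulus_isLub[of z] unfolding isLub_UNIV_iff by blast

lemma modulus_least:
  fixes z :: "'a::dc_banach_lattice complexification"
  shows "(\<And>\<theta>. cos \<theta> *\<^sub>R re z + sin \<theta> *\<^sub>R im z \<le> u) \<Longrightarrow> modulus z \<le> u"
  using modulus_isLub[of z] unfolding isLub_UNIV_iff by blast

lemma modulus_upper_abs:
  fixes z :: "'a::dc_banach_lattice complexification"
  shows "\<bar>cos \<theta> *\<^sub>R re z + sin \<theta> *\<^sub>R im z\<bar> \<le> modulus z"
  using modulus_upper[of \<theta> z] modulus_upper[of "\<theta> + pi" z] by (intro abs_leI) auto

lemma modulus_nonneg: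
  fixes z :: "'a::dc_banach_lattice complexification"
  shows "0 \<le> modulus z"
  using modulus_upper_abs[of 0 z] abs_ge_zero order_trans by blast

lemma modulus_eq_0_iff:
  fixes z :: "'a::dc_banach_lattice complexification"
  shows "modulus z = 0 \<longleftrightarrow> z = 0"
proof
  assume "modulus z = 0"
  then show "z = 0"
    using modulus_upper_abs[of 0 z] modulus_upper_abs[of "pi / 2" z]
    by (intro complexification_eqI) auto
next
  assume "z = 0"
  then show "modulus z = 0"
    by (intro order.antisym modulus_nonneg modulus_least) simp
qed

lemma modulus_triangle:
  fixes z w :: "'a::dc_banach_lattice complexification"
  shows "modulus (z + w) \<le> modulus z + modulus w"
proof (rule modulus_least)
  fix \<theta>
  show "cos \<theta> *\<^sub>R re (z + w) + sin \<theta> *\<^sub>R im (z + w) \<le> modulus z + modulus w"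
    using add_mono[OF modulus_upper[of \<theta> z] modulus_upper[of \<theta> w]] by (simp add: algebra_simps)
qed

lemma modulus_scaleR:
  fixes z :: "'a::dc_banach_lattice complexification"
  shows "modulus (c *\<^sub>R z) = \<bar>c\<bar> *\<^sub>R modulus z"
proof -
  have le: "modulus (d *\<^sub>R w) \<le> \<bar>d\<bar> *\<^sub>R modulus w" for d and w :: "'a complexification"
  proof (rule modulus_least)
    fix \<theta>
    have "\<bar>d\<bar> *\<^sub>R (cos (if 0 \<le> d then \<theta> else \<theta> + pi) *\<^sub>R re w
        + sin (if 0 \<le> d then \<theta> else \<theta> + pi) *\<^sub>R im w) \<le> \<bar>d\<bar> *\<^sub>R modulus w"
      by (intro scaleR_left_mono modulus_upper) auto
    then show "cos \<theta> *\<^sub>R re (d *\<^sub>R w) + sin \<theta> *\<^sub>R im (d *\<^sub>R w) \<le> \<bar>d\<bar> *\<^sub>R modulus w"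
      by (cases "0 \<le> d") (auto simp: algebra_simps)
  qed
  show ?thesis
  proof (cases "c = 0")
    case True
    then show ?thesis
      by (simp add: modulus_eq_0_iff)
  next
    case False
    have "\<bar>c\<bar> *\<^sub>R modulus z = \<bar>c\<bar> *\<^sub>R modulus (inverse c *\<^sub>R c *\<^sub>R z)"
      using False by simp
    also have "\<dots> \<le> \<bar>c\<bar> *\<^sub>R \<bar>inverse c\<bar> *\<^sub>R modulus (c *\<^sub>R z)"
      by (intro scaleR_left_mono le) simp
    also have "\<dots> = modulus (c *\<^sub>R z)"
      using False by (simp add: abs_inverse)
    finally show ?thesis
      using le[of c z] by (intro order.antisym)
  qed
qed

instantiation complexification :: (dc_banach_lattice) real_normed_vector
begin

definition "norm z = norm (modulus z)"
definition "dist z w = norm (z - w)" for z w :: "'a complexification"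
definition "sgn z = inverse (norm z) *\<^sub>R z" for z :: "'a complexification"
definition "(uniformity :: ('a complexification \<times> 'a complexification) filter) =
  (INF e\<in>{0<..}. principal {(z, w). dist z w < e})"
definition "open U \<longleftrightarrow> (\<forall>z\<in>U. eventually (\<lambda>(z', w). z' = z \<longrightarrow> w \<in> U) uniformity)"
  for U :: "'a complexification set"

instance
proof
  fix z w :: "'a complexification" and c :: real and U :: "'a complexification set"
  show "dist z w = norm (z - w)" "sgn z = z /\<^sub>R norm z"
    "(uniformity :: ('a complexification \<times> 'a complexification) filter) =
      (INF e\<in>{0<..}. principal {(z, w). dist z w < e})"
    "open U \<longleftrightarrow> (\<forall>z\<in>U. \<forall>\<^sub>F (z', w) in uniformity. z' = z \<longrightarrow> w \<in> U)"
    by (fact dist_complexification_def sgn_complexification_def uniformity_complexification_def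
        open_complexification_def)+
  show "norm z = 0 \<longleftrightarrow> z = 0"
    by (simp add: norm_complexification_def modulus_eq_0_iff)
  have "norm (modulus (z + w)) \<le> norm (modulus z + modulus w)"
    by (intro norm_mono_abs) (simp add: modulus_nonneg modulus_triangle)
  also have "\<dots> \<le> norm (modulus z) + norm (modulus w)"
    by (rule norm_triangle_ineq)
  finally show "norm (z + w) \<le> norm z + norm w"
    by (simp add: norm_complexification_def)
  show "norm (c *\<^sub>R z) = \<bar>c\<bar> * norm z"
    by (simp add: norm_complexification_def modulus_scaleR)
qed

end

text \<open>\<open>F\<close> plays the role of the real vector lattice in whose complexification convergence takes
  place; it is either the whole type or the centre of \<open>E\<close>.\<close>

definition sigma_order_tendsto ::
    "'a::ordered_real_vector set \<Rightarrow> (nat \<Rightarrow> 'a complexification) \<Rightarrow> 'a complexification \<Rightarrow> bool"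
  where
  "sigma_order_tendsto F Z z \<longleftrightarrow>
    (\<exists>u. range u \<subseteq> F \<and> decseq u \<and> isGlb F (range u) 0 \<and> (\<forall>n. modulus (Z n - z) \<le> u n))"


section \<open>The centres of \<open>E\<close> and of its complexification\<close>

text \<open>\<open>'a regop complexification\<close> is the space of regular operators on \<open>'a complexification\<close>; an
  element \<open>Cplx R S\<close> stands for \<open>R + iS\<close>, and \<open>capply\<close> is its action.\<close>

definition capply ::
    "'a::vector_lattice regop complexification \<Rightarrow> 'a complexification \<Rightarrow> 'a complexification" where
  "capply T z = Cplx (rapply (re T) (re z) - rapply (im T) (im z))
                     (rapply (re T) (im z) + rapply (im T) (re z))"

text \<open>\<open>'a regop\<close> carries no lattice instance, so absolute values of regular operators are
  described by their universal property.\<close>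

definition regop_abs :: "'a::vector_lattice regop \<Rightarrow> 'a regop" where
  "regop_abs T = (THE m. isLub UNIV {T, - T} m)"

definition centre :: "'a::vector_lattice regop set" where
  "centre = {T. \<exists>r\<ge>0. regop_abs T \<le> r *\<^sub>R 1}"

definition ccentre :: "'a::vector_lattice regop complexification set" where
  "ccentre = {T. \<exists>r\<ge>0. modulus T \<le> r *\<^sub>R 1}"

definition ccentre_norm :: "'a::vector_lattice regop complexification \<Rightarrow> real" where
  "ccentre_norm T = Inf {r. 0 \<le> r \<and> modulus T \<le> r *\<^sub>R 1}"

definition closed_unital_subalgebra :: "'a::vector_lattice regop complexification set \<Rightarrow> bool" where
  "closed_unital_subalgebra A \<longleftrightarrow> A \<subseteq> ccentre \<and> 1 \<in> A \<and>
    (\<forall>S\<in>A. \<forall>T\<in>A. S + T \<in> A \<and> S * T \<in> A) \<and> (\<forall>c. \<forall>T\<in>A. c *\<^sub>C T \<in> A) \<and>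
    (\<forall>S T. range S \<subseteq> A \<and> T \<in> ccentre \<and> (\<lambda>n. ccentre_norm (S n - T)) \<longlonglongrightarrow> 0 \<longrightarrow> T \<in> A)"


section \<open>Spectrum\<close>

definition bounded_clinear ::
    "('a::dc_banach_lattice complexification \<Rightarrow> 'a complexification) \<Rightarrow> bool" where
  "bounded_clinear A \<longleftrightarrow> bounded_linear A \<and> (\<forall>c z. A (c *\<^sub>C z) = c *\<^sub>C A z)"

text \<open>The inverse is required to be a bounded operator on the complexified Banach lattice, not
  merely a regular or a central one.\<close>

definition spectrum ::
    "('a::dc_banach_lattice complexification \<Rightarrow> 'a complexification) \<Rightarrow> complex set" where
  "spectrum A = {c. \<not> (\<exists>B. bounded_clinear B \<and>
    (\<forall>z. B (c *\<^sub>C z - A z) = z) \<and> (\<forall>z. c *\<^sub>C B z - A (B z) = z))}"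


section \<open>Normal vector lattices\<close>

text \<open>The order continuous dual of a vector lattice \<open>F\<close>, given as a subspace of an ordered vector
  space: the order bounded linear functionals which tend to \<open>0\<close> along every decreasing net with
  infimum \<open>0\<close>.  Such a net may be replaced by its range, a downward directed set, ordered by
  itself; the filter below is the one of its tails.  Values outside \<open>F\<close> are irrelevant.\<close>

definition order_continuous_dual :: "'a::ordered_real_vector set \<Rightarrow> ('a \<Rightarrow> real) set" where
  "order_continuous_dual F = {\<phi>.
    (\<forall>x\<in>F. \<forall>y\<in>F. \<phi> (x + y) = \<phi> x + \<phi> y) \<and> (\<forall>c. \<forall>x\<in>F. \<phi> (c *\<^sub>R x) = c * \<phi> x) \<and>
    (\<forall>a\<in>F. \<forall>b\<in>F. bounded (\<phi> ` ({a..b} \<inter> F))) \<and>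
    (\<forall>D\<subseteq>F. D \<noteq> {} \<and> (\<forall>a\<in>D. \<forall>b\<in>D. \<exists>d\<in>D. d \<le> a \<and> d \<le> b) \<and> isGlb F D 0 \<longrightarrow>
      (\<phi> \<longlongrightarrow> 0) (INF d\<in>D. principal (D \<inter> {..d})))}"

definition normal_lattice :: "'a::ordered_real_vector set \<Rightarrow> bool" where
  "normal_lattice F \<longleftrightarrow> (\<forall>x\<in>F. (\<forall>\<phi>\<in>order_continuous_dual F. \<phi> x = 0) \<longrightarrow> x = 0)"


section \<open>Measures with values in the centre and their order integrals\<close>

text \<open>Only the measurable space underlying \<open>M\<close> is used.\<close>

definition centre_measure :: "'s measure \<Rightarrow> ('s set \<Rightarrow> 'a::vector_lattice regop) \<Rightarrow> bool" where
  "centre_measure M \<mu> \<longleftrightarrow> (\<forall>\<Delta>\<in>sets M. \<mu> \<Delta> \<in> centre \<and> 0 \<le> \<mu> \<Delta>) \<and> \<mu> {} = 0 \<and>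
    (\<forall>\<Delta>::nat \<Rightarrow> _. range \<Delta> \<subseteq> sets M \<and> disjoint_family \<Delta> \<longrightarrow>
      isLub centre (range (\<lambda>N. \<Sum>n\<le>N. \<mu> (\<Delta> n))) (\<mu> (\<Union>n. \<Delta> n)))"

definition spectral_measure :: "'s measure \<Rightarrow> ('s set \<Rightarrow> 'a::vector_lattice regop) \<Rightarrow> bool" where
  "spectral_measure M \<mu> \<longleftrightarrow> centre_measure M \<mu> \<and>
    (\<forall>\<Delta>1\<in>sets M. \<forall>\<Delta>2\<in>sets M. \<mu> (\<Delta>1 \<inter> \<Delta>2) = \<mu> \<Delta>1 * \<mu> \<Delta>2)"

definition order_AE :: "'s measure \<Rightarrow> ('s set \<Rightarrow> 'a::vector_lattice regop) \<Rightarrow> ('s \<Rightarrow> bool) \<Rightarrow> bool"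
  where
  "order_AE M \<mu> P \<longleftrightarrow> (\<exists>N\<in>sets M. \<mu> N = 0 \<and> (\<forall>x\<in>space M - N. P x))"

definition order_integral_simple ::
    "'s measure \<Rightarrow> ('s set \<Rightarrow> 'a::vector_lattice regop) \<Rightarrow> ('s \<Rightarrow> real) \<Rightarrow> 'a regop" where
  "order_integral_simple M \<mu> \<phi> = (\<Sum>r\<in>\<phi> ` space M. r *\<^sub>R \<mu> (\<phi> -` {r} \<inter> space M))"

text \<open>For bounded measurable \<open>f \<ge> 0\<close> and a measure \<open>\<mu>\<close> the supremum below exists and does not
  depend on the simple functions \<open>\<phi> n\<close> increasing to \<open>f\<close>.\<close>

definition order_integral_nonneg ::
    "'s measure \<Rightarrow> ('s set \<Rightarrow> 'a::vector_lattice regop) \<Rightarrow> ('s \<Rightarrow> real) \<Rightarrow> 'a regop" where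
  "order_integral_nonneg M \<mu> f = (THE I. \<exists>\<phi>.
    (\<forall>n::nat. simple_function M (\<phi> n) \<and> (\<forall>x\<in>space M. 0 \<le> \<phi> n x)) \<and>
    (\<forall>x\<in>space M. incseq (\<lambda>n. \<phi> n x) \<and> (\<lambda>n. \<phi> n x) \<longlonglongrightarrow> f x) \<and>
    isLub centre (range (\<lambda>n. order_integral_simple M \<mu> (\<phi> n))) I)"

definition order_integral_real ::
    "'s measure \<Rightarrow> ('s set \<Rightarrow> 'a::vector_lattice regop) \<Rightarrow> ('s \<Rightarrow> real) \<Rightarrow> 'a regop" where
  "order_integral_real M \<mu> f =
    order_integral_nonneg M \<mu> (\<lambda>x. max (f x) 0) - order_integral_nonneg M \<mu> (\<lambda>x. max (- f x) 0)"

definition order_integral ::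
    "'s measure \<Rightarrow> ('s set \<Rightarrow> 'a::vector_lattice regop) \<Rightarrow> ('s \<Rightarrow> complex) \<Rightarrow> 'a regop complexification"
  where
  "order_integral M \<mu> f =
    Cplx (order_integral_real M \<mu> (\<lambda>x. Re (f x))) (order_integral_real M \<mu> (\<lambda>x. Im (f x)))"


section \<open>Function algebras and the functional calculus\<close>

text \<open>Functions on \<open>X\<close> are represented by total functions with the fixed value \<open>undefined\<close>
  outside \<open>X\<close>, so that equality is equality on \<open>X\<close>.\<close>

definition bounded_borel :: "complex set \<Rightarrow> (complex \<Rightarrow> complex) set" where
  "bounded_borel X =
    {f \<in> extensional X. f \<in> borel_measurable (restrict_space borel X) \<and> bounded (f ` X)}"

definition continuous_fun :: "complex set \<Rightarrow> (complex \<Rightarrow> complex) set" where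
  "continuous_fun X = {f \<in> extensional X. continuous_on X f}"

definition unital_star_hom ::
    "'s set \<Rightarrow> ('s \<Rightarrow> complex) set \<Rightarrow> 'a::vector_lattice regop complexification set \<Rightarrow>
      (('s \<Rightarrow> complex) \<Rightarrow> 'a regop complexification) \<Rightarrow> bool" where
  "unital_star_hom X A B \<rho> \<longleftrightarrow> \<rho> ` A \<subseteq> B \<and> \<rho> (\<lambda>x\<in>X. 1) = 1 \<and>
    (\<forall>f\<in>A. \<forall>g\<in>A. \<rho> (\<lambda>x\<in>X. f x + g x) = \<rho> f + \<rho> g \<and> \<rho> (\<lambda>x\<in>X. f x * g x) = \<rho> f * \<rho> g) \<and>
    (\<forall>c. \<forall>f\<in>A. \<rho> (\<lambda>x\<in>X. c * f x) = c *\<^sub>C \<rho> f) \<and>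
    (\<forall>f\<in>A. \<rho> (\<lambda>x\<in>X. cnj (f x)) = cconj (\<rho> f))"

abbreviation spectral_space :: "'a::dc_banach_lattice regop complexification \<Rightarrow> complex measure" where
  "spectral_space T \<equiv> restrict_space borel (spectrum (capply T))"

text \<open>A predicate rather than a definite description: the spectral measure is unique on the Borel
  sets of the spectrum, but \<open>\<mu>\<close> as a total function is arbitrary elsewhere.\<close>

definition is_spectral_measure_of ::
    "'a::dc_banach_lattice regop complexification \<Rightarrow> (complex set \<Rightarrow> 'a regop) \<Rightarrow> bool" where
  "is_spectral_measure_of T \<mu> \<longleftrightarrow> spectral_measure (spectral_space T) \<mu> \<and>
    \<mu> (spectrum (capply T)) = 1 \<and> order_integral (spectral_space T) \<mu> (\<lambda>z. z) = T"

definition functional_calculus ::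
    "'a::dc_banach_lattice regop complexification \<Rightarrow> (complex set \<Rightarrow> 'a regop) \<Rightarrow>
      (complex \<Rightarrow> complex) \<Rightarrow> 'a regop complexification" where
  "functional_calculus T \<mu> f = order_integral (spectral_space T) \<mu> f"

end

theory Submission
  imports Defs
begin

text \<open>For simple functions, integration against a spectral measure is linear, monotone and
  multiplicative; uniform approximation carries this over to bounded measurable functions, and
  sigma-additivity gives continuity from above.  The suprema of regular operators that occur in moduli
  and integrals exist by the Riesz-Kantorovich theorem.

  A relatively open nonempty subset of the spectrum has nonzero measure: if it contained \<open>c\<close> and had
  measure \<open>0\<close>, the bounded function \<open>1 / (c - z)\<close> off that set would integrate to an inverse of
  \<open>c - T\<close>.  Hence the calculus is isometric on continuous functions, its range on them is closed, and
  Stone-Weierstrass identifies this range with the algebra generated by \<open>T\<close> and its conjugate.  The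
  same nonzero projections yield approximate eigenvectors for the values of a continuous function.\<close>

text \<open>Regular operators carry neither a lattice structure nor a norm here, so every estimate
  is an order inequality against a multiple of the identity: \<open>id_bounded\<close> and
  \<open>cid_bounded\<close> take the place of norm bounds, and equality follows by letting the
  bound shrink, since E is Archimedean. Rotations by exp(-i \<theta>) reduce statements about a
  complex modulus to real ones.

  The measure is countably additive with respect to suprema taken inside the centre, whereas the
  last assertion also asks for order convergence at each vector z. The bridge is that a decreasing
  sequence of positive operators has its infimum computed vector by vector. Continuity from above is
  therefore recorded at vectors: a lower bound b of all \<mu> (A n) x satisfies b \<le> 0 when the
  sets A n decrease to the empty set. This form is carried through the integrals, and a single
  dominating sequence then serves both halves of the last assertion.\<close>

text \<open>The positive part of x is squeezed below d times the positive part of y for every d > 0,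
  and the monotone norm then makes it vanish. This is how the limit e -> 0 is taken in order
  inequalities throughout.\<close>

lemma lattice_archimedean:
  fixes x y :: "'a::dc_banach_lattice"
  assumes "\<And>e. 0 < e \<Longrightarrow> x \<le> e *\<^sub>R y"
  shows "x \<le> 0"
proof -
  have "norm (sup x 0) \<le> e" if "0 < e" for e
  proof -
    \<comment> \<open>The added 1 keeps the quotient meaningful when the positive part of y is 0,
      and d times that norm still stays below e.\<close>
    define d where "d = e / (norm (sup y 0) + 1)"
    have np: "0 < norm (sup y 0) + 1"
      by (smt (verit) norm_ge_zero)
    then have "0 < d"
      using that by (simp add: d_def)
    have "x \<le> d *\<^sub>R sup y 0"
      using assms[OF \<open>0 < d\<close>] scaleR_left_mono[of y "sup y 0" d] \<open>0 < d\<close> by (auto intro: order_trans)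
    moreover have "0 \<le> d *\<^sub>R sup y 0"
      using \<open>0 < d\<close> by (simp add: scaleR_nonneg_nonneg)
    ultimately have "norm (sup x 0) \<le> norm (d *\<^sub>R sup y 0)"
      by (intro norm_mono_abs) simp
    also have "\<dots> = d * norm (sup y 0)"
      using \<open>0 < d\<close> by simp
    also have "\<dots> \<le> d * (norm (sup y 0) + 1)"
      using \<open>0 < d\<close> by (intro mult_left_mono) auto
    also have "\<dots> = e"
      using np by (simp add: d_def)
    finally show ?thesis .
  qed
  then have "norm (sup x 0) \<le> 0"
    by (rule field_le_epsilon[of _ 0, simplified])
  then have "sup x 0 = 0"
    by simp
  then show ?thesis
    by (metis sup_ge1)
qed

section \<open>Dedekind completeness of the regular operators\<close>

lemma regop_leI: "(\<And>x. 0 \<le> x \<Longrightarrow> rapply S x \<le> rapply T x) \<Longrightarrow> S \<le> T"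
  by (simp add: less_eq_regop.rep_eq)

lemma regop_leD: "S \<le> T \<Longrightarrow> 0 \<le> x \<Longrightarrow> rapply S x \<le> rapply T x"
  by (simp add: less_eq_regop.rep_eq)

lemma rapply_diff: "rapply (S - T) x = rapply S x - rapply T x"
proof -
  have "rapply (S - T) x = rapply S x + - rapply T x"
    by (simp only: minus_regop_def plus_regop.rep_eq uminus_regop.rep_eq)
  then show ?thesis
    by simp
qed

lemma rapply_simps [simp]:
  "rapply 0 x = 0" "rapply 1 x = x" "rapply (- S) x = - rapply S x"
  "rapply (S + T) x = rapply S x + rapply T x" "rapply (S - T) x = rapply S x - rapply T x"
  "rapply (c *\<^sub>R S) x = c *\<^sub>R rapply S x" "rapply (S * T) x = rapply S (rapply T x)"
  by (simp_all only: zero_regop.rep_eq one_regop.rep_eq uminus_regop.rep_eq plus_regop.rep_eq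
      rapply_diff scaleR_regop.rep_eq times_regop.rep_eq)

lemma rapply_sum: "rapply (sum f I) x = (\<Sum>i\<in>I. rapply (f i) x)"
  by (induction I rule: infinite_finite_induct) auto

lemma rapply_linear_simps [simp]:
  "rapply S (x + y) = rapply S x + rapply S y" "rapply S (x - y) = rapply S x - rapply S y"
  "rapply S (- x) = - rapply S x" "rapply S (c *\<^sub>R x) = c *\<^sub>R rapply S x" "rapply S 0 = 0"
  using linear_rapply[of S]
  by (simp_all add: linear_add linear_diff linear_neg linear_0 linear_cmul)

lemma regop_mult_scaleR [simp]:
  fixes S T :: "'a::vector_lattice regop"
  shows "(c *\<^sub>R S) * T = c *\<^sub>R (S * T)" "S * (c *\<^sub>R T) = c *\<^sub>R (S * T)"
  by (simp_all add: rapply_inject[symmetric] fun_eq_iff)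

lemma regop_one_nonneg [simp]: "0 \<le> (1 :: 'a::vector_lattice regop)"
  by (rule regop_leI) simp

lemma regop_mult_nonneg: "0 \<le> S \<Longrightarrow> 0 \<le> T \<Longrightarrow> 0 \<le> S * (T :: 'a::vector_lattice regop)"
  by (simp add: less_eq_regop.rep_eq)

lemma regop_eqI:
  assumes "\<And>x. 0 \<le> x \<Longrightarrow> rapply S x = rapply T x"
  shows "S = T"
  by (rule order.antisym; rule regop_leI) (simp_all add: assms)

lemma regop_archimedean:
  fixes S U :: "'a::dc_banach_lattice regop"
  assumes "\<And>e. 0 < e \<Longrightarrow> S \<le> e *\<^sub>R U"
  shows "S \<le> 0"
  using regop_leD[OF assms] by (intro regop_leI) (simp, metis lattice_archimedean)

text \<open>Suprema and infima of operators are computed on the positive cone first; this is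
  Kantorovich's extension from there. Since f is additive on the cone, f a - f b depends on a - b
  alone, so any decomposition of x into positive elements may be used.\<close>

lemma linear_extension_from_cone:
  fixes f :: "'a::vector_lattice \<Rightarrow> 'a"
  assumes add: "\<And>x y. 0 \<le> x \<Longrightarrow> 0 \<le> y \<Longrightarrow> f (x + y) = f x + f y"
    and scale: "\<And>c x. 0 < c \<Longrightarrow> 0 \<le> x \<Longrightarrow> f (c *\<^sub>R x) = c *\<^sub>R f x"
  obtains g where "linear g" "\<And>x. 0 \<le> x \<Longrightarrow> g x = f x"
proof
  define g where "g x = f (sup x 0) - f (sup (- x) 0)" for x
  have f0: "f 0 = 0"
    using add[of 0 0] by simp
  have g: "g x = f a - f b" if "x = a - b" "0 \<le> a" "0 \<le> b" for x a b
  proof -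
    have "a + sup (- x) 0 = b + sup x 0"
      using positive_cone_generating[of x] that(1)
      by (metis add.commute diff_add_cancel diff_add_eq)
    then have "f a + f (sup (- x) 0) = f b + f (sup x 0)"
      using that by (metis add sup.cobounded2)
    then show ?thesis
      by (simp add: g_def algebra_simps)
  qed
  show "g x = f x" if "0 \<le> x" for x
    using g[of x x 0] that f0 by simp
  show "linear g"
  proof (rule linearI)
    fix x y :: 'a and c :: real
    have "x + y = (sup x 0 + sup y 0) - (sup (- x) 0 + sup (- y) 0)"
      using positive_cone_generating[of x] positive_cone_generating[of y] by (metis add_diff_add)
    from g[OF this] show "g (x + y) = g x + g y"
      by (simp add: g_def add)
    show "g (c *\<^sub>R x) = c *\<^sub>R g x"
    proof -
      consider "c = 0" | "0 < c" | "c < 0"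
        by linarith
      then show ?thesis
      proof cases
        case 1
        then show ?thesis
          by (simp add: g_def f0)
      next
        case 2
        have "c *\<^sub>R x = c *\<^sub>R sup x 0 - c *\<^sub>R sup (- x) 0"
          using positive_cone_generating[of x] by (metis scaleR_diff_right)
        from g[OF this] 2 show ?thesis
          by (simp add: g_def scale algebra_simps scaleR_nonneg_nonneg)
      next
        case 3
        have "c *\<^sub>R x = c *\<^sub>R sup x 0 - c *\<^sub>R sup (- x) 0"
          using positive_cone_generating[of x] by (metis scaleR_diff_right)
        \<comment> \<open>A negative factor exchanges the two positive pieces.\<close>
        then have "c *\<^sub>R x = (- c) *\<^sub>R sup (- x) 0 - (- c) *\<^sub>R sup x 0"
          by simp
        from g[OF this] 3 scale[of "- c"] show ?thesis
          by (simp add: g_def algebra_simps scaleR_nonpos_nonneg)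
      qed
    qed
  qed
qed

text \<open>\<open>riesz_sum A x d\<close> holds when \<open>d = T\<^sub>1 x\<^sub>1 + \<dots> + T\<^sub>n x\<^sub>n\<close> for some \<open>T\<^sub>i \<in> A\<close> and \<open>x\<^sub>i \<ge> 0\<close> with
  sum \<open>x\<close>; the Riesz-Kantorovich formula gives \<open>sup A\<close> at \<open>x\<close> as the supremum of all such \<open>d\<close>.\<close>

inductive riesz_sum :: "'a::vector_lattice regop set \<Rightarrow> 'a \<Rightarrow> 'a \<Rightarrow> bool" for A where
  single: "T \<in> A \<Longrightarrow> 0 \<le> x \<Longrightarrow> riesz_sum A x (rapply T x)"
| plus: "riesz_sum A x d \<Longrightarrow> riesz_sum A y e \<Longrightarrow> riesz_sum A (x + y) (d + e)"

lemma riesz_sum_nonneg: "riesz_sum A x d \<Longrightarrow> 0 \<le> x"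
  by (induction rule: riesz_sum.induct) auto

lemma riesz_sum_le: "riesz_sum A x d \<Longrightarrow> (\<And>T. T \<in> A \<Longrightarrow> T \<le> U) \<Longrightarrow> d \<le> rapply U x"
  by (induction rule: riesz_sum.induct) (auto simp: regop_leD add_mono)

lemma riesz_sum_scale: "riesz_sum A x d \<Longrightarrow> 0 \<le> c \<Longrightarrow> riesz_sum A (c *\<^sub>R x) (c *\<^sub>R d)"
proof (induction rule: riesz_sum.induct)
  case (single T x)
  then show ?case
    using riesz_sum.single[of T A "c *\<^sub>R x"] by (simp add: scaleR_nonneg_nonneg)
next
  case (plus x d y e)
  then show ?case
    using riesz_sum.plus by (simp add: scaleR_add_right)
qed

text \<open>This is the Riesz decomposition property. In the \<open>plus\<close> case, x takes
  \<open>inf w1 x\<close> from the first summand and the remainder from the second; what is left of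
  both summands makes up y. It makes the supremum over all Riesz sums subadditive.\<close>

lemma riesz_sum_split:
  assumes "riesz_sum A w d" "w = x + y" "0 \<le> x" "0 \<le> y"
  shows "\<exists>d1 d2. riesz_sum A x d1 \<and> riesz_sum A y d2 \<and> d = d1 + d2"
  using assms
proof (induction arbitrary: x y rule: riesz_sum.induct)
  case (single T w)
  then show ?case
    using riesz_sum.single[of T A] by (metis rapply_linear_simps(1))
next
  case (plus w1 d1 w2 d2)
  note w = riesz_sum_nonneg[OF plus.hyps(1)] riesz_sum_nonneg[OF plus.hyps(2)]
  define x1 where "x1 = inf w1 x"
  have nn: "0 \<le> x1" "0 \<le> w1 - x1" "0 \<le> x - x1"
    using w plus.prems by (simp_all only: x1_def diff_ge_0_iff_ge inf_le1 inf_le2 le_infI)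
  \<comment> \<open>The remainder equals inf y w2, so x - x1 does fit below w2.\<close>
  have "w2 - (x - x1) = inf (w2 - x + w1) (w2 - x + x)"
    unfolding x1_def add_inf_distrib_left[symmetric] by (simp add: algebra_simps)
  also have "w2 - x + w1 = y"
    using plus.prems(1) by (simp add: algebra_simps)
  finally have "0 \<le> w2 - (x - x1)"
    using w plus.prems by simp
  then obtain e1 f1 e2 f2 where *: "riesz_sum A x1 e1" "riesz_sum A (w1 - x1) f1" "d1 = e1 + f1"
    "riesz_sum A (x - x1) e2" "riesz_sum A (w2 - (x - x1)) f2" "d2 = e2 + f2"
    using nn plus.IH(1)[of x1 "w1 - x1"] plus.IH(2)[of "x - x1" "w2 - (x - x1)"] by auto
  have "w1 - x1 + (w2 - (x - x1)) = y"
    using plus.prems(1) by (simp add: algebra_simps)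
  then show ?case
    using riesz_sum.plus[OF *(1,4)] riesz_sum.plus[OF *(2,5)] *(3,6)
    by (intro exI[of _ "e1 + e2"] exI[of _ "f1 + f2"]) (simp add: algebra_simps)
qed

text \<open>The pointwise supremum of a family that is not directed need not be additive; the
  supremum over Riesz sums is: splitting a sum gives one inequality, joining two sums gives the
  other.\<close>

theorem regop_dedekind_complete:
  fixes A :: "'a::dc_banach_lattice regop set"
  assumes "A \<noteq> {}" and U: "\<And>T. T \<in> A \<Longrightarrow> T \<le> U"
  obtains S where "isLub UNIV A S"
proof -
  obtain T0 where T0: "T0 \<in> A"
    using assms by blast
  define f where "f x = Sup {d. riesz_sum A x d}" for x
  have bdd: "bdd_above {d. riesz_sum A x d}" for x
    using riesz_sum_le[OF _ U] by (intro bdd_aboveI[of _ "rapply U x"]) auto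
  have ne: "{d. riesz_sum A x d} \<noteq> {}" if "0 \<le> x" for x
    using riesz_sum.single[OF T0 that] by blast
  have up: "d \<le> f x" if "riesz_sum A x d" for x d
    unfolding f_def using that by (intro cSup_upper bdd) auto
  have least: "f x \<le> b" if "0 \<le> x" "\<And>d. riesz_sum A x d \<Longrightarrow> d \<le> b" for x b
    unfolding f_def using that by (intro cSup_least ne) auto
  have add: "f (x + y) = f x + f y" if xy: "0 \<le> x" "0 \<le> y" for x y
  proof (rule order.antisym)
    show "f (x + y) \<le> f x + f y"
    proof (rule least)
      fix d assume "riesz_sum A (x + y) d"
      then obtain d1 d2 where "riesz_sum A x d1" "riesz_sum A y d2" "d = d1 + d2"
        using riesz_sum_split[OF _ refl xy] by blast
      then show "d \<le> f x + f y"
        by (simp add: add_mono up)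
    qed (use that in simp)
    have "d \<le> f (x + y) - f y" if "riesz_sum A x d" for d
    proof -
      have "f y \<le> f (x + y) - d"
        using \<open>0 \<le> y\<close> up[OF riesz_sum.plus[OF that]] by (intro least) (auto simp: le_diff_eq add.commute[of _ d])
      then show ?thesis
        by (metis add.commute le_diff_eq)
    qed
    then have "f x \<le> f (x + y) - f y"
      using that by (intro least)
    then show "f x + f y \<le> f (x + y)"
      by (simp add: le_diff_eq)
  qed
  have le: "f (c *\<^sub>R x) \<le> c *\<^sub>R f x" if "0 < c" "0 \<le> x" for c x
  proof (rule least)
    show "0 \<le> c *\<^sub>R x"
      using that by (simp add: scaleR_nonneg_nonneg)
    fix d assume "riesz_sum A (c *\<^sub>R x) d"
    then have "riesz_sum A x (inverse c *\<^sub>R d)"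
      using riesz_sum_scale[of A "c *\<^sub>R x" d "inverse c"] that by simp
    then have "c *\<^sub>R inverse c *\<^sub>R d \<le> c *\<^sub>R f x"
      using that by (intro scaleR_left_mono up) auto
    then show "d \<le> c *\<^sub>R f x"
      using that by simp
  qed
  have scale: "f (c *\<^sub>R x) = c *\<^sub>R f x" if "0 < c" "0 \<le> x" for c x
  proof (rule order.antisym[OF le[OF that]])
    have "f (inverse c *\<^sub>R c *\<^sub>R x) \<le> inverse c *\<^sub>R f (c *\<^sub>R x)"
      using that by (intro le) (auto simp: scaleR_nonneg_nonneg)
    then have "c *\<^sub>R f x \<le> c *\<^sub>R inverse c *\<^sub>R f (c *\<^sub>R x)"
      using that by (intro scaleR_left_mono) auto
    then show "c *\<^sub>R f x \<le> f (c *\<^sub>R x)"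
      using that by simp
  qed
  obtain g where g: "linear g" "\<And>x. 0 \<le> x \<Longrightarrow> g x = f x"
    using linear_extension_from_cone[of f] add scale by blast
  \<comment> \<open>Regularity of g: it differs from the member T0 of A by a positive
    operator.\<close>
  have "positive_op (\<lambda>x. g x - rapply T0 x)"
    using g up[OF riesz_sum.single[OF T0]] by (auto simp: positive_op_def linear_rapply linear_compose_sub)
  from regular_op_add[OF regular_op_positive[OF this], of "rapply T0"]
  have reg: "regular_op g"
    using rapply[of T0] by simp
  have S: "rapply (Regop g) x = f x" if "0 \<le> x" for x
    using reg g that by (simp add: Regop_inverse)
  have "isLub UNIV A (Regop g)"
    unfolding isLub_UNIV_iff
  proof (intro conjI ballI allI impI)
    fix T assume "T \<in> A"
    then show "T \<le> Regop g"
      using up[OF riesz_sum.single] by (intro regop_leI) (simp add: S)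
  next
    fix V assume V: "\<forall>T\<in>A. T \<le> V"
    show "Regop g \<le> V"
    proof (rule regop_leI)
      fix x :: 'a assume "0 \<le> x"
      then show "rapply (Regop g) x \<le> rapply V x"
        unfolding S[OF \<open>0 \<le> x\<close>] using riesz_sum_le[of A x _ V] V by (intro least) auto
    qed
  qed
  then show ?thesis
    using that by blast
qed

text \<open>For a decreasing sequence, bounds at the indices m and n combine at
  \<open>max m n\<close>, so the pointwise infimum is already additive. Its explicit values at x
  later turn convergence of operators into convergence of vectors.\<close>

lemma regop_decseq_Inf:
  fixes u :: "nat \<Rightarrow> 'a::dc_banach_lattice regop"
  assumes "decseq u" and nonneg: "\<And>n. 0 \<le> u n"
  obtains w where "0 \<le> w" "\<And>x. 0 \<le> x \<Longrightarrow> rapply w x = (INF n. rapply (u n) x)"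
proof -
  define f where "f x = (INF n. rapply (u n) x)" for x
  have bdd: "bdd_below (range (\<lambda>n. rapply (u n) x))" if "0 \<le> x" for x
    using regop_leD[OF nonneg that] by (intro bdd_belowI[of _ 0]) auto
  have low: "f x \<le> rapply (u n) x" if "0 \<le> x" for x n
    unfolding f_def using that by (intro cINF_lower bdd) auto
  have greatest: "b \<le> f x" if "\<And>n. b \<le> rapply (u n) x" for x b
    unfolding f_def using that by (intro cINF_greatest) auto
  have dec: "rapply (u n) x \<le> rapply (u m) x" if "0 \<le> x" "m \<le> n" for x m n
    using regop_leD[OF decseqD[OF \<open>decseq u\<close> that(2)] that(1)] .
  have add: "f (x + y) = f x + f y" if "0 \<le> x" "0 \<le> y" for x y
  proof (rule order.antisym)
    have *: "f (x + y) - rapply (u m) y \<le> rapply (u n) x" for m n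
    proof -
      have "f (x + y) \<le> rapply (u (max m n)) (x + y)"
        using that by (intro low) auto
      also have "\<dots> \<le> rapply (u n) x + rapply (u m) y"
        using that by (auto intro!: add_mono dec)
      finally show ?thesis
        by (simp add: diff_le_eq)
    qed
    have "f (x + y) - f x \<le> rapply (u m) y" for m
      using greatest[OF *[of m]] by (metis add.commute diff_le_eq)
    then show "f (x + y) \<le> f x + f y"
      using greatest[of "f (x + y) - f x" y] by (metis add.commute diff_le_eq)
    show "f x + f y \<le> f (x + y)"
      using that by (intro greatest) (auto intro!: add_mono low)
  qed
  have le: "c *\<^sub>R f x \<le> f (c *\<^sub>R x)" if "0 < c" "0 \<le> x" for c x
    using that low by (intro greatest) (auto intro: scaleR_left_mono)
  have scale: "f (c *\<^sub>R x) = c *\<^sub>R f x" if "0 < c" "0 \<le> x" for c x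
  proof (rule order.antisym[OF _ le[OF that]])
    have "inverse c *\<^sub>R f (c *\<^sub>R x) \<le> f (inverse c *\<^sub>R c *\<^sub>R x)"
      using that by (intro le) (auto simp: scaleR_nonneg_nonneg)
    then have "c *\<^sub>R inverse c *\<^sub>R f (c *\<^sub>R x) \<le> c *\<^sub>R f x"
      using that by (intro scaleR_left_mono) auto
    then show "f (c *\<^sub>R x) \<le> c *\<^sub>R f x"
      using that by simp
  qed
  obtain g where g: "linear g" "\<And>x. 0 \<le> x \<Longrightarrow> g x = f x"
    using linear_extension_from_cone[of f] add scale by blast
  have "positive_op g"
    using g greatest[of 0] regop_leD[OF nonneg] by (auto simp: positive_op_def)
  then have S: "rapply (Regop g) x = f x" if "0 \<le> x" for x
    using g that by (simp add: Regop_inverse regular_op_positive)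
  have "0 \<le> Regop g"
  proof (rule regop_leI)
    fix x :: 'a assume "0 \<le> x"
    then show "rapply 0 x \<le> rapply (Regop g) x"
      using greatest[of 0 x] regop_leD[OF nonneg, of x] by (simp add: S)
  qed
  then show ?thesis
    using S unfolding f_def by (rule that)
qed

section \<open>Operators dominated by multiples of the identity\<close>

text \<open>This says that the absolute value of A is at most r times the identity, without
  mentioning an absolute value; it plays the part of a norm bound by r.\<close>

definition id_bounded :: "real \<Rightarrow> 'a::vector_lattice regop \<Rightarrow> bool" where
  "id_bounded r A \<longleftrightarrow> - (r *\<^sub>R 1) \<le> A \<and> A \<le> r *\<^sub>R 1"

lemma id_bounded_mono:
  fixes A :: "'a::vector_lattice regop"
  assumes "id_bounded r A" "r \<le> s"
  shows "id_bounded s A"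
proof -
  have "r *\<^sub>R (1 :: 'a regop) \<le> s *\<^sub>R 1"
    using assms by (intro scaleR_right_mono) auto
  then show ?thesis
    using assms unfolding id_bounded_def by (meson neg_le_iff_le order_trans)
qed

lemma id_bounded_uminus: "id_bounded r A \<Longrightarrow> id_bounded r (- A)"
  by (auto simp: id_bounded_def minus_le_iff)

lemma id_bounded_add: "id_bounded r A \<Longrightarrow> id_bounded s B \<Longrightarrow> id_bounded (r + s) (A + B)"
  unfolding id_bounded_def using add_mono[of "- (r *\<^sub>R 1)" A "- (s *\<^sub>R 1)" B] add_mono[of A "r *\<^sub>R 1" B "s *\<^sub>R 1"]
  by (simp add: algebra_simps)

lemma id_bounded_diff: "id_bounded r A \<Longrightarrow> id_bounded s B \<Longrightarrow> id_bounded (r + s) (A - B)"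
  using id_bounded_add[OF _ id_bounded_uminus] by fastforce

lemma id_bounded_scaleR:
  assumes "id_bounded r A"
  shows "id_bounded (\<bar>c\<bar> * r) (c *\<^sub>R A)"
proof -
  have *: "id_bounded (d * r) (d *\<^sub>R B)" if "0 \<le> d" "id_bounded r B" for d and B :: "'a regop"
    using that scaleR_left_mono[of "- (r *\<^sub>R 1)" B d] scaleR_left_mono[of B "r *\<^sub>R 1" d]
    by (simp add: id_bounded_def)
  show ?thesis
    using *[of c A] *[of "- c" "- A"] assms id_bounded_uminus[of r A] by (cases "0 \<le> c") auto
qed

text \<open>\<open>(a + A)(b - B) + (a - A)(b + B) = 2 (ab - AB)\<close> is a sum of products of positive operators.\<close>

lemma mult_le_scaleR_one:
  fixes A B :: "'a::vector_lattice regop"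
  assumes "id_bounded a A" "id_bounded b B"
  shows "A * B \<le> (a * b) *\<^sub>R 1"
proof -
  have "0 \<le> (a *\<^sub>R 1 + A) * (b *\<^sub>R 1 - B)" "0 \<le> (a *\<^sub>R 1 - A) * (b *\<^sub>R 1 + B)"
    using assms add_left_mono[of "- (a *\<^sub>R 1)" A "a *\<^sub>R 1"] add_left_mono[of "- (b *\<^sub>R 1)" B "b *\<^sub>R 1"]
    by (intro regop_mult_nonneg; simp add: id_bounded_def)+
  then have "0 \<le> (a *\<^sub>R 1 + A) * (b *\<^sub>R 1 - B) + (a *\<^sub>R 1 - A) * (b *\<^sub>R 1 + B)"
    by simp
  also have "\<dots> = ((a * b) *\<^sub>R 1 - A * B) + ((a * b) *\<^sub>R 1 - A * B)"
    by (simp add: algebra_simps)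
  finally have "0 \<le> (1/2) *\<^sub>R (((a * b) *\<^sub>R 1 - A * B) + ((a * b) *\<^sub>R 1 - A * B))"
    by (intro scaleR_nonneg_nonneg) auto
  then show ?thesis
    by (simp only: scaleR_half_double diff_ge_0_iff_ge)
qed

lemma id_bounded_mult:
  assumes "id_bounded a A" "id_bounded b B"
  shows "id_bounded (a * b) (A * B)"
  using mult_le_scaleR_one[OF assms] mult_le_scaleR_one[OF id_bounded_uminus[OF assms(1)] assms(2)]
  by (simp add: id_bounded_def minus_le_iff)

text \<open>The factor c absorbs the constants of error estimates such as 2 * e.\<close>

lemma id_bounded_eq_0:
  fixes A :: "'a::dc_banach_lattice regop"
  assumes "\<And>e. 0 < e \<Longrightarrow> id_bounded (c * e) A" "0 < c"
  shows "A = 0"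
proof (rule order.antisym)
  have *: "id_bounded e A" if "0 < e" for e
    using assms(1)[of "e / c"] that assms(2) by simp
  show "A \<le> 0"
    using * by (intro regop_archimedean[of _ 1]) (auto simp: id_bounded_def)
  have "- A \<le> 0"
    using * by (intro regop_archimedean[of _ 1]) (auto simp: id_bounded_def minus_le_iff)
  then show "0 \<le> A"
    by simp
qed

text \<open>Here x is the difference of the positive elements \<open>pprt x\<close> and
  \<open>- nprt x\<close>; the upper bound of the operator is used on the first and the lower bound
  on the second.\<close>

lemma id_bounded_abs_le:
  fixes A :: "'a::dc_banach_lattice regop"
  assumes "id_bounded r A"
  shows "\<bar>rapply A x\<bar> \<le> r *\<^sub>R \<bar>x\<bar>"
proof -
  have *: "rapply B x \<le> r *\<^sub>R \<bar>x\<bar>" if "id_bounded r B" for B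
  proof -
    have "rapply B (pprt x) \<le> r *\<^sub>R pprt x" "- (r *\<^sub>R (- nprt x)) \<le> rapply B (- nprt x)"
      using that regop_leD[of B "r *\<^sub>R 1" "pprt x"] regop_leD[of "- (r *\<^sub>R 1)" B "- nprt x"]
      by (simp_all add: id_bounded_def)
    then have "rapply B (pprt x) - rapply B (- nprt x) \<le> r *\<^sub>R pprt x - - (r *\<^sub>R (- nprt x))"
      by (rule diff_mono)
    then have "rapply B (pprt x + nprt x) \<le> r *\<^sub>R (pprt x - nprt x)"
      by (simp add: scaleR_diff_right)
    then show ?thesis
      by (simp add: abs_prts prts[symmetric])
  qed
  show ?thesis
    using *[OF assms] *[OF id_bounded_uminus[OF assms]] by (intro abs_leI) auto
qed

section \<open>The modulus of regular operators and the complexified centre\<close>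

text \<open>The real part of exp(-i \<theta>) z; \<open>modulus\<close> is its supremum over
  \<theta>. The same notion serves elements of E and operators.\<close>

definition rotated_re :: "real \<Rightarrow> 'a::real_vector complexification \<Rightarrow> 'a" where
  "rotated_re \<theta> z = cos \<theta> *\<^sub>R re z + sin \<theta> *\<^sub>R im z"

lemma rotated_re_simps [simp]:
  "rotated_re \<theta> (z + w) = rotated_re \<theta> z + rotated_re \<theta> w"
  "rotated_re \<theta> (z - w) = rotated_re \<theta> z - rotated_re \<theta> w"
  "rotated_re \<theta> (- z) = - rotated_re \<theta> z"
  "rotated_re 0 z = re z" "rotated_re (pi / 2) z = im z" "rotated_re (\<theta> + pi) z = - rotated_re \<theta> z"
  by (simp_all add: rotated_re_def algebra_simps)

text \<open>A factor in polar form scales by its radius and merely shifts the angle, so the family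
  of all rotations is only rescaled.\<close>

lemma scaleC_rcis_rotated_re: "rotated_re \<theta> (rcis r \<alpha> *\<^sub>C z) = r *\<^sub>R rotated_re (\<theta> - \<alpha>) z"
  by (simp add: rotated_re_def scaleC_def cos_diff sin_diff algebra_simps)

lemma regop_dominated:
  fixes R :: "'a::vector_lattice regop"
  obtains U where "\<And>c. \<bar>c\<bar> \<le> 1 \<Longrightarrow> c *\<^sub>R R \<le> U"
proof -
  obtain P Q where PQ: "positive_op P" "positive_op Q" "rapply R = (\<lambda>x. P x - Q x)"
    using rapply[of R] unfolding regular_op_def by blast
  \<comment> \<open>For R = P - Q the operator P + Q works, as (P + Q) - c (P - Q) = (1 - c) P + (1
    + c) Q with nonnegative coefficients.\<close>
  define U where "U = Regop (\<lambda>x. P x + Q x)"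
  have U: "rapply U x = P x + Q x" for x
    unfolding U_def using PQ by (simp add: Regop_inverse regular_op_positive positive_op_add)
  have "c *\<^sub>R R \<le> U" if "\<bar>c\<bar> \<le> 1" for c
  proof (rule regop_leI)
    fix x :: 'a assume "0 \<le> x"
    then have nn: "0 \<le> P x" "0 \<le> Q x"
      using PQ by (auto simp: positive_op_def)
    have "0 \<le> (1 - c) *\<^sub>R P x + (1 + c) *\<^sub>R Q x"
      using nn abs_le_D1[OF that] abs_le_D2[OF that]
      by (intro add_nonneg_nonneg[OF scaleR_nonneg_nonneg scaleR_nonneg_nonneg]) simp_all
    also have "\<dots> = rapply U x - rapply (c *\<^sub>R R) x"
      by (simp add: U PQ(3) algebra_simps)
    finally show "rapply (c *\<^sub>R R) x \<le> rapply U x"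
      by simp
  qed
  then show ?thesis
    using that by blast
qed

text \<open>Cosines and sines lie in [-1, 1], so fixed operators dominating the real and the
  imaginary part bound all rotations at once; Dedekind completeness then makes the description in
  \<open>modulus\<close> denote.\<close>

lemma modulus_regop_isLub:
  fixes T :: "'a::dc_banach_lattice regop complexification"
  shows "isLub UNIV (range (\<lambda>\<theta>. rotated_re \<theta> T)) (modulus T)"
proof -
  obtain U V where UV: "\<And>c. \<bar>c\<bar> \<le> 1 \<Longrightarrow> c *\<^sub>R re T \<le> U" "\<And>c. \<bar>c\<bar> \<le> 1 \<Longrightarrow> c *\<^sub>R im T \<le> V"
    using regop_dominated by metis
  obtain S where S: "isLub UNIV (range (\<lambda>\<theta>. rotated_re \<theta> T)) S"
    by (rule regop_dedekind_complete[of "range (\<lambda>\<theta>. rotated_re \<theta> T)" "U + V"])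
      (auto simp: rotated_re_def intro!: add_mono UV)
  moreover have "S' = S" if "isLub UNIV (range (\<lambda>\<theta>. rotated_re \<theta> T)) S'" for S'
    using that S unfolding isLub_UNIV_iff by (blast intro: order.antisym)
  ultimately show ?thesis
    unfolding modulus_def rotated_re_def[symmetric] by (metis theI)
qed

lemma modulus_regop_le_iff:
  fixes T :: "'a::dc_banach_lattice regop complexification"
  shows "modulus T \<le> U \<longleftrightarrow> (\<forall>\<theta>. rotated_re \<theta> T \<le> U)"
  using modulus_regop_isLub[of T] unfolding isLub_UNIV_iff by (auto intro: order_trans)

definition cid_bounded :: "real \<Rightarrow> 'a::vector_lattice regop complexification \<Rightarrow> bool" where
  "cid_bounded r T \<longleftrightarrow> (\<forall>\<theta>. id_bounded r (rotated_re \<theta> T))"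

text \<open>Upper bounds suffice because the rotation by \<theta> + pi is the negative of the
  rotation by \<theta>.\<close>

lemma cid_boundedI: "(\<And>\<theta>. rotated_re \<theta> T \<le> r *\<^sub>R 1) \<Longrightarrow> cid_bounded r T"
  unfolding cid_bounded_def id_bounded_def using rotated_re_simps(6)[of _ T]
  by (metis minus_le_iff)

lemma modulus_le_iff_cid_bounded:
  fixes T :: "'a::dc_banach_lattice regop complexification"
  shows "modulus T \<le> r *\<^sub>R 1 \<longleftrightarrow> cid_bounded r T"
  using cid_boundedI[of T r] unfolding modulus_regop_le_iff
  by (auto simp: cid_bounded_def id_bounded_def)

lemma cid_bounded_re: "cid_bounded r T \<Longrightarrow> id_bounded r (re T)"
  unfolding cid_bounded_def by (metis rotated_re_simps(4))

lemma cid_bounded_im: "cid_bounded r T \<Longrightarrow> id_bounded r (im T)"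
  unfolding cid_bounded_def by (metis rotated_re_simps(5))

lemma cid_bounded_mono: "cid_bounded r T \<Longrightarrow> r \<le> s \<Longrightarrow> cid_bounded s T"
  unfolding cid_bounded_def using id_bounded_mono by blast

lemma cid_bounded_diff: "cid_bounded r S \<Longrightarrow> cid_bounded s T \<Longrightarrow> cid_bounded (r + s) (S - T)"
  unfolding cid_bounded_def by (simp add: id_bounded_diff)

lemma cid_bounded_eq_0:
  fixes T :: "'a::dc_banach_lattice regop complexification"
  assumes "\<And>e. 0 < e \<Longrightarrow> cid_bounded (c * e) T" "0 < c"
  shows "T = 0"
  using assms cid_bounded_re cid_bounded_im
  by (intro complexification_eqI; simp; intro id_bounded_eq_0[of c]; blast)

lemma mem_ccentre_iff:
  fixes T :: "'a::dc_banach_lattice regop complexification"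
  shows "T \<in> ccentre \<longleftrightarrow> (\<exists>r\<ge>0. cid_bounded r T)"
  by (simp add: ccentre_def modulus_le_iff_cid_bounded)

lemma ccentre_diff:
  fixes S T :: "'a::dc_banach_lattice regop complexification"
  assumes "S \<in> ccentre" "T \<in> ccentre"
  shows "S - T \<in> ccentre"
  using assms cid_bounded_diff unfolding mem_ccentre_iff by (metis add_nonneg_nonneg)

lemma ccentre_norm_le:
  fixes T :: "'a::dc_banach_lattice regop complexification"
  assumes "0 \<le> r" "cid_bounded r T"
  shows "ccentre_norm T \<le> r"
  unfolding ccentre_norm_def modulus_le_iff_cid_bounded
  using assms by (intro cInf_lower bdd_belowI[of _ 0]) auto

lemma ccentre_norm_nonneg:
  fixes T :: "'a::dc_banach_lattice regop complexification"
  assumes "T \<in> ccentre"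
  shows "0 \<le> ccentre_norm T"
  unfolding ccentre_norm_def modulus_le_iff_cid_bounded
  using assms by (intro cInf_greatest) (auto simp: mem_ccentre_iff)

text \<open>The strict inequality leaves room for an admissible bound below r, so the infimum need
  not be known to be attained.\<close>

lemma cid_bounded_if_ccentre_norm_less:
  fixes T :: "'a::dc_banach_lattice regop complexification"
  assumes "T \<in> ccentre" "ccentre_norm T < r"
  shows "cid_bounded r T"
proof -
  have "{r. 0 \<le> r \<and> cid_bounded r T} \<noteq> {}"
    using assms by (auto simp: mem_ccentre_iff)
  then obtain s where "cid_bounded s T" "s < r"
    using cInf_lessD[of "{r. 0 \<le> r \<and> cid_bounded r T}" r] assms(2)
    unfolding ccentre_norm_def modulus_le_iff_cid_bounded by blast
  then show ?thesis
    using cid_bounded_mono less_imp_le by blast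
qed

text \<open>\<open>ccentre_norm\<close> is an infimum on a subset of a type without a norm; this
  translates its convergence into order bounds, the form in which integrals are estimated.\<close>

lemma ccentre_tendsto_iff:
  fixes S :: "nat \<Rightarrow> 'a::dc_banach_lattice regop complexification"
  assumes "\<And>n. S n \<in> ccentre" "T \<in> ccentre"
  shows "(\<lambda>n. ccentre_norm (S n - T)) \<longlonglongrightarrow> 0 \<longleftrightarrow>
    (\<forall>e>0. \<exists>N. \<forall>n\<ge>N. cid_bounded e (S n - T))"
proof safe
  fix e :: real
  assume "(\<lambda>n. ccentre_norm (S n - T)) \<longlonglongrightarrow> 0" "0 < e"
  then obtain N where "\<forall>n\<ge>N. norm (ccentre_norm (S n - T) - 0) < e"
    using LIMSEQ_D by blast
  then have "\<forall>n\<ge>N. ccentre_norm (S n - T) < e"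
    by auto
  then show "\<exists>N. \<forall>n\<ge>N. cid_bounded e (S n - T)"
    using cid_bounded_if_ccentre_norm_less[OF ccentre_diff[OF assms]] by blast
next
  assume *: "\<forall>e>0. \<exists>N. \<forall>n\<ge>N. cid_bounded e (S n - T)"
  show "(\<lambda>n. ccentre_norm (S n - T)) \<longlonglongrightarrow> 0"
  proof (rule LIMSEQ_I)
    fix e :: real assume "0 < e"
    then obtain N where "\<forall>n\<ge>N. cid_bounded (e/2) (S n - T)"
      using * half_gt_zero by blast
    then have "\<forall>n\<ge>N. ccentre_norm (S n - T) \<le> e / 2"
      using \<open>0 < e\<close> ccentre_norm_le[of "e / 2" "S _ - T"] by simp
    then have "\<forall>n\<ge>N. norm (ccentre_norm (S n - T) - 0) < e"
      using ccentre_norm_nonneg[OF ccentre_diff[OF assms]] \<open>0 < e\<close> by fastforce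
    then show "\<exists>N. \<forall>n\<ge>N. norm (ccentre_norm (S n - T) - 0) < e"
      by blast
  qed
qed

lemma centre_if_nonneg_le:
  fixes S :: "'a::vector_lattice regop"
  assumes "0 \<le> S" "S \<le> r *\<^sub>R 1" "0 \<le> r"
  shows "S \<in> centre"
proof -
  have "- S \<le> S"
    using assms(1) by (meson neg_le_0_iff_le order_trans)
  \<comment> \<open>For positive S the set {S, - S} has greatest element S, which evaluates the
    description in \<open>regop_abs\<close>.\<close>
  then have "isLub UNIV {S, - S} m \<longleftrightarrow> m = S" for m
    unfolding isLub_UNIV_iff by (auto intro: order.antisym)
  then have "regop_abs S = S"
    by (simp add: regop_abs_def)
  then show ?thesis
    using assms by (auto simp: centre_def)
qed

lemma capply_simps [simp]:
  "capply 1 z = z" "capply (S * T) z = capply S (capply T z)"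
  "capply (S + T) z = capply S z + capply T z" "capply (S - T) z = capply S z - capply T z"
  "capply (c *\<^sub>C T) z = c *\<^sub>C capply T z"
  "capply T (z + w) = capply T z + capply T w" "capply T (c *\<^sub>C z) = c *\<^sub>C capply T z"
  "capply T (r *\<^sub>R z) = r *\<^sub>R capply T z"
  by (rule complexification_eqI;
      simp add: capply_def one_complexification_def times_complexification_def scaleC_def algebra_simps)+

lemma scaleC_simps [simp]:
  "c *\<^sub>C (z + w) = c *\<^sub>C z + c *\<^sub>C w" "c *\<^sub>C (z - w) = c *\<^sub>C z - c *\<^sub>C w"
  "(c - d) *\<^sub>C z = c *\<^sub>C z - d *\<^sub>C z" "c *\<^sub>C d *\<^sub>C z = (c * d) *\<^sub>C z" "1 *\<^sub>C z = z"
  "c *\<^sub>C (r *\<^sub>R z) = r *\<^sub>R (c *\<^sub>C z)"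
  by (rule complexification_eqI; simp add: scaleC_def algebra_simps)+

section \<open>The spectrum is compact\<close>

lemma rotated_re_le_modulus:
  fixes z :: "'a::dc_banach_lattice complexification"
  shows "rotated_re \<theta> z \<le> modulus z"
  unfolding rotated_re_def by (rule modulus_upper)

lemma modulus_leI:
  fixes z :: "'a::dc_banach_lattice complexification"
  shows "(\<And>\<theta>. rotated_re \<theta> z \<le> u) \<Longrightarrow> modulus z \<le> u"
  unfolding rotated_re_def by (rule modulus_least)

lemma modulus_scaleC_le:
  fixes z :: "'a::dc_banach_lattice complexification"
  shows "modulus (c *\<^sub>C z) \<le> cmod c *\<^sub>R modulus z"
  using scaleC_rcis_rotated_re[of _ "cmod c" "Arg c" z]
  by (intro modulus_leI) (simp add: rcis_cmod_Arg scaleR_left_mono rotated_re_le_modulus)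

lemma norm_le_if_modulus_le:
  fixes z w :: "'a::dc_banach_lattice complexification"
  assumes "modulus z \<le> r *\<^sub>R modulus w" "0 \<le> r"
  shows "norm z \<le> r * norm w"
proof -
  have "norm (modulus z) \<le> norm (r *\<^sub>R modulus w)"
    using assms by (intro norm_mono_abs) (simp add: modulus_nonneg scaleR_nonneg_nonneg)
  then show ?thesis
    using assms by (simp add: norm_complexification_def)
qed

lemma norm_scaleC_le:
  fixes z :: "'a::dc_banach_lattice complexification"
  shows "norm (c *\<^sub>C z) \<le> cmod c * norm z"
  by (intro norm_le_if_modulus_le modulus_scaleC_le) simp

lemma norm_re_le: "norm (re z) \<le> norm (z :: 'a::dc_banach_lattice complexification)"
  unfolding norm_complexification_def using modulus_upper_abs[of 0 z]
  by (intro norm_mono_abs) (simp add: modulus_nonneg)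

lemma norm_im_le: "norm (im z) \<le> norm (z :: 'a::dc_banach_lattice complexification)"
  unfolding norm_complexification_def using modulus_upper_abs[of "pi / 2" z]
  by (intro norm_mono_abs) (simp add: modulus_nonneg)

lemma norm_abs [simp]: "norm \<bar>x\<bar> = norm (x :: 'a::dc_banach_lattice)"
  by (intro order.antisym norm_mono_abs) simp_all

lemma norm_complexification_le:
  "norm z \<le> norm (re z) + norm (im (z :: 'a::dc_banach_lattice complexification))"
proof -
  have "modulus z \<le> \<bar>re z\<bar> + \<bar>im z\<bar>"
    by (intro modulus_least add_mono scaleR_le_abs) simp_all
  then have "norm z \<le> norm (\<bar>re z\<bar> + \<bar>im z\<bar>)"
    unfolding norm_complexification_def by (intro norm_mono_abs) (simp add: modulus_nonneg)
  also have "\<dots> \<le> norm \<bar>re z\<bar> + norm \<bar>im z\<bar>"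
    by (rule norm_triangle_ineq)
  finally show ?thesis
    by simp
qed

text \<open>Completeness is inherited from E, since the norm of z dominates the norms of its two
  parts and is at most their sum. The contraction principle below relies on it.\<close>

instance complexification :: (dc_banach_lattice) banach
proof
  fix X :: "nat \<Rightarrow> 'a complexification"
  assume X: "Cauchy X"
  have "Cauchy (\<lambda>n. re (X n))" "Cauchy (\<lambda>n. im (X n))"
    using X norm_re_le[of "X _ - X _"] norm_im_le[of "X _ - X _"]
    unfolding Cauchy_iff by (metis complexification_simps(7,8) le_less_trans)+
  then obtain x y where xy: "(\<lambda>n. re (X n)) \<longlonglongrightarrow> x" "(\<lambda>n. im (X n)) \<longlonglongrightarrow> y"
    by (meson Cauchy_convergent convergentD)
  have "(\<lambda>n. norm (re (X n) - x) + norm (im (X n) - y)) \<longlonglongrightarrow> 0 + 0"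
    using xy by (intro tendsto_add) (simp_all add: LIM_zero tendsto_norm_zero)
  then have "(\<lambda>n. X n - Cplx x y) \<longlonglongrightarrow> 0"
    using norm_complexification_le[of "X _ - Cplx x y"]
    by (intro Lim_null_comparison[of "\<lambda>n. X n - Cplx x y" "\<lambda>n. norm (re (X n) - x) + norm (im (X n) - y)"]) auto
  then show "convergent X"
    using LIM_zero_cancel convergent_def by blast
qed

text \<open>Solving G z - D z = w means finding a fixed point of z -> B (w + D z), a contraction
  with constant b * d; the estimate \<open>lower\<close> gives injectivity and the bound on the
  inverse.\<close>

lemma perturbed_inverse:
  fixes G B D :: "'a::dc_banach_lattice complexification \<Rightarrow> 'a complexification"
  assumes G: "linear G" "\<And>c z. G (c *\<^sub>C z) = c *\<^sub>C G z"
    and D: "linear D" "\<And>c z. D (c *\<^sub>C z) = c *\<^sub>C D z" "\<And>z. norm (D z) \<le> d * norm z"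
    and B: "linear B" "\<And>z. norm (B z) \<le> b * norm z" "\<And>z. B (G z) = z" "\<And>z. G (B z) = z"
    and bd: "0 \<le> b" "0 \<le> d" "b * d < 1"
  shows "\<exists>C. bounded_clinear C \<and> (\<forall>z. C (G z - D z) = z) \<and> (\<forall>z. G (C z) - D (C z) = z)"
proof -
  define H where "H z = G z - D z" for z
  have H: "linear H" "\<And>c z. H (c *\<^sub>C z) = c *\<^sub>C H z"
    using G D by (auto simp: H_def[abs_def] linear_compose_sub)
  have lower: "(1 - b * d) * norm z \<le> b * norm (H z)" for z
  proof -
    have "z = B (H z + D z)"
      by (simp add: H_def B(3))
    then have "norm z \<le> b * norm (H z + D z)"
      using B(2) by metis
    also have "\<dots> \<le> b * (norm (H z) + d * norm z)"
      using bd D(3) by (intro mult_left_mono norm_triangle_le add_left_mono)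
    finally show ?thesis
      by (simp add: algebra_simps)
  qed
  have inj: "inj H"
    unfolding linear_injective_0[OF H(1)]
    using lower bd(3) by (metis diff_gt_0_iff_gt mult_zero_right norm_zero norm_le_zero_iff mult_le_0_iff linorder_not_less)
  have "\<exists>z. H z = w" for w
  proof -
    have "dist (B (w + D x)) (B (w + D y)) \<le> b * d * dist x y" for x y
    proof -
      have "B (w + D x) - B (w + D y) = B (D (x - y))"
        by (simp add: linear_diff[OF B(1)] linear_add[OF B(1)] linear_diff[OF D(1)])
      moreover have "norm (B (D (x - y))) \<le> b * (d * norm (x - y))"
        using B(2)[of "D (x - y)"] mult_left_mono[OF D(3) bd(1)] by (rule order_trans)
      ultimately show ?thesis
        by (simp add: dist_norm mult.assoc)
    qed
    then have "\<exists>!z. B (w + D z) = z"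
      using bd by (intro banach_fix_type[of "b * d"]) auto
    then obtain z where "B (w + D z) = z"
      by blast
    then have "H z = w"
      unfolding H_def using B(4)[of "w + D z"] by simp
    then show ?thesis ..
  qed
  then have "bij H"
    using inj by (metis bijI surjI)
  then have CH: "inv H (H z) = z" "H (inv H z) = z" for z
    using bij_is_surj[of H] surj_f_inv_f[of H] inj by auto
  have "inv H (c *\<^sub>C z) = c *\<^sub>C inv H z" for c z
    using CH by (metis H(2))
  moreover have "bounded_linear (inv H)"
  proof (rule bounded_linear_intro[of _ "b / (1 - b * d)"])
    show "inv H (x + y) = inv H x + inv H y" for x y
      using CH by (metis linear_add[OF H(1)])
    show "inv H (r *\<^sub>R x) = r *\<^sub>R inv H x" for r x
      using CH by (metis linear_cmul[OF H(1)])
    show "norm (inv H x) \<le> norm x * (b / (1 - b * d))" for x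
      using lower[of "inv H x"] bd(3) by (simp add: CH field_simps)
  qed
  ultimately show ?thesis
    using CH unfolding bounded_clinear_def H_def[symmetric] by blast
qed

lemma linear_scaleC: "linear (\<lambda>z. c *\<^sub>C z)"
  by (rule linearI) simp_all

lemma compact_spectrum:
  fixes A :: "'a::dc_banach_lattice complexification \<Rightarrow> 'a complexification"
  assumes A: "bounded_clinear A"
  shows "compact (spectrum A)"
proof -
  have lin: "linear A" and cl: "\<And>c z. A (c *\<^sub>C z) = c *\<^sub>C A z"
    using A by (auto simp: bounded_clinear_def bounded_linear.linear)
  obtain K where K: "0 < K" "\<And>z. norm (A z) \<le> K * norm z"
    using A bounded_linear.pos_bounded unfolding bounded_clinear_def by (metis mult.commute)
  have "spectrum A \<subseteq> cball 0 K"
  proof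
    fix c assume c: "c \<in> spectrum A"
    show "c \<in> cball 0 K"
    proof (rule ccontr)
      assume "c \<notin> cball 0 K"
      then have cK: "K < cmod c" and "c \<noteq> 0"
        using K by auto
      \<comment> \<open>Beyond radius K the operator A is a perturbation of the scalar c, whose
        inverse has norm at most 1 / cmod c.\<close>
      have "\<exists>C. bounded_clinear C \<and> (\<forall>z. C (c *\<^sub>C z - A z) = z) \<and> (\<forall>z. c *\<^sub>C C z - A (C z) = z)"
        using K(1) cK \<open>c \<noteq> 0\<close>
        by (intro perturbed_inverse[of "\<lambda>z. c *\<^sub>C z" A K "\<lambda>z. inverse c *\<^sub>C z" "cmod (inverse c)"]
            K(2) lin linear_scaleC norm_scaleC_le cl)
          (simp_all add: mult.commute norm_inverse, simp add: divide_simps)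
      then show False
        using c unfolding spectrum_def by blast
    qed
  qed
  moreover have "open (- spectrum A)"
  proof (rule openI)
    fix c assume "c \<in> - spectrum A"
    then obtain B where B: "bounded_clinear B" "\<And>z. B (c *\<^sub>C z - A z) = z" "\<And>z. c *\<^sub>C B z - A (B z) = z"
      by (auto simp: spectrum_def)
    obtain b where b: "0 < b" "\<And>z. norm (B z) \<le> b * norm z"
      using B(1) bounded_linear.pos_bounded unfolding bounded_clinear_def by (metis mult.commute)
    \<comment> \<open>The radius 1 / b makes c' - A = (c - A) - (c - c') an admissible perturbation:
      b * cmod (c - c') < 1.\<close>
    have "c' \<notin> spectrum A" if "c' \<in> ball c (1 / b)" for c'
    proof -
      have "b * cmod (c - c') < 1"
        using that b(1) by (simp add: dist_norm field_simps)
      moreover have "linear B"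
        using B(1) by (simp add: bounded_clinear_def bounded_linear.linear)
      ultimately have "\<exists>C. bounded_clinear C \<and> (\<forall>z. C (c *\<^sub>C z - A z - (c - c') *\<^sub>C z) = z) \<and>
          (\<forall>z. c *\<^sub>C C z - A (C z) - (c - c') *\<^sub>C C z = z)"
        using B(2,3) b lin cl
        by (intro perturbed_inverse[of "\<lambda>z. c *\<^sub>C z - A z" "\<lambda>z. (c - c') *\<^sub>C z" "cmod (c - c')" B b]
            norm_scaleC_le linear_scaleC linear_compose_sub)
          (simp_all add: algebra_simps)
      moreover have "c *\<^sub>C z - A z' - (c - c') *\<^sub>C z = c' *\<^sub>C z - A z'" for z z'
        by simp
      ultimately show ?thesis
        by (simp add: spectrum_def)
    qed
    then show "\<exists>e>0. ball c e \<subseteq> - spectrum A"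
      using b(1) by (intro exI[of _ "1 / b"]) auto
  qed
  ultimately show ?thesis
    by (meson bounded_cball bounded_subset closed_def compact_eq_bounded_closed)
qed

lemma bounded_clinear_capply:
  fixes T :: "'a::dc_banach_lattice regop complexification"
  assumes "T \<in> ccentre"
  shows "bounded_clinear (capply T)"
proof -
  obtain r where r: "0 \<le> r" "cid_bounded r T"
    using assms by (auto simp: mem_ccentre_iff)
  have *: "norm (rapply A x) \<le> r * norm x" if "id_bounded r A" for A and x :: 'a
  proof -
    have "norm (rapply A x) \<le> norm (r *\<^sub>R \<bar>x\<bar>)"
      using id_bounded_abs_le[OF that, of x] r(1)
      by (intro norm_mono_abs) (simp add: scaleR_nonneg_nonneg)
    then show ?thesis
      using r(1) by simp
  qed
  \<comment> \<open>Four terms arise, two in each part of T z, each of norm at most r * norm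
    z.\<close>
  have "norm (capply T z) \<le> norm z * (4 * r)" for z
  proof -
    have b: "norm (rapply A x) \<le> r * norm z" if "id_bounded r A" "norm x \<le> norm z" for A and x :: 'a
      using *[OF that(1), of x] mult_left_mono[OF that(2) r(1)] by linarith
    have "norm (capply T z) \<le> norm (rapply (re T) (re z) - rapply (im T) (im z)) +
        norm (rapply (re T) (im z) + rapply (im T) (re z))"
      using norm_complexification_le[of "capply T z"] by (simp add: capply_def)
    also have "\<dots> \<le> (r * norm z + r * norm z) + (r * norm z + r * norm z)"
      by (intro add_mono norm_triangle_le_diff norm_triangle_le b cid_bounded_re[OF r(2)]
          cid_bounded_im[OF r(2)] norm_re_le norm_im_le)
    finally show ?thesis
      by (simp add: mult_ac)
  qed
  then show ?thesis
    unfolding bounded_clinear_def by (auto intro!: bounded_linear_intro[of _ "4 * r"])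
qed

section \<open>Order integrals with respect to a spectral measure\<close>

lemma isLub_iff:
  "isLub C A s \<longleftrightarrow> s \<in> C \<and> (\<forall>a\<in>A. a \<le> s) \<and> (\<forall>u\<in>C. (\<forall>a\<in>A. a \<le> u) \<longrightarrow> s \<le> u)"
  by (auto simp: isLub_def isUb_def leastP_def setle_def setge_def)

lemma isGlb_iff:
  "isGlb C A s \<longleftrightarrow> s \<in> C \<and> (\<forall>a\<in>A. s \<le> a) \<and> (\<forall>u\<in>C. (\<forall>a\<in>A. u \<le> a) \<longrightarrow> u \<le> s)"
  by (auto simp: isGlb_def isLb_def greatestP_def setle_def setge_def)

section \<open>Bounded measurable functions\<close>

text \<open>Functions are total and only their values on \<open>space M\<close> count. Unlike in
  \<open>bounded_borel\<close>, no value outside is prescribed, so sums and products stay in the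
  class without being restricted.\<close>

definition bounded_measurable :: "'s measure \<Rightarrow> ('s \<Rightarrow> 'b::{real_normed_vector}) \<Rightarrow> bool" where
  "bounded_measurable M f \<longleftrightarrow> f \<in> borel_measurable M \<and> (\<exists>K. \<forall>x\<in>space M. norm (f x) \<le> K)"

lemma bounded_measurableI:
  "f \<in> borel_measurable M \<Longrightarrow> (\<And>x. x \<in> space M \<Longrightarrow> norm (f x) \<le> K) \<Longrightarrow> bounded_measurable M f"
  by (auto simp: bounded_measurable_def)

lemma bounded_measurable_bound:
  assumes "bounded_measurable M f"
  obtains K where "0 < K" "\<And>x. x \<in> space M \<Longrightarrow> norm (f x) \<le> K"
proof -
  obtain K where "\<forall>x\<in>space M. norm (f x) \<le> K"
    using assms by (auto simp: bounded_measurable_def)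
  then have "\<forall>x\<in>space M. norm (f x) \<le> max K 1"
    by (meson max.coboundedI1)
  then show ?thesis
    using that[of "max K 1"] by auto
qed

lemma bounded_measurable_measurable [measurable_dest]:
  "bounded_measurable M f \<Longrightarrow> f \<in> borel_measurable M"
  by (simp add: bounded_measurable_def)

lemma bounded_measurable_add:
  fixes f g :: "'s \<Rightarrow> 'b::{second_countable_topology, real_normed_vector}"
  assumes "bounded_measurable M f" "bounded_measurable M g"
  shows "bounded_measurable M (\<lambda>x. f x + g x)"
proof -
  obtain K L where "\<And>x. x \<in> space M \<Longrightarrow> norm (f x) \<le> K" "\<And>x. x \<in> space M \<Longrightarrow> norm (g x) \<le> L"
    using bounded_measurable_bound assms by metis
  then show ?thesis
    using assms by (intro bounded_measurableI[of _ _ "K + L"])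
      (auto intro: norm_triangle_mono bounded_measurable_measurable borel_measurable_add)
qed

lemma bounded_measurable_mult:
  fixes f g :: "'s \<Rightarrow> 'b::{second_countable_topology, real_normed_field}"
  assumes "bounded_measurable M f" "bounded_measurable M g"
  shows "bounded_measurable M (\<lambda>x. f x * g x)"
proof -
  obtain K L where "0 < K" "\<And>x. x \<in> space M \<Longrightarrow> norm (f x) \<le> K" "\<And>x. x \<in> space M \<Longrightarrow> norm (g x) \<le> L"
    using bounded_measurable_bound assms by metis
  then show ?thesis
    using assms by (intro bounded_measurableI[of _ _ "K * L"])
      (auto intro!: bounded_measurable_measurable borel_measurable_times mult_mono simp: norm_mult)
qed

lemma bounded_measurable_const [simp]: "bounded_measurable M (\<lambda>_. c)"
  by (rule bounded_measurableI[of _ _ "norm c"]) auto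

lemma bounded_measurable_scale:
  fixes f :: "'s \<Rightarrow> 'b::{second_countable_topology, real_normed_field}"
  shows "bounded_measurable M f \<Longrightarrow> bounded_measurable M (\<lambda>x. c * f x)"
  by (rule bounded_measurable_mult) auto

lemma bounded_measurable_diff:
  fixes f g :: "'s \<Rightarrow> 'b::{second_countable_topology, real_normed_field}"
  assumes "bounded_measurable M f" "bounded_measurable M g"
  shows "bounded_measurable M (\<lambda>x. f x - g x)"
  using bounded_measurable_add[OF assms(1) bounded_measurable_scale[OF assms(2), of "- 1"]] by simp

lemma bounded_measurable_norm:
  "bounded_measurable M f \<Longrightarrow> bounded_measurable M (\<lambda>x. norm (f x))"
  unfolding bounded_measurable_def by auto

lemma bounded_measurable_indicator:
  "A \<in> sets M \<Longrightarrow> bounded_measurable M (indicator A :: _ \<Rightarrow> real)"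
  by (rule bounded_measurableI[of _ _ 1]) (auto simp: indicator_def)

lemma bounded_measurable_simple:
  fixes \<phi> :: "'s \<Rightarrow> real"
  assumes "simple_function M \<phi>"
  shows "bounded_measurable M \<phi>"
proof -
  have "bounded (\<phi> ` space M)"
    using assms by (intro finite_imp_bounded simple_functionD)
  then show ?thesis
    using borel_measurable_simple_function[OF assms] by (auto simp: bounded_measurable_def bounded_iff)
qed

lemma bounded_measurable_cong:
  "bounded_measurable M f \<Longrightarrow> (\<And>x. x \<in> space M \<Longrightarrow> g x = f x) \<Longrightarrow> bounded_measurable M g"
  unfolding bounded_measurable_def using measurable_cong[of M g f] by auto

lemma bounded_measurable_Re_Im:
  assumes "bounded_measurable M f"
  shows "bounded_measurable M (\<lambda>x. Re (f x))" "bounded_measurable M (\<lambda>x. Im (f x))"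
proof -
  obtain K where K: "\<And>x. x \<in> space M \<Longrightarrow> norm (f x) \<le> K"
    using bounded_measurable_bound[OF assms] by blast
  show "bounded_measurable M (\<lambda>x. Re (f x))"
    using K bounded_measurable_measurable[OF assms]
    by (intro bounded_measurableI[of _ _ K]) (auto intro: order_trans[OF abs_Re_le_cmod])
  show "bounded_measurable M (\<lambda>x. Im (f x))"
    using K bounded_measurable_measurable[OF assms]
    by (intro bounded_measurableI[of _ _ K]) (auto intro: order_trans[OF abs_Im_le_cmod])
qed

lemma bounded_measurable_cnj:
  "bounded_measurable M f \<Longrightarrow> bounded_measurable M (\<lambda>x. cnj (f x))"
  by (auto simp: bounded_measurable_def intro: borel_measurable_continuous_on[of cnj] continuous_intros)

lemma bounded_measurable_max_0:
  fixes f :: "'s \<Rightarrow> real"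
  assumes "bounded_measurable M f"
  shows "bounded_measurable M (\<lambda>x. max (f x) 0)"
proof -
  obtain K where K: "\<And>x. x \<in> space M \<Longrightarrow> norm (f x) \<le> K"
    using bounded_measurable_bound[OF assms] by blast
  then show ?thesis
    using bounded_measurable_measurable[OF assms] by (intro bounded_measurableI[of _ _ K]) force+
qed

section \<open>Elementary properties of a spectral measure of total mass 1\<close>

locale unital_spectral_measure =
  fixes M :: "'s measure" and \<mu> :: "'s set \<Rightarrow> 'a::dc_banach_lattice regop"
  assumes spectral: "spectral_measure M \<mu>" and total: "\<mu> (space M) = 1"
begin

lemma nonneg: "A \<in> sets M \<Longrightarrow> 0 \<le> \<mu> A"
  and empty [simp]: "\<mu> {} = 0"
  and inter: "A \<in> sets M \<Longrightarrow> B \<in> sets M \<Longrightarrow> \<mu> (A \<inter> B) = \<mu> A * \<mu> B"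
  and sigma_additive: "range \<Delta> \<subseteq> sets M \<Longrightarrow> disjoint_family (\<Delta> :: nat \<Rightarrow> _) \<Longrightarrow>
    isLub centre (range (\<lambda>N. \<Sum>n\<le>N. \<mu> (\<Delta> n))) (\<mu> (\<Union>n. \<Delta> n))"
  using spectral by (auto simp: spectral_measure_def centre_measure_def)

text \<open>The sequence A, B, {}, {}, ... makes countable additivity yield the finite one; its
  partial sums take only two values.\<close>

lemma binaryset_sums:
  "range (\<lambda>N. \<Sum>n\<le>N. \<mu> (binaryset A B n)) = {\<mu> A, \<mu> A + \<mu> B}"
proof -
  have "(\<Sum>n\<le>Suc N. \<mu> (binaryset A B n)) = \<mu> A + \<mu> B" for N
    by (induction N) (auto simp: binaryset_def)
  then have *: "(\<Sum>n\<le>N. \<mu> (binaryset A B n)) = (if N = 0 then \<mu> A else \<mu> A + \<mu> B)" for N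
    by (cases N) (auto simp: binaryset_def)
  show ?thesis
    unfolding * by (auto simp: image_iff)
qed

lemma binary_isLub:
  assumes "A \<in> sets M" "B \<in> sets M" "A \<inter> B = {}"
  shows "isLub centre {\<mu> A, \<mu> A + \<mu> B} (\<mu> (A \<union> B))"
proof -
  have "disjoint_family (binaryset A B)"
    using assms by (auto simp: disjoint_family_on_def binaryset_def)
  then have "isLub centre (range (\<lambda>N. \<Sum>n\<le>N. \<mu> (binaryset A B n))) (\<mu> (\<Union>n. binaryset A B n))"
    using assms by (intro sigma_additive) (auto simp: range_binaryset_eq)
  then show ?thesis
    unfolding binaryset_sums UN_binaryset_eq .
qed

text \<open>The only input is that \<mu> A occurs among the partial sums for the whole space, so
  this bound is available before additivity.\<close>

lemma le_one: "A \<in> sets M \<Longrightarrow> \<mu> A \<le> 1"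
  using binary_isLub[of A "space M - A"] total sets.sets_into_space[of A M]
  by (auto simp: isLub_iff Un_absorb1)

lemma additive:
  assumes "A \<in> sets M" "B \<in> sets M" "A \<inter> B = {}"
  shows "\<mu> (A \<union> B) = \<mu> A + \<mu> B"
proof (rule order.antisym)
  have "\<mu> A + \<mu> B \<le> 2 *\<^sub>R 1"
    using add_mono[OF le_one le_one] assms by (simp add: scaleR_2)
  \<comment> \<open>The supremum in the definition of a measure is tested against central operators,
    so the candidate bound has to be placed in the centre.\<close>
  then have "\<mu> A + \<mu> B \<in> centre"
    using assms nonneg by (intro centre_if_nonneg_le[of _ 2]) auto
  then show "\<mu> (A \<union> B) \<le> \<mu> A + \<mu> B"
    using binary_isLub[OF assms] nonneg[OF assms(2)] unfolding isLub_iff by auto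
  show "\<mu> A + \<mu> B \<le> \<mu> (A \<union> B)"
    using binary_isLub[OF assms] unfolding isLub_iff by auto
qed

lemma diff:
  assumes "A \<in> sets M" "B \<in> sets M" "B \<subseteq> A"
  shows "\<mu> (A - B) = \<mu> A - \<mu> B"
  using additive[of "A - B" B] assms by (simp add: sup_absorb1 Int_commute)

lemma mono: "A \<in> sets M \<Longrightarrow> B \<in> sets M \<Longrightarrow> B \<subseteq> A \<Longrightarrow> \<mu> B \<le> \<mu> A"
  using diff[of A B] nonneg[of "A - B"] by auto

lemma finite_additive:
  assumes "finite I" "\<And>i. i \<in> I \<Longrightarrow> A i \<in> sets M" "disjoint_family_on A I"
  shows "\<mu> (\<Union>i\<in>I. A i) = (\<Sum>i\<in>I. \<mu> (A i))"
  using assms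
proof (induction I)
  case (insert i I)
  have "A i \<inter> (\<Union>i\<in>I. A i) = {}"
    using insert.prems(2) insert.hyps(2) by (auto simp: disjoint_family_on_def)
  moreover have "disjoint_family_on A I"
    using insert.prems(2) by (auto simp: disjoint_family_on_def)
  moreover have "(\<Union>i\<in>I. A i) \<in> sets M"
    using insert.hyps(1) insert.prems(1) by (intro sets.finite_UN) auto
  ultimately show ?case
    using insert additive[of "A i" "\<Union>i\<in>I. A i"] by auto
qed auto

text \<open>Let w be the infimum of \<mu> (A n), computed vector by vector. Countable additivity
  over the differences A n - A (Suc n) makes \<mu> (A 0) the supremum of \<mu> (A 0) - \<mu> (A (Suc
  n)), while \<mu> (A 0) - w is a central upper bound of these; hence w \<le> 0. Phrasing the
  conclusion at a vector x also controls infima in E.\<close>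

lemma continuous_from_above:
  assumes A: "\<And>n. A n \<in> sets M" "decseq A" "(\<Inter>n. A n) = {}"
    and x: "0 \<le> x" "\<And>n. b \<le> rapply (\<mu> (A n)) x"
  shows "b \<le> 0"
proof -
  have "decseq (\<lambda>n. \<mu> (A n))"
    using A(1,2) mono by (auto simp: decseq_def)
  then obtain w where w: "0 \<le> w" "\<And>x. 0 \<le> x \<Longrightarrow> rapply w x = (INF n. rapply (\<mu> (A n)) x)"
    using regop_decseq_Inf[of "\<lambda>n. \<mu> (A n)"] nonneg A(1) by blast
  have le: "w \<le> \<mu> (A n)" for n
  proof (rule regop_leI)
    fix y :: 'a assume "0 \<le> y"
    then have "bdd_below (range (\<lambda>n. rapply (\<mu> (A n)) y))"
      using regop_leD[OF nonneg[OF A(1)]] by (intro bdd_belowI[of _ 0]) auto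
    then show "rapply w y \<le> rapply (\<mu> (A n)) y"
      unfolding w(2)[OF \<open>0 \<le> y\<close>] by (rule cINF_lower) simp
  qed
  define B where "B n = A n - A (Suc n)" for n
  have dec: "A n \<subseteq> A m" if "m \<le> n" for m n
    using A(2) that by (simp add: decseq_def)
  have "B m \<inter> B n = {}" if "m < n" for m n
    using dec[of "Suc m" n] that by (auto simp: B_def)
  then have "disjoint_family B"
    unfolding disjoint_family_on_def by (metis Int_commute nat_neq_iff)
  moreover have "(\<Union>n. B n) = A 0"
  proof
    show "A 0 \<subseteq> (\<Union>n. B n)"
    proof
      fix y assume y: "y \<in> A 0"
      \<comment> \<open>The first set missing y; it has a predecessor because y lies in A 0, and
        that predecessor still contains y.\<close>
      define n where "n = (LEAST n. y \<notin> A n)"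
      have "\<exists>n. y \<notin> A n"
        using A(3) by blast
      then have "y \<notin> A n"
        unfolding n_def by (rule LeastI_ex)
      then obtain k where k: "n = Suc k"
        using y by (cases n) auto
      then have "y \<in> A k"
        using not_less_Least[of k "\<lambda>n. y \<notin> A n"] unfolding n_def by auto
      then show "y \<in> (\<Union>n. B n)"
        using \<open>y \<notin> A n\<close> k by (auto simp: B_def)
    qed
  qed (use A(2) in \<open>auto simp: B_def decseq_def\<close>)
  moreover have "(\<Sum>n\<le>N. \<mu> (B n)) = \<mu> (A 0) - \<mu> (A (Suc N))" for N
    by (induction N) (use A in \<open>simp_all add: B_def diff decseq_SucD\<close>)
  moreover have "range B \<subseteq> sets M"
    using A(1) by (auto simp: B_def)
  ultimately have lub: "isLub centre (range (\<lambda>N. \<mu> (A 0) - \<mu> (A (Suc N)))) (\<mu> (A 0))"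
    using sigma_additive[of B] by simp
  have "\<mu> (A 0) - w \<le> 1 *\<^sub>R 1"
    using le_one[OF A(1), of 0] w(1) by (metis add_increasing2 diff_le_eq scaleR_one)
  then have "\<mu> (A 0) - w \<in> centre"
    using le by (intro centre_if_nonneg_le[of _ 1]) auto
  then have "\<mu> (A 0) \<le> \<mu> (A 0) - w"
    using lub le unfolding isLub_iff by auto
  then have "w \<le> 0"
    by (metis diff_add_cancel add_le_same_cancel1 le_diff_eq)
  then have "rapply w x \<le> 0"
    using regop_leD[of w 0 x] x(1) by simp
  moreover have "b \<le> rapply w x"
    unfolding w(2)[OF x(1)] using x(2) by (intro cINF_greatest) auto
  ultimately show ?thesis
    by (rule order_trans[rotated])
qed

section \<open>Integrals of simple functions\<close>

abbreviation I :: "('s \<Rightarrow> real) \<Rightarrow> 'a regop" where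
  "I \<equiv> order_integral_simple M \<mu>"

text \<open>An integrand that factors through h may be summed over the level sets of h. With h the
  pair of two simple functions this provides the common refinement for sums, comparisons and
  products.\<close>

lemma simple_comp:
  assumes "simple_function M h"
  shows "I (\<lambda>x. g (h x)) = (\<Sum>y\<in>h ` space M. g y *\<^sub>R \<mu> (h -` {y} \<inter> space M))"
proof -
  have fin: "finite (h ` space M)" and meas: "\<And>y. h -` {y} \<inter> space M \<in> sets M"
    using assms by (auto simp: simple_functionD)
  have *: "\<mu> ((\<lambda>x. g (h x)) -` {r} \<inter> space M) = (\<Sum>y\<in>{y\<in>h ` space M. g y = r}. \<mu> (h -` {y} \<inter> space M))" for r
  proof -
    have "(\<lambda>x. g (h x)) -` {r} \<inter> space M = (\<Union>y\<in>{y\<in>h ` space M. g y = r}. h -` {y} \<inter> space M)"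
      by auto
    then show ?thesis
      using fin meas by (simp only:) (intro finite_additive, auto simp: disjoint_family_on_def)
  qed
  have "I (\<lambda>x. g (h x)) =
      (\<Sum>r\<in>g ` h ` space M. \<Sum>y\<in>{y\<in>h ` space M. g y = r}. g y *\<^sub>R \<mu> (h -` {y} \<inter> space M))"
    unfolding order_integral_simple_def * scaleR_sum_right image_image
    by (intro sum.cong refl) auto
  also have "\<dots> = (\<Sum>y\<in>h ` space M. g y *\<^sub>R \<mu> (h -` {y} \<inter> space M))"
    using fin by (intro sum.group) auto
  finally show ?thesis .
qed

lemma simple_add:
  assumes "simple_function M \<phi>" "simple_function M \<psi>"
  shows "I (\<lambda>x. \<phi> x + \<psi> x) = I \<phi> + I \<psi>"
  using simple_comp[OF simple_function_Pair[OF assms], of "\<lambda>p. fst p + snd p"]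
    simple_comp[OF simple_function_Pair[OF assms], of fst]
    simple_comp[OF simple_function_Pair[OF assms], of snd]
  by (simp add: scaleR_add_left sum.distrib)

lemma simple_scale:
  assumes "simple_function M \<phi>"
  shows "I (\<lambda>x. c * \<phi> x) = c *\<^sub>R I \<phi>"
  using simple_comp[OF assms, of "\<lambda>r. c * r"] simple_comp[OF assms, of "\<lambda>r. r"]
  by (simp add: scaleR_sum_right)

lemma simple_diff:
  assumes "simple_function M \<phi>" "simple_function M \<psi>"
  shows "I (\<lambda>x. \<phi> x - \<psi> x) = I \<phi> - I \<psi>"
proof -
  have "simple_function M (\<lambda>x. - 1 * \<psi> x)"
    by (rule simple_function_compose1[OF assms(2)])
  then show ?thesis
    using simple_add[OF assms(1), of "\<lambda>x. - 1 * \<psi> x"] simple_scale[OF assms(2), of "- 1"] by simp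
qed

lemma simple_mono:
  assumes "simple_function M \<phi>" "simple_function M \<psi>" "\<And>x. x \<in> space M \<Longrightarrow> \<phi> x \<le> \<psi> x"
  shows "I \<phi> \<le> I \<psi>"
proof -
  let ?h = "\<lambda>x. (\<phi> x, \<psi> x)"
  have "?h -` {y} \<inter> space M \<in> sets M" for y
    using simple_functionD[OF simple_function_Pair[OF assms(1,2)]] by blast
  then have "(\<Sum>y\<in>?h ` space M. fst y *\<^sub>R \<mu> (?h -` {y} \<inter> space M)) \<le>
      (\<Sum>y\<in>?h ` space M. snd y *\<^sub>R \<mu> (?h -` {y} \<inter> space M))"
    using assms(3) by (intro sum_mono scaleR_right_mono nonneg) auto
  then show ?thesis
    using simple_comp[OF simple_function_Pair[OF assms(1,2)], of fst]
      simple_comp[OF simple_function_Pair[OF assms(1,2)], of snd] by simp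
qed

lemma simple_const: "I (\<lambda>_. c) = c *\<^sub>R 1"
proof (cases "space M = {}")
  case True
  \<comment> \<open>On an empty space the total mass is both \<mu> {} = 0 and 1, so E is the zero
    lattice.\<close>
  then have "c *\<^sub>R 1 = (0 :: 'a regop)"
    using total empty by (metis scaleR_zero_right)
  then show ?thesis
    using True by (simp add: order_integral_simple_def)
next
  case False
  then have "(\<lambda>_. c) ` space M = {c}" "(\<lambda>_. c) -` {c} \<inter> space M = space M"
    by auto
  then show ?thesis
    using total by (simp add: order_integral_simple_def)
qed

lemma simple_indicator:
  assumes "A \<in> sets M"
  shows "I (indicator A) = \<mu> A"
proof -
  have "A \<subseteq> space M"
    using assms sets.sets_into_space by blast
  then have "indicator A -` {1 :: real} \<inter> space M = A"
    by (auto simp: indicator_def)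
  moreover have "I (indicator A) = (\<Sum>r\<in>{0, 1}. r *\<^sub>R \<mu> (indicator A -` {r} \<inter> space M))"
    unfolding order_integral_simple_def
  proof (intro sum.mono_neutral_left ballI)
    fix r :: real assume "r \<in> {0, 1} - indicator A ` space M"
    then have "indicator A -` {r} \<inter> space M = {}"
      by auto
    then show "r *\<^sub>R \<mu> (indicator A -` {r} \<inter> space M) = 0"
      by simp
  qed (auto simp: indicator_def)
  ultimately show ?thesis
    by simp
qed

text \<open>Level sets of the pair are intersections, and the spectral property turns their measures
  into products. Pairs of values that are not attained have empty level sets, so the sum may run
  over the full product of the ranges.\<close>

lemma simple_mult:
  assumes "simple_function M \<phi>" "simple_function M \<psi>"
  shows "I (\<lambda>x. \<phi> x * \<psi> x) = I \<phi> * I \<psi>"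
proof -
  let ?h = "\<lambda>x. (\<phi> x, \<psi> x)"
  have meas: "\<phi> -` {a} \<inter> space M \<in> sets M" "\<psi> -` {a} \<inter> space M \<in> sets M" for a
    using assms by (auto simp: simple_functionD)
  have *: "?h -` {(a, b)} \<inter> space M = (\<phi> -` {a} \<inter> space M) \<inter> (\<psi> -` {b} \<inter> space M)" for a b
    by auto
  have "I (\<lambda>x. \<phi> x * \<psi> x) = (\<Sum>y\<in>?h ` space M. (fst y * snd y) *\<^sub>R \<mu> (?h -` {y} \<inter> space M))"
    using simple_comp[OF simple_function_Pair[OF assms], of "\<lambda>p. fst p * snd p"] by simp
  also have "\<dots> = (\<Sum>y\<in>(\<phi> ` space M) \<times> (\<psi> ` space M). (fst y * snd y) *\<^sub>R \<mu> (?h -` {y} \<inter> space M))"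
  proof (intro sum.mono_neutral_left ballI)
    show "finite ((\<phi> ` space M) \<times> (\<psi> ` space M))"
      using assms by (auto simp: simple_functionD)
    fix y assume "y \<in> (\<phi> ` space M) \<times> (\<psi> ` space M) - ?h ` space M"
    then have "y \<notin> ?h ` space M"
      by simp
    then have "?h -` {y} \<inter> space M = {}"
      by blast
    then show "(fst y * snd y) *\<^sub>R \<mu> (?h -` {y} \<inter> space M) = 0"
      by simp
  qed auto
  also have "\<dots> = (\<Sum>a\<in>\<phi> ` space M. \<Sum>b\<in>\<psi> ` space M.
      (a *\<^sub>R \<mu> (\<phi> -` {a} \<inter> space M)) * (b *\<^sub>R \<mu> (\<psi> -` {b} \<inter> space M)))"
    unfolding sum.cartesian_product by (intro sum.cong refl) (auto simp: * inter meas mult.commute)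
  also have "\<dots> = I \<phi> * I \<psi>"
    unfolding order_integral_simple_def sum_product ..
  finally show ?thesis .
qed

section \<open>Integrals of bounded functions as uniform limits\<close>

text \<open>Uniform instead of the monotone approximation of \<open>order_integral_nonneg\<close>: linearity and
  multiplicativity pass to the limit at once.\<close>

definition is_integral :: "('s \<Rightarrow> real) \<Rightarrow> 'a regop \<Rightarrow> bool" where
  "is_integral f U \<longleftrightarrow> (\<forall>e>0. \<exists>\<phi>. simple_function M \<phi> \<and>
    (\<forall>x\<in>space M. \<bar>f x - \<phi> x\<bar> \<le> e) \<and> id_bounded e (U - I \<phi>))"

lemma is_integralE:
  assumes "is_integral f U" "0 < e"
  obtains \<phi> where "simple_function M \<phi>" "\<And>x. x \<in> space M \<Longrightarrow> \<bar>f x - \<phi> x\<bar> \<le> e" "id_bounded e (U - I \<phi>)"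
proof -
  obtain \<phi> where "simple_function M \<phi> \<and> (\<forall>x\<in>space M. \<bar>f x - \<phi> x\<bar> \<le> e) \<and> id_bounded e (U - I \<phi>)"
    using assms(1)[unfolded is_integral_def, THEN spec, THEN mp, OF assms(2)] by (elim exE)
  then show ?thesis
    by (intro that[of \<phi>]) simp_all
qed

lemma is_integral_simple: "simple_function M \<phi> \<Longrightarrow> is_integral \<phi> (I \<phi>)"
  unfolding is_integral_def by (intro allI impI exI[of _ \<phi>]) (auto simp: id_bounded_def scaleR_nonneg_nonneg)

lemma is_integral_mono:
  assumes "is_integral f U" "is_integral g V" "\<And>x. x \<in> space M \<Longrightarrow> f x \<le> g x"
  shows "U \<le> V"
proof -
  \<comment> \<open>Of the factor 4, two come from the errors of the simple functions and two from
    those of their integrals.\<close>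
  have "U - V \<le> e *\<^sub>R (4 *\<^sub>R 1)" if e: "0 < e" for e
  proof -
    obtain \<phi> where \<phi>: "simple_function M \<phi>" "\<And>x. x \<in> space M \<Longrightarrow> \<bar>f x - \<phi> x\<bar> \<le> e" "id_bounded e (U - I \<phi>)"
      using is_integralE[OF assms(1) e] by blast
    obtain \<psi> where \<psi>: "simple_function M \<psi>" "\<And>x. x \<in> space M \<Longrightarrow> \<bar>g x - \<psi> x\<bar> \<le> e" "id_bounded e (V - I \<psi>)"
      using is_integralE[OF assms(2) e] by blast
    have "\<phi> x - \<psi> x \<le> 2 * e" if "x \<in> space M" for x
      using \<phi>(2)[OF that] \<psi>(2)[OF that] assms(3)[OF that] by linarith
    then have "I \<phi> - I \<psi> \<le> (2 * e) *\<^sub>R 1"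
      using simple_mono[of "\<lambda>x. \<phi> x - \<psi> x" "\<lambda>_. 2 * e"] \<phi>(1) \<psi>(1) by (simp add: simple_diff simple_const)
    moreover have "(U - I \<phi>) - (V - I \<psi>) \<le> (e + e) *\<^sub>R 1"
      using id_bounded_diff[OF \<phi>(3) \<psi>(3)] by (simp add: id_bounded_def)
    ultimately have "(I \<phi> - I \<psi>) + ((U - I \<phi>) - (V - I \<psi>)) \<le> (2 * e) *\<^sub>R 1 + (e + e) *\<^sub>R 1"
      by (rule add_mono)
    also have "(2 * e) *\<^sub>R 1 + (e + e) *\<^sub>R (1 :: 'a regop) = e *\<^sub>R (4 *\<^sub>R 1)"
      by (simp flip: scaleR_add_left)
    finally show ?thesis
      by simp
  qed
  then have "U - V \<le> 0"
    by (rule regop_archimedean)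
  then show ?thesis
    by simp
qed

lemma is_integral_unique:
  assumes "is_integral f U" "is_integral g V" "\<And>x. x \<in> space M \<Longrightarrow> f x = g x"
  shows "U = V"
  using assms by (intro order.antisym) (auto intro: is_integral_mono)

lemma is_integral_bounded:
  assumes "is_integral f U" "\<And>x. x \<in> space M \<Longrightarrow> \<bar>f x\<bar> \<le> K"
  shows "id_bounded K U"
  using is_integral_mono[OF assms(1) is_integral_simple, of "\<lambda>_. K"]
    is_integral_mono[OF is_integral_simple assms(1), of "\<lambda>_. - K"] assms(2)
  by (simp add: id_bounded_def simple_const abs_le_iff minus_le_iff)

lemma is_integral_add:
  assumes "is_integral f U" "is_integral g V"
  shows "is_integral (\<lambda>x. f x + g x) (U + V)"
  unfolding is_integral_def
proof (intro allI impI)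
  fix e :: real assume "0 < e"
  then have e: "0 < e / 2"
    by simp
  obtain \<phi> where \<phi>: "simple_function M \<phi>" "\<And>x. x \<in> space M \<Longrightarrow> \<bar>f x - \<phi> x\<bar> \<le> e / 2" "id_bounded (e / 2) (U - I \<phi>)"
    using is_integralE[OF assms(1) e] by blast
  obtain \<psi> where \<psi>: "simple_function M \<psi>" "\<And>x. x \<in> space M \<Longrightarrow> \<bar>g x - \<psi> x\<bar> \<le> e / 2" "id_bounded (e / 2) (V - I \<psi>)"
    using is_integralE[OF assms(2) e] by blast
  have "\<bar>f x + g x - (\<phi> x + \<psi> x)\<bar> \<le> e" if "x \<in> space M" for x
    using \<phi>(2)[OF that] \<psi>(2)[OF that] by linarith
  moreover have "id_bounded e (U + V - I (\<lambda>x. \<phi> x + \<psi> x))"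
    using id_bounded_add[OF \<phi>(3) \<psi>(3)] by (simp add: simple_add \<phi> \<psi> algebra_simps)
  ultimately show "\<exists>\<phi>. simple_function M \<phi> \<and> (\<forall>x\<in>space M. \<bar>f x + g x - \<phi> x\<bar> \<le> e) \<and> id_bounded e (U + V - I \<phi>)"
    using \<phi>(1) \<psi>(1) by (intro exI[of _ "\<lambda>x. \<phi> x + \<psi> x"]) auto
qed

lemma is_integral_scale:
  assumes "is_integral f U"
  shows "is_integral (\<lambda>x. c * f x) (c *\<^sub>R U)"
  unfolding is_integral_def
proof (intro allI impI)
  fix e :: real assume "0 < e"
  define d where "d = e / (\<bar>c\<bar> + 1)"
  have "0 < d" and d: "\<bar>c\<bar> * d \<le> e"
    using \<open>0 < e\<close> by (auto simp: d_def field_simps)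
  obtain \<phi> where \<phi>: "simple_function M \<phi>" "\<And>x. x \<in> space M \<Longrightarrow> \<bar>f x - \<phi> x\<bar> \<le> d" "id_bounded d (U - I \<phi>)"
    using is_integralE[OF assms \<open>0 < d\<close>] by blast
  have "\<bar>c * f x - c * \<phi> x\<bar> \<le> e" if "x \<in> space M" for x
    using mult_left_mono[OF \<phi>(2)[OF that], of "\<bar>c\<bar>"] d by (simp add: abs_mult flip: right_diff_distrib)
  moreover have "id_bounded e (c *\<^sub>R U - I (\<lambda>x. c * \<phi> x))"
    using id_bounded_mono[OF id_bounded_scaleR[OF \<phi>(3)] d] by (simp add: simple_scale \<phi> algebra_simps)
  ultimately show "\<exists>\<phi>. simple_function M \<phi> \<and> (\<forall>x\<in>space M. \<bar>c * f x - \<phi> x\<bar> \<le> e) \<and> id_bounded e (c *\<^sub>R U - I \<phi>)"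
    using simple_function_compose1[OF \<phi>(1)] by (intro exI[of _ "\<lambda>x. c * \<phi> x"]) auto
qed

lemma is_integral_diff:
  assumes "is_integral f U" "is_integral g V"
  shows "is_integral (\<lambda>x. f x - g x) (U - V)"
  using is_integral_add[OF assms(1) is_integral_scale[OF assms(2), of "- 1"]] by simp

lemma is_integral_mult:
  assumes "is_integral f U" "is_integral g V"
    and K: "0 < K" "\<And>x. x \<in> space M \<Longrightarrow> \<bar>f x\<bar> \<le> K" "\<And>x. x \<in> space M \<Longrightarrow> \<bar>g x\<bar> \<le> K"
  shows "is_integral (\<lambda>x. f x * g x) (U * V)"
  unfolding is_integral_def
proof (intro allI impI)
  fix e :: real assume "0 < e"
  \<comment> \<open>The error of the product is at most d * K + (K + 1) * d, where K + 1 bounds the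
    approximant of f because d \<le> 1.\<close>
  define d where "d = min 1 (e / (2 * K + 1))"
  have d: "0 < d" "d \<le> 1"
    using \<open>0 < e\<close> K(1) by (auto simp: d_def)
  have "(2 * K + 1) * d \<le> (2 * K + 1) * (e / (2 * K + 1))"
    using K(1) by (intro mult_left_mono) (auto simp: d_def)
  also have "\<dots> = e"
    using K(1) by simp
  finally have de: "d * K + (K + 1) * d \<le> e"
    by (simp add: algebra_simps)
  obtain \<phi> where \<phi>: "simple_function M \<phi>" "\<And>x. x \<in> space M \<Longrightarrow> \<bar>f x - \<phi> x\<bar> \<le> d" "id_bounded d (U - I \<phi>)"
    using is_integralE[OF assms(1) d(1)] by blast
  obtain \<psi> where \<psi>: "simple_function M \<psi>" "\<And>x. x \<in> space M \<Longrightarrow> \<bar>g x - \<psi> x\<bar> \<le> d" "id_bounded d (V - I \<psi>)"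
    using is_integralE[OF assms(2) d(1)] by blast
  have \<phi>K: "\<bar>\<phi> x\<bar> \<le> K + 1" if "x \<in> space M" for x
    using \<phi>(2)[OF that] K(2)[OF that] d by linarith
  have "\<bar>f x * g x - \<phi> x * \<psi> x\<bar> \<le> e" if x: "x \<in> space M" for x
  proof -
    have "\<bar>f x * g x - \<phi> x * \<psi> x\<bar> \<le> \<bar>(f x - \<phi> x) * g x\<bar> + \<bar>\<phi> x * (g x - \<psi> x)\<bar>"
      using abs_triangle_ineq[of "(f x - \<phi> x) * g x" "\<phi> x * (g x - \<psi> x)"] by (simp add: algebra_simps)
    also have "\<dots> \<le> d * K + (K + 1) * d"
      unfolding abs_mult using \<phi>(2)[OF x] \<psi>(2)[OF x] K(3)[OF x] \<phi>K[OF x] K(1) d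
      by (intro add_mono mult_mono) auto
    finally show ?thesis
      using de by linarith
  qed
  moreover have "id_bounded e (U * V - I (\<lambda>x. \<phi> x * \<psi> x))"
  proof -
    have "id_bounded (d * K + (K + 1) * d) ((U - I \<phi>) * V + I \<phi> * (V - I \<psi>))"
      using is_integral_bounded[OF assms(2) K(3)] is_integral_bounded[OF is_integral_simple[OF \<phi>(1)] \<phi>K] \<phi>(3) \<psi>(3)
      by (intro id_bounded_add id_bounded_mult) auto
    moreover have "(U - I \<phi>) * V + I \<phi> * (V - I \<psi>) = U * V - I (\<lambda>x. \<phi> x * \<psi> x)"
      by (simp add: simple_mult \<phi> \<psi> algebra_simps)
    ultimately show ?thesis
      using id_bounded_mono[OF _ de] by simp
  qed
  ultimately show "\<exists>\<phi>. simple_function M \<phi> \<and> (\<forall>x\<in>space M. \<bar>f x * g x - \<phi> x\<bar> \<le> e) \<and> id_bounded e (U * V - I \<phi>)"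
    using \<phi>(1) \<psi>(1) by (intro exI[of _ "\<lambda>x. \<phi> x * \<psi> x"]) auto
qed

text \<open>Rounding f down to a multiple of e leaves finitely many values because f is
  bounded.\<close>

lemma uniform_simple_approximation:
  assumes f: "bounded_measurable M (f :: 's \<Rightarrow> real)" and "0 < e"
  obtains \<phi> where "simple_function M \<phi>" "\<And>x. x \<in> space M \<Longrightarrow> \<phi> x \<le> f x \<and> f x \<le> \<phi> x + e"
proof
  define \<phi> where "\<phi> x = e * of_int \<lfloor>f x / e\<rfloor>" for x
  note [measurable] = bounded_measurable_measurable[OF f]
  obtain K where K: "0 < K" "\<And>x. x \<in> space M \<Longrightarrow> norm (f x) \<le> K"
    using bounded_measurable_bound[OF f] by blast
  have "\<lfloor>f x / e\<rfloor> \<in> {\<lfloor>- K / e\<rfloor>..\<lfloor>K / e\<rfloor>}" if "x \<in> space M" for x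
  proof -
    have "- K \<le> f x" "f x \<le> K"
      using K(2)[OF that] by (auto simp: abs_le_iff)
    then have "- K / e \<le> f x / e" "f x / e \<le> K / e"
      using \<open>0 < e\<close> by (auto intro!: divide_right_mono simp del: divide_minus_left)
    then show ?thesis
      by (auto intro!: floor_mono simp del: divide_minus_left)
  qed
  then have "\<phi> ` space M \<subseteq> (\<lambda>k. e * of_int k) ` {\<lfloor>- K / e\<rfloor>..\<lfloor>K / e\<rfloor>}"
    by (auto simp: \<phi>_def)
  then have "finite (\<phi> ` space M)"
    by (rule finite_subset) simp
  moreover have "\<phi> \<in> borel_measurable M"
    unfolding \<phi>_def by measurable
  ultimately show "simple_function M \<phi>"
    by (intro simple_function_borel_measurable)
  show "\<phi> x \<le> f x \<and> f x \<le> \<phi> x + e" for x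
  proof -
    have "of_int \<lfloor>f x / e\<rfloor> \<le> f x / e" "f x / e \<le> of_int \<lfloor>f x / e\<rfloor> + 1"
      by linarith+
    then have "e * of_int \<lfloor>f x / e\<rfloor> \<le> e * (f x / e)" "e * (f x / e) \<le> e * (of_int \<lfloor>f x / e\<rfloor> + 1)"
      using \<open>0 < e\<close> by (simp_all only: mult_left_mono less_imp_le)
    then show ?thesis
      using \<open>0 < e\<close> by (simp add: \<phi>_def algebra_simps)
  qed
qed

text \<open>U is the supremum, among all regular operators, of the integrals of simple functions
  below f.\<close>

lemma is_integral_exists:
  assumes f: "bounded_measurable M f"
  obtains U where "is_integral f U"
proof -
  define S where "S = {I \<phi> |\<phi>. simple_function M \<phi> \<and> (\<forall>x\<in>space M. \<phi> x \<le> f x)}"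
  obtain \<phi>1 where \<phi>1: "simple_function M \<phi>1" "\<And>x. x \<in> space M \<Longrightarrow> \<phi>1 x \<le> f x \<and> f x \<le> \<phi>1 x + 1"
    using uniform_simple_approximation[OF f, of 1] by auto
  have "I \<phi>1 \<in> S"
    using \<phi>1 by (auto simp: S_def)
  moreover have "V \<le> I (\<lambda>x. \<phi>1 x + 1)" if V: "V \<in> S" for V
  proof -
    obtain \<psi> where \<psi>: "V = I \<psi>" "simple_function M \<psi>" "\<And>x. x \<in> space M \<Longrightarrow> \<psi> x \<le> f x"
      using V by (auto simp: S_def)
    show ?thesis
      unfolding \<psi>(1) using \<psi>(3) \<phi>1 by (intro simple_mono \<psi>(2)) (auto intro: order_trans)
  qed
  ultimately obtain U where U: "isLub UNIV S U"
    using regop_dedekind_complete[of S "I (\<lambda>x. \<phi>1 x + 1)"] by blast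
  have "is_integral f U"
    unfolding is_integral_def
  proof (intro allI impI)
    fix e :: real assume "0 < e"
    obtain \<phi> where \<phi>: "simple_function M \<phi>" "\<And>x. x \<in> space M \<Longrightarrow> \<phi> x \<le> f x \<and> f x \<le> \<phi> x + e"
      using uniform_simple_approximation[OF f \<open>0 < e\<close>] by blast
    have "I \<phi> \<le> U"
      using U \<phi> unfolding isLub_UNIV_iff S_def by blast
    \<comment> \<open>Every competitor lies below \<phi> + e, so U exceeds the integral of \<phi> by
      at most e times the identity.\<close>
    moreover have "I \<psi> \<le> I \<phi> + e *\<^sub>R 1" if \<psi>: "simple_function M \<psi>" "\<forall>x\<in>space M. \<psi> x \<le> f x" for \<psi>
    proof -
      have "I \<psi> \<le> I (\<lambda>x. \<phi> x + e)"
        using \<psi> \<phi> by (intro simple_mono) (auto intro: order_trans)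
      then show ?thesis
        using simple_add[OF \<phi>(1), of "\<lambda>_. e"] by (simp add: simple_const)
    qed
    then have "U \<le> I \<phi> + e *\<^sub>R 1"
      using U unfolding isLub_UNIV_iff S_def by blast
    ultimately have "id_bounded e (U - I \<phi>)"
      using \<open>0 < e\<close> scaleR_nonneg_nonneg[of e "1 :: 'a regop"]
      by (auto simp: id_bounded_def diff_le_eq add.commute intro: order_trans[of _ 0])
    then show "\<exists>\<phi>. simple_function M \<phi> \<and> (\<forall>x\<in>space M. \<bar>f x - \<phi> x\<bar> \<le> e) \<and> id_bounded e (U - I \<phi>)"
      using \<phi> by (intro exI[of _ \<phi>]) (auto simp: abs_le_iff; fastforce)
  qed
  then show ?thesis
    using that by blast
qed

section \<open>Continuity from above and the definition by monotone approximation\<close>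

text \<open>A Chebyshev argument: the bound L is used on the set A n where g n is at least e, and e
  elsewhere, so U n is at most e times the identity plus L times \<mu> (A n). As the sets A n
  decrease to the empty set, b is at most e times x for every e > 0.\<close>

lemma integral_continuous_from_above:
  assumes g: "\<And>n. is_integral (g n) (U n)" "\<And>n. g n \<in> borel_measurable M"
    and K: "\<And>n x. x \<in> space M \<Longrightarrow> g n x \<le> K"
    and dec: "\<And>x. x \<in> space M \<Longrightarrow> decseq (\<lambda>n. g n x)"
    and lim: "\<And>x. x \<in> space M \<Longrightarrow> (\<lambda>n. g n x) \<longlonglongrightarrow> 0"
    and x: "0 \<le> x" "\<And>n. b \<le> rapply (U n) x"
  shows "b \<le> 0"
proof -
  note [measurable] = g(2)
  \<comment> \<open>K may be 0 or negative; a positive bound can be inverted below.\<close>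
  define L where "L = max K 1"
  have L: "0 < L" "\<And>n x. x \<in> space M \<Longrightarrow> g n x \<le> L"
    using K by (auto simp: L_def max.coboundedI1)
  have "b \<le> e *\<^sub>R x" if "0 < e" for e
  proof -
    define A where "A n = {y \<in> space M. e \<le> g n y}" for n
    have A: "A n \<in> sets M" for n
      unfolding A_def by measurable
    have "decseq A"
      using dec by (auto simp: A_def decseq_def intro: order_trans)
    moreover have "(\<Inter>n. A n) = {}"
    proof -
      have "\<exists>n. y \<notin> A n" if "y \<in> space M" for y
      proof -
        have "\<forall>\<^sub>F n in sequentially. g n y < e"
          using lim[OF that] \<open>0 < e\<close> by (rule order_tendstoD)
        then obtain n where "g n y < e"
          using eventually_happens by force
        then show ?thesis
          by (intro exI[of _ n]) (simp add: A_def)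
      qed
      then show ?thesis
        by (auto simp: A_def)
    qed
    moreover have "inverse L *\<^sub>R (b - e *\<^sub>R x) \<le> rapply (\<mu> (A n)) x" for n
    proof -
      have s: "simple_function M (indicator (A n) :: _ \<Rightarrow> real)"
        using A by (rule simple_function_indicator)
      have "is_integral (\<lambda>y. e + L * indicator (A n) y) (e *\<^sub>R 1 + L *\<^sub>R \<mu> (A n))"
        using is_integral_add[OF is_integral_simple[of "\<lambda>_. e"] is_integral_scale[OF is_integral_simple[OF s], of L]]
        by (simp add: simple_const simple_indicator A)
      then have "U n \<le> e *\<^sub>R 1 + L *\<^sub>R \<mu> (A n)"
      proof (rule is_integral_mono[OF g(1)])
        fix y assume "y \<in> space M"
        then show "g n y \<le> e + L * indicator (A n) y"
          using L(2)[of y n] \<open>0 < e\<close> by (auto simp: A_def indicator_def)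
      qed
      then have "b \<le> e *\<^sub>R x + L *\<^sub>R rapply (\<mu> (A n)) x"
        using x(2)[of n] regop_leD[OF _ x(1)] by (fastforce intro: order_trans)
      then have "inverse L *\<^sub>R (b - e *\<^sub>R x) \<le> inverse L *\<^sub>R (L *\<^sub>R rapply (\<mu> (A n)) x)"
        using L(1) by (intro scaleR_left_mono) (auto simp: diff_le_eq add.commute)
      then show ?thesis
        using L(1) by simp
    qed
    ultimately have "inverse L *\<^sub>R (b - e *\<^sub>R x) \<le> 0"
      by (rule continuous_from_above[of A, OF A _ _ x(1)])
    then have "L *\<^sub>R inverse L *\<^sub>R (b - e *\<^sub>R x) \<le> L *\<^sub>R 0"
      using L(1) by (intro scaleR_left_mono) auto
    then show ?thesis
      using L(1) by simp
  qed
  then show ?thesis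
    by (rule lattice_archimedean)
qed

text \<open>Along any increasing simple approximation the differences f - \<phi> n decrease to 0,
  and continuity from above makes U the supremum of the integrals in the centre. So the defining
  description has exactly one solution, whichever sequence is chosen.\<close>

lemma order_integral_nonneg_eq:
  assumes f: "bounded_measurable M f" "\<And>x. x \<in> space M \<Longrightarrow> 0 \<le> f x" and U: "is_integral f U"
  shows "order_integral_nonneg M \<mu> f = U"
proof -
  obtain K where K: "0 < K" "\<And>x. x \<in> space M \<Longrightarrow> norm (f x) \<le> K"
    using bounded_measurable_bound[OF f(1)] by blast
  note [measurable] = bounded_measurable_measurable[OF f(1)]
  have U_bounds: "0 \<le> U" "U \<le> K *\<^sub>R 1"
    using is_integral_mono[OF is_integral_simple U, of "\<lambda>_. 0"] is_integral_bounded[OF U, of K] f(2) K(2)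
    by (simp_all add: simple_const id_bounded_def)
  have lub: "isLub centre (range (\<lambda>n. I (\<phi> n))) U"
    if \<phi>: "\<And>n. simple_function M (\<phi> n)" "\<And>n x. x \<in> space M \<Longrightarrow> 0 \<le> \<phi> n x"
      "\<And>x. x \<in> space M \<Longrightarrow> incseq (\<lambda>n. \<phi> n x)" "\<And>x. x \<in> space M \<Longrightarrow> (\<lambda>n. \<phi> n x) \<longlonglongrightarrow> f x"
    for \<phi> :: "nat \<Rightarrow> 's \<Rightarrow> real"
    unfolding isLub_iff
  proof (intro conjI ballI impI)
    show "U \<in> centre"
      using U_bounds K(1) by (intro centre_if_nonneg_le) auto
    have "\<phi> n x \<le> f x" if "x \<in> space M" for n x
      using incseq_le[OF \<phi>(3,4)] that by blast
    then show "V \<le> U" if "V \<in> range (\<lambda>n. I (\<phi> n))" for V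
      using that is_integral_mono[OF is_integral_simple[OF \<phi>(1)] U] by auto
    fix V assume V: "\<forall>a\<in>range (\<lambda>n. I (\<phi> n)). a \<le> V"
    have "rapply (U - V) x \<le> 0" if "0 \<le> x" for x
    proof (rule integral_continuous_from_above)
      show "is_integral (\<lambda>x. f x - \<phi> n x) (U - I (\<phi> n))" for n
        by (intro is_integral_diff U is_integral_simple \<phi>)
      show "(\<lambda>x. f x - \<phi> n x) \<in> borel_measurable M" for n
        using borel_measurable_simple_function[OF \<phi>(1)] by measurable
      show "f x - \<phi> n x \<le> K" if "x \<in> space M" for n x
        using K(2)[OF that] \<phi>(2)[OF that, of n] by auto
      show "decseq (\<lambda>n. f x - \<phi> n x)" if "x \<in> space M" for x
        using \<phi>(3)[OF that] by (auto simp: decseq_def incseq_def)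
      show "(\<lambda>n. f x - \<phi> n x) \<longlonglongrightarrow> 0" if "x \<in> space M" for x
        using tendsto_diff[OF tendsto_const \<phi>(4)[OF that], of "f x"] by simp
      show "rapply (U - V) x \<le> rapply (U - I (\<phi> n)) x" for n
        using V \<open>0 \<le> x\<close> by (intro regop_leD diff_mono) auto
    qed fact
    then have "U - V \<le> 0"
      by (intro regop_leI) simp
    then show "U \<le> V"
      by simp
  qed
  obtain \<phi> where "incseq \<phi>" and \<phi>: "\<And>i. simple_function M (\<phi> i)" "\<And>x. bdd_above (range (\<lambda>i. \<phi> i x))"
    "\<And>i x. 0 \<le> \<phi> i x" "(\<lambda>x. max 0 (f x)) = (SUP i. \<phi> i)"
    using borel_measurable_implies_simple_function_sequence_real[of "\<lambda>x. max 0 (f x)" M] by auto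
  have inc: "incseq (\<lambda>n. \<phi> n x)" for x
    using \<open>incseq \<phi>\<close> by (auto simp: incseq_def le_fun_def)
  have lim: "(\<lambda>n. \<phi> n x) \<longlonglongrightarrow> f x" if "x \<in> space M" for x
  proof -
    have "max 0 (f x) = (SUP i. \<phi> i x)"
      using fun_cong[OF \<phi>(4), of x] by (simp add: image_comp)
    then show ?thesis
      using LIMSEQ_incseq_SUP[OF \<phi>(2) inc, of x] f(2)[OF that] by simp
  qed
  show ?thesis
    unfolding order_integral_nonneg_def
  proof (rule the_equality)
    show "\<exists>\<phi>. (\<forall>n. simple_function M (\<phi> n) \<and> (\<forall>x\<in>space M. 0 \<le> \<phi> n x)) \<and>
        (\<forall>x\<in>space M. incseq (\<lambda>n. \<phi> n x) \<and> (\<lambda>n. \<phi> n x) \<longlonglongrightarrow> f x) \<and> isLub centre (range (\<lambda>n. I (\<phi> n))) U"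
      by (intro exI[of _ \<phi>] conjI allI ballI \<phi>(1,3) inc lim lub)
    fix V
    assume "\<exists>\<phi>. (\<forall>n. simple_function M (\<phi> n) \<and> (\<forall>x\<in>space M. 0 \<le> \<phi> n x)) \<and>
        (\<forall>x\<in>space M. incseq (\<lambda>n. \<phi> n x) \<and> (\<lambda>n. \<phi> n x) \<longlonglongrightarrow> f x) \<and> isLub centre (range (\<lambda>n. I (\<phi> n))) V"
    then obtain \<psi> where \<psi>: "\<forall>n. simple_function M (\<psi> n) \<and> (\<forall>x\<in>space M. 0 \<le> \<psi> n x)"
        "\<forall>x\<in>space M. incseq (\<lambda>n. \<psi> n x) \<and> (\<lambda>n. \<psi> n x) \<longlonglongrightarrow> f x"
        and V: "isLub centre (range (\<lambda>n. I (\<psi> n))) V"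
      by (elim exE conjE)
    have "isLub centre (range (\<lambda>n. I (\<psi> n))) U"
      using \<psi> by (intro lub) simp_all
    then show "V = U"
      using V unfolding isLub_iff by (meson order.antisym)
  qed
qed

section \<open>Rules for the integral of bounded real and complex functions\<close>

abbreviation J :: "('s \<Rightarrow> real) \<Rightarrow> 'a regop" where
  "J \<equiv> order_integral_real M \<mu>"

abbreviation L :: "('s \<Rightarrow> complex) \<Rightarrow> 'a regop complexification" where
  "L \<equiv> order_integral M \<mu>"

lemma order_integral_real_is_integral:
  assumes "bounded_measurable M f"
  shows "is_integral f (J f)"
proof -
  have bm: "bounded_measurable M (\<lambda>x. max (f x) 0)" "bounded_measurable M (\<lambda>x. max (- f x) 0)"
    using bounded_measurable_max_0[OF assms]
      bounded_measurable_max_0[OF bounded_measurable_scale[OF assms, of "- 1"]] by simp_all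
  obtain U V where UV: "is_integral (\<lambda>x. max (f x) 0) U" "is_integral (\<lambda>x. max (- f x) 0) V"
    using is_integral_exists bm by metis
  then have "J f = U - V"
    using bm by (simp add: order_integral_real_def order_integral_nonneg_eq)
  moreover have "(\<lambda>x. max (f x) 0 - max (- f x) 0) = f"
    by (auto simp: max_def)
  ultimately show ?thesis
    using is_integral_diff[OF UV] by simp
qed

lemma order_integral_real_eqI:
  assumes "is_integral f U" "bounded_measurable M g" "\<And>x. x \<in> space M \<Longrightarrow> g x = f x"
  shows "J g = U"
  using is_integral_unique[OF order_integral_real_is_integral[OF assms(2)] assms(1)] assms(3) by simp

lemma order_integral_real_mono:
  assumes "bounded_measurable M f" "bounded_measurable M g" "\<And>x. x \<in> space M \<Longrightarrow> f x \<le> g x"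
  shows "J f \<le> J g"
  using is_integral_mono[OF order_integral_real_is_integral order_integral_real_is_integral] assms by blast

lemma order_integral_real_cong:
  assumes "bounded_measurable M f" "\<And>x. x \<in> space M \<Longrightarrow> g x = f x"
  shows "J g = J f"
  using order_integral_real_eqI[OF order_integral_real_is_integral] bounded_measurable_cong assms by metis

lemma order_integral_real_add:
  assumes "bounded_measurable M f" "bounded_measurable M g"
  shows "J (\<lambda>x. f x + g x) = J f + J g"
  using assms
  by (intro order_integral_real_eqI[OF is_integral_add[OF order_integral_real_is_integral order_integral_real_is_integral]] bounded_measurable_add) auto

lemma order_integral_real_diff:
  assumes "bounded_measurable M f" "bounded_measurable M g"
  shows "J (\<lambda>x. f x - g x) = J f - J g"
  using assms
  by (intro order_integral_real_eqI[OF is_integral_diff[OF order_integral_real_is_integral order_integral_real_is_integral]] bounded_measurable_diff) auto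

lemma order_integral_real_scale:
  assumes "bounded_measurable M f"
  shows "J (\<lambda>x. c * f x) = c *\<^sub>R J f"
  using assms
  by (intro order_integral_real_eqI[OF is_integral_scale[OF order_integral_real_is_integral]] bounded_measurable_scale) auto

lemma order_integral_real_uminus:
  assumes "bounded_measurable M f"
  shows "J (\<lambda>x. - f x) = - J f"
  using order_integral_real_scale[OF assms, of "- 1"] by simp

lemma order_integral_real_mult:
  assumes "bounded_measurable M f" "bounded_measurable M g"
  shows "J (\<lambda>x. f x * g x) = J f * J g"
proof -
  obtain K L where K: "0 < K" "\<And>x. x \<in> space M \<Longrightarrow> \<bar>f x\<bar> \<le> K" "\<And>x. x \<in> space M \<Longrightarrow> \<bar>g x\<bar> \<le> L"
    using bounded_measurable_bound assms by (metis real_norm_def)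
  have "is_integral (\<lambda>x. f x * g x) (J f * J g)"
    using K by (intro is_integral_mult[of _ _ _ _ "max K L"] order_integral_real_is_integral assms) (auto simp: le_max_iff_disj)
  then show ?thesis
    by (intro order_integral_real_eqI bounded_measurable_mult assms) auto
qed

lemma order_integral_real_simple: "simple_function M \<phi> \<Longrightarrow> J \<phi> = I \<phi>"
  by (intro order_integral_real_eqI[OF is_integral_simple] bounded_measurable_simple) auto

lemma order_integral_real_const: "J (\<lambda>_. c) = c *\<^sub>R 1"
  by (simp add: order_integral_real_simple simple_const)

lemma order_integral_real_indicator: "A \<in> sets M \<Longrightarrow> J (indicator A) = \<mu> A"
  by (simp add: order_integral_real_simple simple_indicator)

lemma order_integral_real_nonneg:
  "bounded_measurable M f \<Longrightarrow> (\<And>x. x \<in> space M \<Longrightarrow> 0 \<le> f x) \<Longrightarrow> 0 \<le> J f"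
  using order_integral_real_mono[of "\<lambda>_. 0" f] by (simp add: order_integral_real_const)

lemma order_integral_real_eq_0:
  assumes f: "bounded_measurable M f" and N: "N \<in> sets M" "\<mu> N = 0"
    and 0: "\<And>x. x \<in> space M - N \<Longrightarrow> f x = 0"
  shows "J f = 0"
proof -
  obtain K where K: "0 < K" "\<And>x. x \<in> space M \<Longrightarrow> norm (f x) \<le> K"
    using bounded_measurable_bound[OF f] by blast
  \<comment> \<open>This applies to f and to - f alike: both are dominated by K times the indicator
    of N, whose integral is K times \<mu> N = 0.\<close>
  have *: "J g \<le> 0" if "bounded_measurable M g" "\<And>x. x \<in> space M \<Longrightarrow> g x \<le> \<bar>f x\<bar>" for g
  proof -
    have "g x \<le> K * indicator N x" if "x \<in> space M" for x
      using K(2)[OF that] 0[of x] \<open>\<And>x. x \<in> space M \<Longrightarrow> g x \<le> \<bar>f x\<bar>\<close>[OF that] that by (cases "x \<in> N") auto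
    then have "J g \<le> J (\<lambda>x. K * indicator N x)"
      using that(1) N(1) by (intro order_integral_real_mono bounded_measurable_scale bounded_measurable_indicator)
    also have "\<dots> = 0"
      by (simp only: order_integral_real_scale[OF bounded_measurable_indicator[OF N(1)]]
          order_integral_real_indicator[OF N(1)] N(2) scaleR_zero_right)
    finally show ?thesis .
  qed
  have "J f \<le> 0"
    by (rule *[OF f]) simp
  moreover have "J (\<lambda>x. - f x) \<le> 0"
    using bounded_measurable_scale[OF f, of "- 1"] by (intro *) auto
  ultimately show ?thesis
    using f by (intro order.antisym) (simp_all add: order_integral_real_uminus)
qed

lemma order_integral_add:
  assumes "bounded_measurable M f" "bounded_measurable M g"
  shows "L (\<lambda>x. f x + g x) = L f + L g"
  by (rule complexification_eqI)
    (simp_all add: order_integral_def order_integral_real_add bounded_measurable_Re_Im assms)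

lemma order_integral_diff:
  assumes "bounded_measurable M f" "bounded_measurable M g"
  shows "L (\<lambda>x. f x - g x) = L f - L g"
  by (rule complexification_eqI)
    (simp_all add: order_integral_def order_integral_real_diff bounded_measurable_Re_Im assms)

lemma order_integral_mult:
  assumes "bounded_measurable M f" "bounded_measurable M g"
  shows "L (\<lambda>x. f x * g x) = L f * L g"
  by (rule complexification_eqI)
    (simp_all add: order_integral_def times_complexification_def order_integral_real_diff
      order_integral_real_add order_integral_real_mult bounded_measurable_mult bounded_measurable_Re_Im assms)

lemma order_integral_scaleC:
  assumes "bounded_measurable M f"
  shows "L (\<lambda>x. c * f x) = c *\<^sub>C L f"
  by (rule complexification_eqI)
    (simp_all add: order_integral_def scaleC_def order_integral_real_diff order_integral_real_add
      order_integral_real_scale bounded_measurable_scale bounded_measurable_Re_Im assms)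

lemma order_integral_cnj:
  assumes "bounded_measurable M f"
  shows "L (\<lambda>x. cnj (f x)) = cconj (L f)"
  by (rule complexification_eqI)
    (simp_all add: order_integral_def cconj_def order_integral_real_uminus bounded_measurable_Re_Im assms)

lemma order_integral_const: "L (\<lambda>_. c) = c *\<^sub>C 1"
  by (simp add: order_integral_def order_integral_real_const one_complexification_def scaleC_def)

lemma order_integral_one: "L (\<lambda>_. 1) = 1"
  by (simp add: order_integral_const)

lemma order_integral_cong:
  assumes "bounded_measurable M f" "\<And>x. x \<in> space M \<Longrightarrow> g x = f x"
  shows "L g = L f"
proof -
  have "J (\<lambda>x. Re (g x)) = J (\<lambda>x. Re (f x))" "J (\<lambda>x. Im (g x)) = J (\<lambda>x. Im (f x))"
    using assms(2) by (auto intro!: order_integral_real_cong bounded_measurable_Re_Im assms(1))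
  then show ?thesis
    by (simp add: order_integral_def)
qed

lemma order_integral_eq_0:
  assumes f: "bounded_measurable M f" and N: "N \<in> sets M" "\<mu> N = 0"
    and 0: "\<And>x. x \<in> space M - N \<Longrightarrow> f x = 0"
  shows "L f = 0"
  using order_integral_real_eq_0[OF bounded_measurable_Re_Im(1)[OF f] N]
    order_integral_real_eq_0[OF bounded_measurable_Re_Im(2)[OF f] N] 0
  by (simp add: order_integral_def zero_complexification_def)

text \<open>Order bounds on all rotations of the operator thereby become pointwise bounds on the
  real part of exp(-i \<theta>) f.\<close>

lemma rotated_re_order_integral:
  assumes "bounded_measurable M f"
  shows "rotated_re \<theta> (L f) = J (\<lambda>x. Re (cis (- \<theta>) * f x))"
  by (simp add: order_integral_def rotated_re_def order_integral_real_add order_integral_real_scale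
      bounded_measurable_scale bounded_measurable_Re_Im assms)

text \<open>Contractivity for the sup norm; on continuous functions over the spectrum,
  \<open>sup_norm_le\<close> supplies the reverse estimate.\<close>

lemma cid_bounded_order_integral:
  assumes f: "bounded_measurable M f" and K: "\<And>x. x \<in> space M \<Longrightarrow> cmod (f x) \<le> K"
  shows "cid_bounded K (L f)"
  unfolding cid_bounded_def
proof
  fix \<theta>
  have "\<bar>Re (cis (- \<theta>) * f x)\<bar> \<le> K" if "x \<in> space M" for x
    using abs_Re_le_cmod[of "cis (- \<theta>) * f x"] K[OF that] by (simp add: norm_mult del: cis.sel)
  then show "id_bounded K (rotated_re \<theta> (L f))"
    unfolding rotated_re_order_integral[OF f]
    using bounded_measurable_Re_Im(1)[OF bounded_measurable_scale[OF f]]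
    by (intro is_integral_bounded[OF order_integral_real_is_integral])
qed

lemma order_integral_in_ccentre:
  assumes "bounded_measurable M f"
  shows "L f \<in> ccentre"
proof -
  obtain K where "0 < K" "\<And>x. x \<in> space M \<Longrightarrow> norm (f x) \<le> K"
    using bounded_measurable_bound[OF assms] by blast
  then show ?thesis
    using cid_bounded_order_integral[OF assms] unfolding mem_ccentre_iff by (intro exI[of _ K]) auto
qed

section \<open>The action of integrals on the complexified lattice\<close>

text \<open>In polar form, the real part of c (x + i y) is cmod c times a rotation of x + i y, hence
  at most cmod c times the modulus of x + i y.\<close>

lemma Re_mult_rotation: "\<exists>\<theta>. Re c *\<^sub>R x - Im c *\<^sub>R y = cmod c *\<^sub>R rotated_re \<theta> (Cplx x y)"
proof -
  have "Re c = cmod c * cos (Arg c)" "Im c = cmod c * sin (Arg c)"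
    using rcis_cmod_Arg[of c] by (metis Re_rcis, metis Im_rcis)
  then show ?thesis
    by (intro exI[of _ "- Arg c"]) (simp add: rotated_re_def algebra_simps)
qed

text \<open>For a simple function \<open>\<Sum> c\<^sub>j \<chi>\<^sub>j\<close> the real part of \<open>(\<integral> f d\<mu>) z\<close> is \<open>\<Sum> \<mu>\<^sub>j (Re (c\<^sub>j z))\<close>, which is
  at most \<open>\<Sum> \<mu>\<^sub>j (|c\<^sub>j| |z|)\<close>; the general case follows by uniform approximation.\<close>

lemma re_capply_order_integral_le:
  assumes f: "bounded_measurable M f"
  shows "re (capply (L f) z) \<le> rapply (J (\<lambda>x. cmod (f x))) (modulus z)"
proof -
  define x y m where "x = re z" and "y = im z" and "m = modulus z"
  have m: "rotated_re \<theta> (Cplx x y) \<le> m" for \<theta>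
    using rotated_re_le_modulus[of \<theta> z] by (simp add: x_def y_def m_def)
  have "0 \<le> m"
    by (simp add: m_def modulus_nonneg)
  \<comment> \<open>On the right, e |x| and e |y| pay for replacing the two integrals by those of
    simple functions, and 2 e m for replacing cmod f.\<close>
  have "rapply (J (\<lambda>x. Re (f x))) x - rapply (J (\<lambda>x. Im (f x))) y - rapply (J (\<lambda>x. cmod (f x))) m
      \<le> e *\<^sub>R (\<bar>x\<bar> + \<bar>y\<bar> + 2 *\<^sub>R m)" if e: "0 < e" for e
  proof -
    obtain \<phi> where \<phi>: "simple_function M \<phi>" "\<And>x. x \<in> space M \<Longrightarrow> \<bar>Re (f x) - \<phi> x\<bar> \<le> e"
      "id_bounded e (J (\<lambda>x. Re (f x)) - I \<phi>)"
      using is_integralE[OF order_integral_real_is_integral[OF bounded_measurable_Re_Im(1)[OF f]] e] by blast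
    obtain \<psi> where \<psi>: "simple_function M \<psi>" "\<And>x. x \<in> space M \<Longrightarrow> \<bar>Im (f x) - \<psi> x\<bar> \<le> e"
      "id_bounded e (J (\<lambda>x. Im (f x)) - I \<psi>)"
      using is_integralE[OF order_integral_real_is_integral[OF bounded_measurable_Re_Im(2)[OF f]] e] by blast
    let ?h = "\<lambda>x. (\<phi> x, \<psi> x)" and ?n = "\<lambda>x. cmod (Complex (\<phi> x) (\<psi> x))"
    have h: "simple_function M ?h"
      using \<phi>(1) \<psi>(1) by simp
    have n: "simple_function M ?n"
      using simple_function_compose1[OF h, of "\<lambda>p. cmod (Complex (fst p) (snd p))"] by simp
    define P where "P p = \<mu> (?h -` {p} \<inter> space M)" for p
    have P: "0 \<le> P p" for p
      unfolding P_def using simple_functionD(2)[OF h] by (intro nonneg)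
    have comp: "I (\<lambda>x. g (\<phi> x) (\<psi> x)) = (\<Sum>p\<in>?h ` space M. g (fst p) (snd p) *\<^sub>R P p)" for g
      using simple_comp[OF h, of "\<lambda>p. g (fst p) (snd p)"] by (simp add: P_def)
    have "rapply (I \<phi>) x - rapply (I \<psi>) y =
        (\<Sum>p\<in>?h ` space M. rapply (P p) (fst p *\<^sub>R x - snd p *\<^sub>R y))"
      using comp[of "\<lambda>a b. a"] comp[of "\<lambda>a b. b"] by (simp add: rapply_sum sum_subtractf)
    also have "\<dots> \<le> (\<Sum>p\<in>?h ` space M. rapply (P p) (cmod (Complex (fst p) (snd p)) *\<^sub>R m))"
    proof (rule sum_mono)
      fix p :: "real \<times> real"
      obtain \<theta> where "fst p *\<^sub>R x - snd p *\<^sub>R y = cmod (Complex (fst p) (snd p)) *\<^sub>R rotated_re \<theta> (Cplx x y)"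
        using Re_mult_rotation[of "Complex (fst p) (snd p)" x y] by auto
      then have "fst p *\<^sub>R x - snd p *\<^sub>R y \<le> cmod (Complex (fst p) (snd p)) *\<^sub>R m"
        using m[of \<theta>] by (simp add: scaleR_left_mono)
      then have "rapply (P p) 0 \<le> rapply (P p) (cmod (Complex (fst p) (snd p)) *\<^sub>R m - (fst p *\<^sub>R x - snd p *\<^sub>R y))"
        using regop_leD[OF P, of "cmod (Complex (fst p) (snd p)) *\<^sub>R m - (fst p *\<^sub>R x - snd p *\<^sub>R y)" p] by simp
      then show "rapply (P p) (fst p *\<^sub>R x - snd p *\<^sub>R y) \<le> rapply (P p) (cmod (Complex (fst p) (snd p)) *\<^sub>R m)"
        unfolding rapply_linear_simps(2)[of _ "cmod (Complex (fst p) (snd p)) *\<^sub>R m"] by (simp only: rapply_linear_simps(5) diff_ge_0_iff_ge)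
    qed
    also have "\<dots> = rapply (I ?n) m"
      using comp[of "\<lambda>a b. cmod (Complex a b)"] by (simp add: rapply_sum)
    also have "\<dots> \<le> rapply (J (\<lambda>x. cmod (f x)) + (2 * e) *\<^sub>R 1) m"
    proof (rule regop_leD[OF _ \<open>0 \<le> m\<close>])
      have "?n x \<le> cmod (f x) + 2 * e" if "x \<in> space M" for x
      proof -
        have "?n x \<le> cmod (f x) + cmod (Complex (\<phi> x) (\<psi> x) - f x)"
          by (rule norm_triangle_sub)
        also have "cmod (Complex (\<phi> x) (\<psi> x) - f x) \<le> \<bar>\<phi> x - Re (f x)\<bar> + \<bar>\<psi> x - Im (f x)\<bar>"
          using cmod_le[of "Complex (\<phi> x) (\<psi> x) - f x"] by simp
        finally show ?thesis
          using \<phi>(2)[OF that] \<psi>(2)[OF that] by linarith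
      qed
      then have "J ?n \<le> J (\<lambda>x. cmod (f x) + 2 * e)"
        by (intro order_integral_real_mono bounded_measurable_simple n bounded_measurable_add
            bounded_measurable_norm f bounded_measurable_const)
      then show "I ?n \<le> J (\<lambda>x. cmod (f x)) + (2 * e) *\<^sub>R 1"
        by (simp add: order_integral_real_simple[OF n] order_integral_real_add bounded_measurable_norm[OF f]
            order_integral_real_const)
    qed
    finally have main: "rapply (I \<phi>) x - rapply (I \<psi>) y \<le> rapply (J (\<lambda>x. cmod (f x))) m + (2 * e) *\<^sub>R m"
      by simp
    have "rapply (J (\<lambda>x. Re (f x)) - I \<phi>) x \<le> e *\<^sub>R \<bar>x\<bar>" "- rapply (J (\<lambda>x. Im (f x)) - I \<psi>) y \<le> e *\<^sub>R \<bar>y\<bar>"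
      using id_bounded_abs_le[OF \<phi>(3), of x] id_bounded_abs_le[OF \<psi>(3), of y]
      by (blast intro: order_trans abs_ge_self abs_ge_minus_self)+
    from add_mono[OF add_mono[OF this] main] show ?thesis
      by (simp add: algebra_simps)
  qed
  from lattice_archimedean[OF this] show ?thesis
    by (simp add: capply_def order_integral_def x_def y_def m_def)
qed

text \<open>A rotation multiplies the integrand by a number of modulus 1, which leaves the bound for
  the real part unchanged.\<close>

lemma modulus_capply_order_integral_le:
  assumes f: "bounded_measurable M f"
  shows "modulus (capply (L f) z) \<le> rapply (J (\<lambda>x. cmod (f x))) (modulus z)"
proof (rule modulus_leI)
  fix \<theta>
  have "rotated_re \<theta> (capply (L f) z) = re (capply (L (\<lambda>x. cis (- \<theta>) * f x)) z)"
    by (simp add: order_integral_scaleC f rotated_re_def) (simp add: scaleC_def)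
  also have "\<dots> \<le> rapply (J (\<lambda>x. cmod (cis (- \<theta>) * f x))) (modulus z)"
    by (intro re_capply_order_integral_le bounded_measurable_scale f)
  finally show "rotated_re \<theta> (capply (L f) z) \<le> rapply (J (\<lambda>x. cmod (f x))) (modulus z)"
    by (simp add: norm_mult)
qed

section \<open>Null functions and dominated convergence\<close>

text \<open>If the integral of f vanishes, so does that of q = |f|^2, by multiplicativity. The
  functions min 1 (n q) then have integral 0 as well and increase to the indicator of the set where
  f is nonzero, whose measure is 0 by continuity from above.\<close>

lemma order_integral_eq_0_iff:
  assumes f: "bounded_measurable M f"
  shows "L f = 0 \<longleftrightarrow> order_AE M \<mu> (\<lambda>x. f x = 0)"
proof
  assume "order_AE M \<mu> (\<lambda>x. f x = 0)"
  then show "L f = 0"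
    using order_integral_eq_0[OF f] unfolding order_AE_def by blast
next
  assume "L f = 0"
  note [measurable] = bounded_measurable_measurable[OF f]
  define q where "q x = (cmod (f x))\<^sup>2" for x
  have q: "bounded_measurable M q"
    unfolding q_def power2_eq_square by (intro bounded_measurable_mult bounded_measurable_norm f)
  have [measurable]: "q \<in> borel_measurable M"
    using q by (rule bounded_measurable_measurable)
  have "L (\<lambda>x. f x * cnj (f x)) = 0"
    using \<open>L f = 0\<close> by (simp add: order_integral_mult f bounded_measurable_cnj)
  then have "J (\<lambda>x. Re (f x * cnj (f x))) = 0"
    unfolding order_integral_def zero_complexification_def by blast
  moreover have "Re (f x * cnj (f x)) = q x" for x
    by (simp add: q_def cmod_power2) (simp add: power2_eq_square)
  ultimately have "J q = 0"
    by simp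
  define N where "N = {x \<in> space M. f x \<noteq> 0}"
  have N: "N \<in> sets M"
    unfolding N_def by measurable
  have bm: "bounded_measurable M (\<lambda>x. min 1 (real n * q x))" for n
    by (rule bounded_measurableI[of _ _ 1]) (auto simp: q_def)
  have J0: "J (\<lambda>x. min 1 (real n * q x)) = 0" for n
  proof (rule order.antisym)
    have "J (\<lambda>x. min 1 (real n * q x)) \<le> J (\<lambda>x. real n * q x)"
      by (intro order_integral_real_mono bm bounded_measurable_scale q) simp
    then show "J (\<lambda>x. min 1 (real n * q x)) \<le> 0"
      using \<open>J q = 0\<close> by (simp add: order_integral_real_scale q)
  qed (intro order_integral_real_nonneg bm; simp add: q_def)
  have "\<mu> N \<le> 0"
  proof (rule regop_leI)
    fix y :: 'a assume "0 \<le> y"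
    have "rapply (\<mu> N) y \<le> 0"
    proof (rule integral_continuous_from_above)
      show "is_integral (\<lambda>x. indicator N x - min 1 (real n * q x)) (\<mu> N)" for n
        using is_integral_diff[OF is_integral_simple[OF simple_function_indicator[OF N]]
            order_integral_real_is_integral[OF bm]] by (simp add: simple_indicator N J0)
      show "(\<lambda>x. indicator N x - min 1 (real n * q x)) \<in> borel_measurable M" for n
        using N by measurable
      show "indicator N x - min 1 (real n * q x) \<le> 1" for n x
      proof -
        have "0 \<le> real n * q x"
          by (simp add: q_def)
        then show ?thesis
          by (auto simp: indicator_def min_def)
      qed
      show "decseq (\<lambda>n. indicator N x - min 1 (real n * q x))" for x
        unfolding decseq_def by (intro allI impI diff_left_mono min.mono mult_right_mono) (simp_all add: q_def)
      show "(\<lambda>n. indicator N x - min 1 (real n * q x)) \<longlonglongrightarrow> 0" if "x \<in> space M" for x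
      proof (cases "x \<in> N")
        case True
        then have "0 < q x"
          by (simp add: N_def q_def)
        then obtain n0 where n0: "1 < real n0 * q x"
          using reals_Archimedean3 by blast
        have "1 \<le> real n * q x" if "n0 \<le> n" for n
        proof -
          have "real n0 * q x \<le> real n * q x"
            using that \<open>0 < q x\<close> by (intro mult_right_mono) auto
          then show ?thesis
            using n0 by linarith
        qed
        then have "\<forall>\<^sub>F n in sequentially. indicator N x - min 1 (real n * q x) = 0"
          using True by (auto simp: eventually_sequentially min_def)
        then show ?thesis
          by (rule tendsto_eventually)
      next
        case False
        then show ?thesis
          using that by (simp add: N_def q_def)
      qed
    qed (use \<open>0 \<le> y\<close> in auto)
    then show "rapply (\<mu> N) y \<le> rapply 0 y"
      by simp
  qed
  then have "\<mu> N = 0"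
    using nonneg[OF N] by (rule order.antisym)
  then show "order_AE M \<mu> (\<lambda>x. f x = 0)"
    using N unfolding order_AE_def N_def by blast
qed

lemma null_Un:
  assumes "N1 \<in> sets M" "\<mu> N1 = 0" "N2 \<in> sets M" "\<mu> N2 = 0"
  shows "\<mu> (N1 \<union> N2) = 0"
proof -
  have "\<mu> (N1 \<union> N2) = \<mu> N1 + \<mu> (N2 - N1)"
    using additive[of N1 "N2 - N1"] assms by auto
  moreover have "\<mu> (N2 - N1) = 0"
    using mono[of N2 "N2 - N1"] nonneg[of "N2 - N1"] assms by (intro order.antisym) auto
  ultimately show ?thesis
    using assms by simp
qed

text \<open>u n is the integral of the supremum of |f m - g| over m \<ge> n, set to 0 on a null set;
  these suprema decrease to 0 pointwise. The last conclusion yields infimum 0 both for u in the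
  centre and for u n x in E.\<close>

lemma dominated_convergence:
  fixes f :: "nat \<Rightarrow> 's \<Rightarrow> complex"
  assumes f: "\<And>n. bounded_measurable M (f n)" and g: "bounded_measurable M g"
    and K: "order_AE M \<mu> (\<lambda>x. \<forall>n. norm (f n x) \<le> K)"
    and lim: "order_AE M \<mu> (\<lambda>x. (\<lambda>n. f n x) \<longlonglongrightarrow> g x)"
  obtains u where "decseq u" "\<And>n. 0 \<le> u n" "\<And>n. u n \<in> centre"
    "\<And>n. J (\<lambda>x. cmod (f n x - g x)) \<le> u n"
    "\<And>x b. 0 \<le> x \<Longrightarrow> (\<And>n. b \<le> rapply (u n) x) \<Longrightarrow> b \<le> 0"
proof -
  obtain N1 N2 where N12: "N1 \<in> sets M" "\<mu> N1 = 0" "\<And>x n. x \<in> space M - N1 \<Longrightarrow> norm (f n x) \<le> K"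
    "N2 \<in> sets M" "\<mu> N2 = 0" "\<And>x. x \<in> space M - N2 \<Longrightarrow> (\<lambda>n. f n x) \<longlonglongrightarrow> g x"
    using K lim unfolding order_AE_def by blast
  define N where "N = N1 \<union> N2"
  have N: "N \<in> sets M" "\<mu> N = 0"
    using N12 null_Un by (auto simp: N_def)
  obtain G where G: "0 < G" "\<And>x. x \<in> space M \<Longrightarrow> norm (g x) \<le> G"
    using bounded_measurable_bound[OF g] by blast
  have [measurable]: "\<And>n. f n \<in> borel_measurable M" "g \<in> borel_measurable M"
    using f g bounded_measurable_measurable by blast+
  \<comment> \<open>K can be negative when N1 is the whole space; \<open>\<bar>K\<bar>\<close> keeps
    C nonnegative.\<close>
  define C where "C = \<bar>K\<bar> + G"
  \<comment> \<open>Erasing the difference on N turns both almost everywhere hypotheses into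
    statements at every point.\<close>
  define d where "d n x = indicator (space M - N) x * cmod (f n x - g x)" for n x
  have d0: "0 \<le> d n x" for n x
    by (simp add: d_def)
  have dC: "d n x \<le> C" if "x \<in> space M" for n x
  proof (cases "x \<in> N")
    case False
    then have "cmod (f n x - g x) \<le> K + G"
      using that N12(3)[of x n] G(2)[OF that] by (intro norm_triangle_le_diff add_mono) (auto simp: N_def)
    then show ?thesis
      using that False by (simp add: d_def C_def)
  qed (use G in \<open>simp add: d_def C_def\<close>)
  have [measurable]: "d n \<in> borel_measurable M" for n
    unfolding d_def using N(1) by measurable
  have bmd: "bounded_measurable M (d n)" for n
    using dC d0 by (intro bounded_measurableI[of _ _ C]) auto
  define h where "h n x = (SUP m. d (n + m) x)" for n x
  have bdd: "bdd_above (range (\<lambda>m. d (n + m) x))" if "x \<in> space M" for n x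
    using dC[OF that] by (intro bdd_aboveI[of _ C]) auto
  have dh: "d (n + m) x \<le> h n x" if "x \<in> space M" for n m x
    unfolding h_def by (rule cSUP_upper[OF _ bdd[OF that]]) simp
  have h0: "0 \<le> h n x" if "x \<in> space M" for n x
    using order_trans[OF d0 dh[OF that]] .
  have hle: "h n x \<le> c" if "\<And>m. n \<le> m \<Longrightarrow> d m x \<le> c" for n x c
    unfolding h_def using that by (intro cSUP_least) auto
  have [measurable]: "h n \<in> borel_measurable M" for n
    unfolding h_def using bdd by (intro borel_measurable_cSUP) auto
  have bmh: "bounded_measurable M (h n)" for n
    using h0 hle[OF dC] by (intro bounded_measurableI[of _ _ C]) auto
  have dech: "h n x \<le> h m x" if "x \<in> space M" "m \<le> n" for m n x
    using dh[OF that(1), of m] that(2) by (intro hle) (metis le_Suc_ex order_trans)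
  have limh: "(\<lambda>n. h n x) \<longlonglongrightarrow> 0" if x: "x \<in> space M" for x
  proof -
    have "(\<lambda>n. d n x) \<longlonglongrightarrow> 0"
    proof (cases "x \<in> N")
      case False
      then have "(\<lambda>n. f n x) \<longlonglongrightarrow> g x"
        using N12(6)[of x] x by (auto simp: N_def)
      then show ?thesis
        using x False by (simp add: d_def LIM_zero tendsto_norm_zero)
    qed (simp add: d_def)
    then have "\<exists>n0. \<forall>n\<ge>n0. norm (h n x - 0) < e" if "0 < e" for e
    proof -
      obtain n0 where "\<forall>n\<ge>n0. norm (d n x - 0) < e / 2"
        using LIMSEQ_D[OF \<open>(\<lambda>n. d n x) \<longlonglongrightarrow> 0\<close>, of "e / 2"] \<open>0 < e\<close> by auto
      then have "d n x \<le> e / 2" if "n0 \<le> n" for n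
        using that by fastforce
      then have "h n x \<le> e / 2" if "n0 \<le> n" for n
        using that by (intro hle) auto
      then show ?thesis
        using h0[OF x] \<open>0 < e\<close> by (intro exI[of _ n0]) fastforce
    qed
    then show ?thesis
      by (intro LIMSEQ_I)
  qed
  define u where "u n = J (h n)" for n
  have "decseq u"
    unfolding u_def decseq_def by (auto intro!: order_integral_real_mono bmh dech)
  moreover have u0: "0 \<le> u n" for n
    unfolding u_def by (intro order_integral_real_nonneg bmh h0)
  moreover have "u n \<in> centre" for n
  proof (rule centre_if_nonneg_le[OF u0])
    have "u n \<le> J (\<lambda>_. C)"
      unfolding u_def using hle[OF dC] by (intro order_integral_real_mono bmh) auto
    then show "u n \<le> C *\<^sub>R 1"
      by (simp add: order_integral_real_const)
    show "0 \<le> C"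
      using G by (simp add: C_def)
  qed
  moreover have "J (\<lambda>x. cmod (f n x - g x)) \<le> u n" for n
  proof -
    have bm: "bounded_measurable M (\<lambda>x. cmod (f n x - g x))"
      by (intro bounded_measurable_norm bounded_measurable_diff f g)
    have "J (\<lambda>x. cmod (f n x - g x) - d n x) = 0"
      using bounded_measurable_diff[OF bm bmd] N by (rule order_integral_real_eq_0) (simp add: d_def)
    then have "J (\<lambda>x. cmod (f n x - g x)) = J (d n)"
      using order_integral_real_diff[OF bm bmd] by simp
    also have "\<dots> \<le> u n"
      unfolding u_def using dh[of _ n 0] by (intro order_integral_real_mono bmd bmh) auto
    finally show ?thesis .
  qed
  moreover have "b \<le> 0" if "0 \<le> x" "\<And>n. b \<le> rapply (u n) x" for x b
  proof (rule integral_continuous_from_above[OF _ _ _ _ limh that])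
    show "is_integral (h n) (u n)" for n
      unfolding u_def by (intro order_integral_real_is_integral bmh)
    show "h n x \<le> C" if "x \<in> space M" for n x
      using hle[OF dC] that by blast
    show "decseq (\<lambda>n. h n x)" if "x \<in> space M" for x
      using dech[OF that] by (simp add: decseq_def)
  qed auto
  ultimately show ?thesis
    using that by blast
qed

end

section \<open>The functional calculus of a central operator\<close>

text \<open>Central operators act boundedly, so an inverse found in the centre is an inverse in the
  sense of \<open>spectrum\<close>.\<close>

lemma not_in_spectrumI:
  fixes S U :: "'a::dc_banach_lattice regop complexification"
  assumes "U \<in> ccentre" "U * (c *\<^sub>C 1 - S) = 1" "(c *\<^sub>C 1 - S) * U = 1"
  shows "c \<notin> spectrum (capply S)"
proof -
  have "capply U (c *\<^sub>C z - capply S z) = z" for z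
  proof -
    have "capply U (c *\<^sub>C z - capply S z) = capply (U * (c *\<^sub>C 1 - S)) z"
      by simp
    then show ?thesis
      by (simp only: assms capply_simps)
  qed
  moreover have "c *\<^sub>C capply U z - capply S (capply U z) = z" for z
  proof -
    have "c *\<^sub>C capply U z - capply S (capply U z) = capply ((c *\<^sub>C 1 - S) * U) z"
      by simp
    then show ?thesis
      by (simp only: assms capply_simps)
  qed
  ultimately show ?thesis
    unfolding spectrum_def using bounded_clinear_capply[OF assms(1)] by blast
qed

locale spectral_calculus =
  fixes T :: "'a::dc_banach_lattice regop complexification" and \<mu> :: "complex set \<Rightarrow> 'a regop"
  assumes central: "T \<in> ccentre" and spectral_measure_of: "is_spectral_measure_of T \<mu>"
begin

abbreviation X :: "complex set" where
  "X \<equiv> spectrum (capply T)"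

sublocale unital_spectral_measure "spectral_space T" \<mu>
  using spectral_measure_of
  by unfold_locales (simp_all add: is_spectral_measure_of_def space_restrict_space)

lemma space_eq [simp]: "space (spectral_space T) = X"
  by (simp add: space_restrict_space)

lemma compact_X: "compact X"
  by (intro compact_spectrum bounded_clinear_capply central)

lemma bounded_borel_measurable: "f \<in> bounded_borel X \<Longrightarrow> bounded_measurable (spectral_space T) f"
  by (auto simp: bounded_borel_def bounded_measurable_def bounded_iff)

lemma continuous_bounded_measurable:
  assumes "continuous_on X f"
  shows "bounded_measurable (spectral_space T) f"
proof -
  have "bounded (f ` X)"
    using assms compact_X by (intro compact_imp_bounded compact_continuous_image)
  then show ?thesis
    using borel_measurable_continuous_on_restrict[OF assms]
    by (auto simp: bounded_measurable_def bounded_iff)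
qed

lemma continuous_fun_subset: "continuous_fun X \<subseteq> bounded_borel X"
proof
  fix f assume f: "f \<in> continuous_fun X"
  then have "bounded_measurable (spectral_space T) f"
    by (simp add: continuous_fun_def continuous_bounded_measurable)
  then show "f \<in> bounded_borel X"
    using f by (simp add: bounded_borel_def continuous_fun_def bounded_measurable_def bounded_iff)
qed

lemma integral_id: "L (\<lambda>z. z) = T"
  using spectral_measure_of by (simp add: is_spectral_measure_of_def)

lemma ball_in_sets: "ball c e \<inter> X \<in> sets (spectral_space T)"
  unfolding sets_restrict_space by (intro image_eqI[of _ _ "ball c e"]) auto

lemma measure_ball_nonzero:
  assumes "c \<in> X" "0 < e"
  shows "\<mu> (ball c e \<inter> X) \<noteq> 0"
proof
  assume null: "\<mu> (ball c e \<inter> X) = 0"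
  \<comment> \<open>Cutting off the ball bounds 1 / (c - z) by 1 / e, and the integral does not
    notice the cut as the ball is assumed null.\<close>
  define f where "f z = indicator (- ball c e) z * inverse (c - z)" for z
  have bid: "bounded_measurable (spectral_space T) (\<lambda>z. c - z)"
    by (intro continuous_bounded_measurable continuous_intros)
  have "f \<in> borel_measurable borel"
    unfolding f_def by measurable
  then have f: "bounded_measurable (spectral_space T) f"
  proof (intro bounded_measurableI[of _ _ "inverse e"] measurable_restrict_space1)
    fix z
    show "norm (f z) \<le> inverse e"
    proof (cases "z \<in> ball c e")
      case False
      then have "e \<le> norm (c - z)"
        by (simp add: dist_norm)
      then show ?thesis
        using False \<open>0 < e\<close> by (simp add: f_def norm_inverse le_imp_inverse_le)
    qed (use \<open>0 < e\<close> in \<open>simp add: f_def\<close>)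
  qed
  have "L (\<lambda>z. (c - z) * f z - 1) = 0"
    using bid f null
  proof (intro order_integral_eq_0[OF _ ball_in_sets])
    fix z assume "z \<in> space (spectral_space T) - ball c e \<inter> X"
    then have "z \<notin> ball c e" "c - z \<noteq> 0"
      using \<open>0 < e\<close> by auto
    then show "(c - z) * f z - 1 = 0"
      by (simp add: f_def)
  qed (auto intro!: bounded_measurable_diff bounded_measurable_mult)
  then have one: "L (\<lambda>z. (c - z) * f z) = 1"
    using bid f by (simp add: order_integral_diff bounded_measurable_mult order_integral_one)
  have cT: "L (\<lambda>z. c - z) = c *\<^sub>C 1 - T"
    by (simp add: order_integral_diff order_integral_const integral_id
        continuous_bounded_measurable[of "\<lambda>z. z"])
  have "(c *\<^sub>C 1 - T) * L f = 1"
    using one order_integral_mult[OF bid f] cT by simp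
  moreover have "L f * (c *\<^sub>C 1 - T) = 1"
    using one order_integral_mult[OF f bid] cT by (simp add: mult.commute)
  ultimately have "c \<notin> X"
    using order_integral_in_ccentre[OF f] by (intro not_in_spectrumI)
  then show False
    using assms by simp
qed

text \<open>If |f w| exceeded r, rotate so that f w becomes positive. Near w the rotated real part g
  is at least r + d, so the projection \<mu> N of a small ball satisfies (r + d) \<mu> N \<le> J g *
  \<mu> N \<le> r \<mu> N, and \<mu> N would vanish.\<close>

lemma sup_norm_le:
  assumes f: "continuous_on X f" and r: "cid_bounded r (L f)" and w: "w \<in> X"
  shows "cmod (f w) \<le> r"
proof (rule ccontr)
  assume less: "\<not> cmod (f w) \<le> r"
  \<comment> \<open>Half the excess of |f w| over r: one d may be lost by continuity, the other
    remains.\<close>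
  define d where "d = (cmod (f w) - r) / 2"
  have d: "0 < d" "cmod (f w) = r + 2 * d"
    using less by (simp_all add: d_def field_simps)
  define \<theta> where "\<theta> = Arg (f w)"
  define g where "g z = Re (cis (- \<theta>) * f z)" for z
  have "f w = cmod (f w) * cis \<theta>"
    unfolding \<theta>_def using rcis_cmod_Arg[of "f w"] by (simp add: rcis_def)
  then have "cis (- \<theta>) * f w = cmod (f w)"
    by (metis cis_mult add.left_inverse cis_zero mult.commute mult.left_commute mult.right_neutral)
  then have gw: "g w = r + 2 * d"
    using d by (simp add: g_def del: cis.sel)
  have cont: "continuous_on X g"
    unfolding g_def using f by (intro continuous_intros)
  have g: "bounded_measurable (spectral_space T) g"
    by (rule continuous_bounded_measurable[OF cont])
  obtain e where e: "0 < e" "\<And>z. z \<in> X \<Longrightarrow> dist z w < e \<Longrightarrow> dist (g z) (g w) < d"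
    using cont w d(1) unfolding continuous_on_iff by metis
  define N where "N = ball w e \<inter> X"
  have N: "N \<in> sets (spectral_space T)" "\<mu> N \<noteq> 0"
    unfolding N_def using ball_in_sets measure_ball_nonzero w e(1) by auto
  have ind: "bounded_measurable (spectral_space T) (indicator N :: _ \<Rightarrow> real)"
    using N(1) by (rule bounded_measurable_indicator)
  have gN: "(r + d) * indicator N z \<le> g z * indicator N z" if "z \<in> X" for z
  proof (cases "z \<in> N")
    case True
    then have "dist (g z) (g w) < d"
      using that by (intro e) (auto simp: N_def dist_commute)
    then show ?thesis
      using True gw by (simp add: dist_real_def)
  qed simp
  have "(r + d) *\<^sub>R \<mu> N = J (\<lambda>z. (r + d) * indicator N z)"
    using N(1) by (simp only: order_integral_real_scale[OF ind] order_integral_real_indicator)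
  also have "\<dots> \<le> J (\<lambda>z. g z * indicator N z)"
    using gN by (intro order_integral_real_mono bounded_measurable_mult bounded_measurable_const ind g) auto
  also have "\<dots> = J g * \<mu> N"
    using N(1) by (simp only: order_integral_real_mult[OF g ind] order_integral_real_indicator)
  also have "\<dots> \<le> r *\<^sub>R \<mu> N"
  proof -
    have "J g \<le> r *\<^sub>R 1"
      using r rotated_re_order_integral[OF continuous_bounded_measurable[OF f], of \<theta>]
      unfolding cid_bounded_def id_bounded_def g_def by metis
    then have "0 \<le> (r *\<^sub>R 1 - J g) * \<mu> N"
      using nonneg[OF N(1)] by (intro regop_mult_nonneg) auto
    then show ?thesis
      by (simp add: left_diff_distrib)
  qed
  finally have "d *\<^sub>R \<mu> N \<le> 0"
    by (simp add: scaleR_add_left)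
  then have "inverse d *\<^sub>R d *\<^sub>R \<mu> N \<le> inverse d *\<^sub>R 0"
    using d(1) by (intro scaleR_left_mono) auto
  then have "\<mu> N = 0"
    using d(1) nonneg[OF N(1)] by (intro order.antisym) auto
  then show False
    using N(2) by simp
qed

lemma order_integral_inj:
  assumes "continuous_on X f" "continuous_on X g" "L f = L g" "z \<in> X"
  shows "f z = g z"
proof -
  have "L (\<lambda>z. f z - g z) = 0"
    using assms by (simp add: order_integral_diff continuous_bounded_measurable)
  \<comment> \<open>Equal integrals give the bound 0, which passes to the values of f - g.\<close>
  then have "cid_bounded 0 (L (\<lambda>z. f z - g z))"
    by (simp add: cid_bounded_def id_bounded_def rotated_re_def)
  then have "cmod (f z - g z) \<le> 0"
    using assms by (intro sup_norm_le[of "\<lambda>z. f z - g z"] continuous_intros)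
  then show ?thesis
    by simp
qed

lemma order_integral_minus_scalar:
  assumes "bounded_measurable (spectral_space T) f"
  shows "L (\<lambda>z. c - f z) = c *\<^sub>C 1 - L f"
  using assms by (simp add: order_integral_diff order_integral_const)

section \<open>The spectral mapping theorem\<close>

text \<open>Off the image, 1 / (c - f) is continuous and integrates to an inverse. For c = f w an
  arbitrary bounded inverse B has to be excluded, not only a central one: with N a small ball around
  w, a vector z in the range of \<mu> N is mapped by c - L f to a vector of norm at most d * norm z,
  too small for the bound on B.\<close>

lemma spectral_mapping:
  assumes f: "continuous_on X f"
  shows "spectrum (capply (L f)) = f ` X"
proof (intro equalityI subsetI)
  note bf = continuous_bounded_measurable[OF f]
  fix c assume "c \<in> spectrum (capply (L f))"
  show "c \<in> f ` X"
  proof (rule ccontr)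
    assume c: "c \<notin> f ` X"
    define h where "h z = inverse (c - f z)" for z
    have "continuous_on X h"
      unfolding h_def using f c by (intro continuous_intros) auto
    then have h: "bounded_measurable (spectral_space T) h"
      by (rule continuous_bounded_measurable)
    have cf: "bounded_measurable (spectral_space T) (\<lambda>z. c - f z)"
      using f by (intro continuous_bounded_measurable continuous_intros)
    have "L (\<lambda>z. (c - f z) * h z) = L (\<lambda>_. 1)"
    proof (intro order_integral_cong)
      fix z assume "z \<in> space (spectral_space T)"
      then have "c - f z \<noteq> 0"
        using c by auto
      then show "(c - f z) * h z = 1"
        by (simp add: h_def)
    qed simp
    then have "L (\<lambda>z. c - f z) * L h = 1" "L h * L (\<lambda>z. c - f z) = 1"
      using order_integral_mult[OF cf h] order_integral_mult[OF h cf]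
      by (simp_all add: order_integral_one mult.commute[of "h _"])
    then have "c \<notin> spectrum (capply (L f))"
      using order_integral_in_ccentre[OF h]
      unfolding order_integral_minus_scalar[OF bf] by (intro not_in_spectrumI)
    then show False
      using \<open>c \<in> spectrum (capply (L f))\<close> by simp
  qed
next
  note bf = continuous_bounded_measurable[OF f]
  fix c assume "c \<in> f ` X"
  then obtain w where w: "w \<in> X" "c = f w"
    by blast
  show "c \<in> spectrum (capply (L f))"
  proof (rule ccontr)
    assume "c \<notin> spectrum (capply (L f))"
    then obtain B where B: "bounded_clinear B" "\<And>z. B (c *\<^sub>C z - capply (L f) z) = z"
      by (auto simp: spectrum_def)
    obtain b where b: "0 < b" "\<And>z. norm (B z) \<le> b * norm z"
      using B(1) bounded_linear.pos_bounded unfolding bounded_clinear_def by (metis mult.commute)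
    \<comment> \<open>Chosen so that the final chain reads norm z \<le> norm z / 2.\<close>
    define d where "d = 1 / (2 * b)"
    have d: "0 < d" "b * d = 1 / 2"
      using b(1) by (simp_all add: d_def)
    obtain e where e: "0 < e" "\<And>z. z \<in> X \<Longrightarrow> dist z w < e \<Longrightarrow> dist (f z) (f w) < d"
      using f w(1) d(1) unfolding continuous_on_iff by metis
    define N where "N = ball w e \<inter> X"
    have N: "N \<in> sets (spectral_space T)" "\<mu> N \<noteq> 0"
      unfolding N_def using ball_in_sets measure_ball_nonzero w(1) e(1) by auto
    have ind: "bounded_measurable (spectral_space T) (indicator N :: _ \<Rightarrow> real)"
      using N(1) by (rule bounded_measurable_indicator)
    \<comment> \<open>Operators are determined on the positive cone, so a nonzero projection is
      nonzero at some positive x; its value v there is positive and fixed by \<mu> N.\<close>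
    obtain x where x: "0 \<le> x" "rapply (\<mu> N) x \<noteq> 0"
      using N(2) regop_eqI[of "\<mu> N" 0] by auto
    define v where "v = rapply (\<mu> N) x"
    have v: "0 \<le> v" "v \<noteq> 0"
      using x regop_leD[OF nonneg[OF N(1)], of x] by (auto simp: v_def)
    have Pv: "rapply (\<mu> N) v = v"
      using inter[OF N(1) N(1)] by (metis Int_absorb rapply_simps(7) v_def)
    define z where "z = Cplx v 0"
    have mz: "modulus z = v"
    proof (rule order.antisym)
      show "modulus z \<le> v"
        using v(1) scaleR_le_abs[of "cos _" v] by (intro modulus_least) (simp add: z_def)
      show "v \<le> modulus z"
        using modulus_upper[of 0 z] by (simp add: z_def)
    qed
    define g where "g z = c - f z" for z
    have g: "bounded_measurable (spectral_space T) g"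
      unfolding g_def using f by (intro continuous_bounded_measurable continuous_intros)
    \<comment> \<open>Writing v as \<mu> N v lets the indicator of N enter the integrand, where cmod
      g stays below d.\<close>
    have "modulus (capply (L g) z) \<le> rapply (J (\<lambda>z. cmod (g z))) (rapply (\<mu> N) v)"
      using modulus_capply_order_integral_le[OF g, of z] by (simp add: mz Pv)
    also have "\<dots> = rapply (J (\<lambda>z. cmod (g z)) * \<mu> N) v"
      by simp
    also have "\<dots> = rapply (J (\<lambda>z. cmod (g z) * indicator N z)) v"
      using N(1) by (simp only: order_integral_real_mult[OF bounded_measurable_norm[OF g] ind] order_integral_real_indicator)
    also have "\<dots> \<le> rapply (J (\<lambda>z. d * indicator N z)) v"
    proof (intro regop_leD v order_integral_real_mono bounded_measurable_mult
        bounded_measurable_norm g ind bounded_measurable_const)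
      fix y assume "y \<in> space (spectral_space T)"
      then show "cmod (g y) * indicator N y \<le> d * indicator N y"
        using e(2)[of y] by (auto simp: N_def indicator_def g_def w(2) dist_norm norm_minus_commute)
    qed
    also have "\<dots> = d *\<^sub>R modulus z"
      using N(1) by (simp only: order_integral_real_scale[OF ind] order_integral_real_indicator rapply_simps Pv mz)
    finally have small: "norm (capply (L g) z) \<le> d * norm z"
      using d(1) by (intro norm_le_if_modulus_le) auto
    have "capply (L g) z = c *\<^sub>C z - capply (L f) z"
      unfolding g_def order_integral_minus_scalar[OF bf] by simp
    then have "norm z \<le> b * norm (capply (L g) z)"
      using b(2) B(2) by metis
    also have "\<dots> \<le> b * (d * norm z)"
      using small b(1) by (intro mult_left_mono) auto
    also have "\<dots> = norm z / 2"
      using d(2) by (simp flip: mult.assoc)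
    finally have "z = 0"
      by simp
    then have "v = 0"
      by (metis complexification.sel(1) complexification_simps(1) z_def)
    then show False
      using v(2) by simp
  qed
qed

section \<open>The algebra generated by T and its conjugate\<close>

text \<open>\<open>continuous_fun\<close> prescribes the values off X; since the integral sees only
  X, any function continuous on X may represent an element.\<close>

lemma continuous_image_iff: "S \<in> L ` continuous_fun X \<longleftrightarrow> (\<exists>f. continuous_on X f \<and> S = L f)"
proof safe
  fix f :: "complex \<Rightarrow> complex" assume f: "continuous_on X f"
  then have "continuous_on X (restrict f X)"
    using continuous_on_cong[of X X "restrict f X" f] by simp
  then have "restrict f X \<in> continuous_fun X"
    by (simp add: continuous_fun_def)
  moreover have "L (restrict f X) = L f"
    using f by (intro order_integral_cong continuous_bounded_measurable) auto
  ultimately show "L f \<in> L ` continuous_fun X"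
    by (metis imageI)
qed (auto simp: continuous_fun_def)

text \<open>Closedness is the substance: by \<open>sup_norm_le\<close> convergent integrals have
  uniformly Cauchy integrands, and by contractivity the integral of the uniform limit is the given
  limit.\<close>

lemma closed_unital_subalgebra_continuous: "closed_unital_subalgebra (L ` continuous_fun X)"
  unfolding closed_unital_subalgebra_def
proof (intro conjI ballI allI impI)
  show "L ` continuous_fun X \<subseteq> ccentre"
    using continuous_fun_subset bounded_borel_measurable order_integral_in_ccentre by blast
  show "1 \<in> L ` continuous_fun X"
    unfolding continuous_image_iff by (intro exI[of _ "\<lambda>_. 1"]) (simp add: order_integral_one)
  fix S U assume "S \<in> L ` continuous_fun X" "U \<in> L ` continuous_fun X"
  then obtain f g where fg: "continuous_on X f" "S = L f" "continuous_on X g" "U = L g"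
    unfolding continuous_image_iff by blast
  show "S + U \<in> L ` continuous_fun X"
    unfolding continuous_image_iff using fg
    by (intro exI[of _ "\<lambda>z. f z + g z"])
      (auto intro!: continuous_intros simp: order_integral_add continuous_bounded_measurable)
  show "S * U \<in> L ` continuous_fun X"
    unfolding continuous_image_iff using fg
    by (intro exI[of _ "\<lambda>z. f z * g z"])
      (auto intro!: continuous_intros simp: order_integral_mult continuous_bounded_measurable)
next
  fix c S assume "S \<in> L ` continuous_fun X"
  then obtain f where "continuous_on X f" "S = L f"
    unfolding continuous_image_iff by blast
  then show "c *\<^sub>C S \<in> L ` continuous_fun X"
    unfolding continuous_image_iff
    by (intro exI[of _ "\<lambda>z. c * f z"])
      (auto intro!: continuous_intros simp: order_integral_scaleC continuous_bounded_measurable)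
next
  fix S U
  assume *: "range S \<subseteq> L ` continuous_fun X \<and> U \<in> ccentre \<and> (\<lambda>n. ccentre_norm (S n - U)) \<longlonglongrightarrow> 0"
  then have "\<forall>n. \<exists>f. continuous_on X f \<and> S n = L f"
    using continuous_image_iff by (metis range_subsetD)
  then obtain f where f: "\<And>n. continuous_on X (f n)" "\<And>n. S n = L (f n)"
    by metis
  have lim: "\<exists>N. \<forall>n\<ge>N. cid_bounded e (L (f n) - U)" if "0 < e" for e
    using * that ccentre_tendsto_iff[of S U] order_integral_in_ccentre[OF continuous_bounded_measurable[OF f(1)]]
    unfolding f(2) by blast
  have "uniformly_Cauchy_on X f"
    unfolding uniformly_Cauchy_on_def
  proof (intro allI impI)
    fix e :: real assume "0 < e"
    then obtain N where N: "\<forall>n\<ge>N. cid_bounded (e / 4) (L (f n) - U)"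
      using lim[of "e / 4"] by auto
    have "dist (f m z) (f n z) < e" if "z \<in> X" "N \<le> m" "N \<le> n" for z m n
    proof -
      \<comment> \<open>The two quarters add up to e / 2, which leaves room for the strict
        inequality.\<close>
      have "cid_bounded (e / 4 + e / 4) ((L (f m) - U) - (L (f n) - U))"
        using N that by (intro cid_bounded_diff) auto
      also have "(L (f m) - U) - (L (f n) - U) = L (\<lambda>z. f m z - f n z)"
        by (simp add: order_integral_diff continuous_bounded_measurable f)
      finally have "cmod (f m z - f n z) \<le> e / 4 + e / 4"
        using f(1) that(1) by (intro sup_norm_le[of "\<lambda>z. f m z - f n z"] continuous_intros)
      then show ?thesis
        using \<open>0 < e\<close> by (simp add: dist_norm)
    qed
    then show "\<exists>N. \<forall>z\<in>X. \<forall>m\<ge>N. \<forall>n\<ge>N. dist (f m z) (f n z) < e"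
      by blast
  qed
  then obtain g where g: "uniform_limit X f g sequentially"
    using Cauchy_uniformly_convergent unfolding uniformly_convergent_on_def by blast
  then have cont: "continuous_on X g"
    by (intro uniform_limit_theorem[OF _ g]) (auto simp: f)
  have "U - L g = 0"
  proof (rule cid_bounded_eq_0)
    fix e :: real assume "0 < e"
    obtain N1 where N1: "\<forall>n\<ge>N1. cid_bounded e (L (f n) - U)"
      using lim[OF \<open>0 < e\<close>] by blast
    obtain N2 where N2: "\<forall>n\<ge>N2. \<forall>z\<in>X. dist (f n z) (g z) < e"
      using g \<open>0 < e\<close> unfolding uniform_limit_iff eventually_sequentially by blast
    define n where "n = max N1 N2"
    have "cid_bounded e (L (\<lambda>z. f n z - g z))"
      using N2 f cont by (intro cid_bounded_order_integral continuous_bounded_measurable continuous_intros)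
        (auto simp: n_def dist_norm less_imp_le)
    moreover have "L (\<lambda>z. f n z - g z) = L (f n) - L g"
      by (simp add: order_integral_diff continuous_bounded_measurable f cont)
    ultimately have "cid_bounded (e + e) ((L (f n) - L g) - (L (f n) - U))"
      using N1 by (intro cid_bounded_diff) (auto simp: n_def)
    then show "cid_bounded (2 * e) (U - L g)"
      by simp
  qed simp
  then show "U \<in> L ` continuous_fun X"
    unfolding continuous_image_iff using cont by auto
qed

text \<open>Real polynomial functions on the plane are built from linear functionals, constants,
  sums and products, and the induction follows this. A real linear functional is a combination of z
  and its conjugate, so it integrates to one of T and \<open>cconj T\<close>. Real and imaginary
  part of f are approximated separately, and closedness of B gives the limit.\<close>

lemma continuous_subset_generated:
  assumes B: "closed_unital_subalgebra B" and T: "T \<in> B" "cconj T \<in> B" and f: "continuous_on X f"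
  shows "L f \<in> B"
proof -
  have add: "S + U \<in> B" and mult: "S * U \<in> B" if "S \<in> B" "U \<in> B" for S U
    using B that by (auto simp: closed_unital_subalgebra_def)
  have scale: "c *\<^sub>C S \<in> B" if "S \<in> B" for S c
    using B that by (auto simp: closed_unital_subalgebra_def)
  have one: "1 \<in> B"
    using B by (auto simp: closed_unital_subalgebra_def)
  have cont_poly: "continuous_on X p" if "real_polynomial_function p" for p :: "complex \<Rightarrow> real"
    using that by (simp add: continuous_on_polymonial_function real_polynomial_function_eq)
  have poly: "L (\<lambda>z. of_real (p z)) \<in> B" if "real_polynomial_function p" for p
    using that
  proof induction
    case (linear p)
    \<comment> \<open>Obtained from p z = Re z * p 1 + Im z * p \<i> by writing Re z and Im z
      through z and its conjugate.\<close>
    define a where "a = (of_real (p 1) - \<i> * of_real (p \<i>)) / 2"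
    define b where "b = (of_real (p 1) + \<i> * of_real (p \<i>)) / 2"
    have "of_real (p z) = a * z + b * cnj z" for z
    proof -
      have "z = Re z *\<^sub>R 1 + Im z *\<^sub>R \<i>"
        by (simp add: complex_eq_iff)
      then have "p z = p (Re z *\<^sub>R 1 + Im z *\<^sub>R \<i>)"
        by (rule arg_cong)
      also have "\<dots> = Re z * p 1 + Im z * p \<i>"
        using linear by (simp add: bounded_linear.linear linear_add linear_cmul)
      finally show ?thesis
        by (simp add: a_def b_def complex_eq_iff field_simps)
    qed
    then have "L (\<lambda>z. of_real (p z)) = L (\<lambda>z. a * z + b * cnj z)"
      by simp
    also have "\<dots> = a *\<^sub>C L (\<lambda>z. z) + b *\<^sub>C cconj (L (\<lambda>z. z))"
      by (simp add: order_integral_add order_integral_scaleC order_integral_cnj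
          continuous_bounded_measurable continuous_intros)
    finally show ?case
      using T by (simp add: integral_id add scale)
  next
    case (const c)
    have "L (\<lambda>_. of_real c * 1) = of_real c *\<^sub>C 1"
      by (simp only: order_integral_scaleC[OF bounded_measurable_const] order_integral_one)
    then show ?case
      using scale[OF one] by simp
  next
    case (add p q)
    then show ?case
      using \<open>\<And>U S. S \<in> B \<Longrightarrow> U \<in> B \<Longrightarrow> S + U \<in> B\<close> cont_poly
      by (simp add: order_integral_add continuous_bounded_measurable continuous_on_of_real)
  next
    case (mult p q)
    then show ?case
      using \<open>\<And>U S. S \<in> B \<Longrightarrow> U \<in> B \<Longrightarrow> S * U \<in> B\<close> cont_poly
      by (simp add: order_integral_mult continuous_bounded_measurable continuous_on_of_real)
  qed
  have "\<exists>p q. real_polynomial_function p \<and> real_polynomial_function q \<and>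
      (\<forall>z\<in>X. cmod (of_real (p z) + \<i> * of_real (q z) - f z) \<le> 2 / real (Suc n))" for n
  proof -
    have "continuous_on X (\<lambda>z. Re (f z))" "continuous_on X (\<lambda>z. Im (f z))"
      using f by (auto intro!: continuous_intros)
    then obtain p q where pq: "real_polynomial_function p" "\<And>z. z \<in> X \<Longrightarrow> \<bar>Re (f z) - p z\<bar> < 1 / real (Suc n)"
      "real_polynomial_function q" "\<And>z. z \<in> X \<Longrightarrow> \<bar>Im (f z) - q z\<bar> < 1 / real (Suc n)"
      using Stone_Weierstrass_real_polynomial_function[OF compact_X] by (metis of_nat_0_less_iff zero_less_Suc zero_less_divide_1_iff)
    \<comment> \<open>Each of the two parts contributes an error below 1 / (n + 1).\<close>
    have "cmod (of_real (p z) + \<i> * of_real (q z) - f z) \<le> 2 / real (Suc n)" if "z \<in> X" for z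
      using cmod_le[of "of_real (p z) + \<i> * of_real (q z) - f z"] pq(2,4)[OF that] by simp
    then show ?thesis
      using pq(1,3) by blast
  qed
  then obtain p q where pq: "\<And>n. real_polynomial_function (p n)" "\<And>n. real_polynomial_function (q n)"
      "\<And>n z. z \<in> X \<Longrightarrow> cmod (of_real (p n z) + \<i> * of_real (q n z) - f z) \<le> 2 / real (Suc n)"
    by metis
  define h where "h n z = complex_of_real (p n z) + \<i> * of_real (q n z)" for n z
  have cont: "continuous_on X (h n)" for n
    unfolding h_def by (intro continuous_intros cont_poly pq)
  have "L (h n) = L (\<lambda>z. of_real (p n z)) + \<i> *\<^sub>C L (\<lambda>z. of_real (q n z))" for n
    unfolding h_def using cont_poly[OF pq(1)] cont_poly[OF pq(2)]
    by (simp add: order_integral_add order_integral_scaleC bounded_measurable_scale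
        continuous_bounded_measurable continuous_on_of_real)
  then have "range (\<lambda>n. L (h n)) \<subseteq> B"
    using poly pq add scale by auto
  moreover have cc: "L (h n) \<in> ccentre" "L f \<in> ccentre" for n
    using cont f by (auto intro!: order_integral_in_ccentre continuous_bounded_measurable)
  moreover have "(\<lambda>n. ccentre_norm (L (h n) - L f)) \<longlonglongrightarrow> 0"
    unfolding ccentre_tendsto_iff[OF cc]
  proof (intro allI impI)
    fix e :: real assume "0 < e"
    then obtain N where N: "2 / real (Suc N) < e"
      using reals_Archimedean[of "e / 2"] by (auto simp: field_simps)
    have "cid_bounded e (L (h n) - L f)" if "N \<le> n" for n
    proof -
      have "2 / real (Suc n) \<le> 2 / real (Suc N)"
        using that by (intro divide_left_mono) auto
      then have "2 / real (Suc n) \<le> e"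
        using N by linarith
      then have "cmod (h n z - f z) \<le> e" if "z \<in> X" for z
        using pq(3)[OF that, of n] unfolding h_def by (rule order_trans[rotated])
      then have "cid_bounded e (L (\<lambda>z. h n z - f z))"
        using cont f
        by (intro cid_bounded_order_integral continuous_bounded_measurable continuous_intros) auto
      then show ?thesis
        using cont f by (simp add: order_integral_diff continuous_bounded_measurable)
    qed
    then show "\<exists>N. \<forall>n\<ge>N. cid_bounded e (L (h n) - L f)"
      by blast
  qed
  ultimately show ?thesis
    using B unfolding closed_unital_subalgebra_def by blast
qed

lemma generated_eq: "closed_unital_subalgebra hull {T, cconj T} = L ` continuous_fun X"
proof (rule hull_unique)
  have "T \<in> L ` continuous_fun X"
    unfolding continuous_image_iff by (intro exI[of _ "\<lambda>z. z"]) (simp add: integral_id)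
  moreover have "cconj T = L (\<lambda>z. cnj z)"
    using order_integral_cnj[of "\<lambda>z. z"] by (simp add: continuous_bounded_measurable integral_id)
  then have "cconj T \<in> L ` continuous_fun X"
    unfolding continuous_image_iff by (intro exI[of _ cnj]) (auto intro!: continuous_intros)
  ultimately show "{T, cconj T} \<subseteq> L ` continuous_fun X"
    by simp
  show "closed_unital_subalgebra (L ` continuous_fun X)"
    by (rule closed_unital_subalgebra_continuous)
  show "L ` continuous_fun X \<subseteq> B" if "{T, cconj T} \<subseteq> B" "closed_unital_subalgebra B" for B
    using continuous_subset_generated[OF that(2)] that(1) by (auto simp: continuous_fun_def)
qed

section \<open>Homomorphism property and order continuity\<close>

text \<open>A and B stay open for two uses: bounded Borel functions with values in the centre, and
  continuous functions with values in the generated algebra. Restricting to X changes only values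
  that the integral ignores.\<close>

lemma unital_star_hom_order_integral:
  assumes A: "A \<subseteq> bounded_borel X" and B: "L ` A \<subseteq> B"
  shows "unital_star_hom X A B L"
  unfolding unital_star_hom_def
proof (intro conjI ballI allI B)
  have cong: "L (\<lambda>x\<in>X. f x) = L f" if "bounded_measurable (spectral_space T) f" for f
    using that by (intro order_integral_cong) auto
  show "L (\<lambda>x\<in>X. 1) = 1"
    using cong[of "\<lambda>_. 1"] by (simp add: order_integral_one)
  fix f assume "f \<in> A"
  then have f: "bounded_measurable (spectral_space T) f"
    using A bounded_borel_measurable by blast
  show "L (\<lambda>x\<in>X. c * f x) = c *\<^sub>C L f" for c
    by (simp add: cong bounded_measurable_scale order_integral_scaleC f)
  show "L (\<lambda>x\<in>X. cnj (f x)) = cconj (L f)"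
    by (simp add: cong bounded_measurable_cnj order_integral_cnj f)
  fix g assume "g \<in> A"
  then have g: "bounded_measurable (spectral_space T) g"
    using A bounded_borel_measurable by blast
  show "L (\<lambda>x\<in>X. f x + g x) = L f + L g"
    by (simp add: cong bounded_measurable_add order_integral_add f g)
  show "L (\<lambda>x\<in>X. f x * g x) = L f * L g"
    by (simp add: cong bounded_measurable_mult order_integral_mult f g)
qed

text \<open>One sequence u serves both claims: the modulus of the integral of f n - g is at most J
  |f n - g| as an operator, and at z it is at most that operator applied to the modulus of
  z.\<close>

lemma sigma_order_continuous:
  fixes f :: "nat \<Rightarrow> complex \<Rightarrow> complex" and z :: "'a complexification"
  assumes "\<And>n. f n \<in> bounded_borel X" "g \<in> bounded_borel X"
    and K: "order_AE (spectral_space T) \<mu> (\<lambda>z. \<forall>n. norm (f n z) \<le> K)"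
    and lim: "order_AE (spectral_space T) \<mu> (\<lambda>z. (\<lambda>n. f n z) \<longlonglongrightarrow> g z)"
  shows "sigma_order_tendsto centre (\<lambda>n. L (f n)) (L g)"
    and "sigma_order_tendsto UNIV (\<lambda>n. capply (L (f n)) z) (capply (L g) z)"
proof -
  have f: "bounded_measurable (spectral_space T) (f n)" for n
    by (rule bounded_borel_measurable) fact
  have g: "bounded_measurable (spectral_space T) g"
    by (rule bounded_borel_measurable) fact
  obtain u where u: "decseq u" "\<And>n. 0 \<le> u n" "\<And>n. u n \<in> centre"
    "\<And>n. J (\<lambda>x. cmod (f n x - g x)) \<le> u n"
    "\<And>x b. 0 \<le> x \<Longrightarrow> (\<And>n. b \<le> rapply (u n) x) \<Longrightarrow> b \<le> 0"
    using dominated_convergence[OF f g K lim] by blast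
  have diff: "L (f n) - L g = L (\<lambda>z. f n z - g z)" for n
    by (simp add: order_integral_diff f g)
  have bm: "bounded_measurable (spectral_space T) (\<lambda>z. f n z - g z)" for n
    by (intro bounded_measurable_diff f g)
  show "sigma_order_tendsto centre (\<lambda>n. L (f n)) (L g)"
    unfolding sigma_order_tendsto_def
  proof (intro exI[of _ u] conjI allI u(1))
    show "range u \<subseteq> centre"
      using u(3) by auto
    show "isGlb centre (range u) 0"
      unfolding isGlb_iff
    proof (intro conjI ballI impI)
      show "0 \<in> centre"
        by (rule centre_if_nonneg_le[of _ 0]) auto
      show "0 \<le> V" if "V \<in> range u" for V
        using u(2) that by auto
      fix V assume V: "\<forall>a\<in>range u. V \<le> a"
      \<comment> \<open>The inequality is tested on each positive x, where the vector form of the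
        convergence applies.\<close>
      show "V \<le> 0"
      proof (rule regop_leI)
        fix x :: 'a assume "0 \<le> x"
        then show "rapply V x \<le> rapply 0 x"
          using u(5)[OF \<open>0 \<le> x\<close>, of "rapply V x"] V by (simp add: regop_leD)
      qed
    qed
    show "modulus (L (f n) - L g) \<le> u n" for n
      unfolding modulus_regop_le_iff diff
    proof
      fix \<theta>
      have "rotated_re \<theta> (L (\<lambda>z. f n z - g z)) \<le> J (\<lambda>z. cmod (f n z - g z))"
        unfolding rotated_re_order_integral[OF bm]
      proof (intro order_integral_real_mono bounded_measurable_Re_Im bounded_measurable_scale
          bounded_measurable_norm bm)
        fix z
        show "Re (cis (- \<theta>) * (f n z - g z)) \<le> cmod (f n z - g z)"
          using complex_Re_le_cmod[of "cis (- \<theta>) * (f n z - g z)"] by (simp add: norm_mult del: cis.sel)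
      qed
      then show "rotated_re \<theta> (L (\<lambda>z. f n z - g z)) \<le> u n"
        using u(4) by (rule order_trans)
    qed
  qed
  show "sigma_order_tendsto UNIV (\<lambda>n. capply (L (f n)) z) (capply (L g) z)"
    unfolding sigma_order_tendsto_def
  proof (intro exI[of _ "\<lambda>n. rapply (u n) (modulus z)"] conjI allI)
    show "decseq (\<lambda>n. rapply (u n) (modulus z))"
      using u(1) by (auto simp: decseq_def intro!: regop_leD modulus_nonneg)
    show "isGlb UNIV (range (\<lambda>n. rapply (u n) (modulus z))) 0"
      unfolding isGlb_iff using u(5)[OF modulus_nonneg[of z]] regop_leD[OF u(2) modulus_nonneg, of z]
      by auto
    fix n
    have "modulus (capply (L (\<lambda>z. f n z - g z)) z) \<le> rapply (J (\<lambda>z. cmod (f n z - g z))) (modulus z)"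
      by (rule modulus_capply_order_integral_le[OF bm])
    also have "\<dots> \<le> rapply (u n) (modulus z)"
      by (intro regop_leD u modulus_nonneg)
    finally show "modulus (capply (L (f n)) z - capply (L g) z) \<le> rapply (u n) (modulus z)"
      by (simp flip: diff)
  qed simp
qed

end

theorem theorem4p7:
  fixes T :: "'a::dc_banach_lattice regop complexification"
    and \<mu> :: "complex set \<Rightarrow> 'a regop"
    and X :: "complex set"
    and \<rho> :: "(complex \<Rightarrow> complex) \<Rightarrow> 'a regop complexification"
  assumes "normal_lattice (centre :: 'a regop set)"
    and "T \<in> ccentre"
    and "is_spectral_measure_of T \<mu>"
    and "X = spectrum (capply T)"
    and "\<rho> = functional_calculus T \<mu>"
  shows
    "(unital_star_hom X (bounded_borel X) ccentre \<rho> \<and> \<rho> (\<lambda>z\<in>X. z) = T) \<and>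
     (unital_star_hom X (continuous_fun X) (closed_unital_subalgebra hull {T, cconj T}) \<rho> \<and>
      bij_betw \<rho> (continuous_fun X) (closed_unital_subalgebra hull {T, cconj T})) \<and>
     (\<forall>f\<in>continuous_fun X. spectrum (capply (\<rho> f)) = f ` X) \<and>
     (\<forall>f\<in>bounded_borel X. \<rho> f = 0 \<longleftrightarrow> order_AE (spectral_space T) \<mu> (\<lambda>z. f z = 0)) \<and>
     (\<forall>f g. range f \<subseteq> bounded_borel X \<and> g \<in> bounded_borel X \<and>
        (\<exists>K. order_AE (spectral_space T) \<mu> (\<lambda>z. \<forall>n. norm (f n z) \<le> K)) \<and>
        order_AE (spectral_space T) \<mu> (\<lambda>z. (\<lambda>n. f n z) \<longlonglongrightarrow> g z) \<longrightarrow>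
        sigma_order_tendsto centre (\<lambda>n. \<rho> (f n)) (\<rho> g) \<and>
        (\<forall>z. sigma_order_tendsto UNIV (\<lambda>n. capply (\<rho> (f n)) z) (capply (\<rho> g) z)))"
proof -
  interpret spectral_calculus T \<mu>
    using assms by unfold_locales
  have \<rho>: "\<rho> = order_integral (spectral_space T) \<mu>"
    using assms(5) by (simp add: functional_calculus_def fun_eq_iff)
  have cont: "continuous_on (spectrum (capply T)) f" if "f \<in> continuous_fun (spectrum (capply T))" for f
    using that by (simp add: continuous_fun_def)
  show ?thesis
    unfolding \<rho> assms(4)
  proof (intro conjI ballI allI impI)
    show "unital_star_hom (spectrum (capply T)) (bounded_borel (spectrum (capply T))) ccentre
        (order_integral (spectral_space T) \<mu>)"
      using bounded_borel_measurable order_integral_in_ccentre by (intro unital_star_hom_order_integral) auto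
    have "order_integral (spectral_space T) \<mu> (\<lambda>z\<in>spectrum (capply T). z) =
        order_integral (spectral_space T) \<mu> (\<lambda>z. z)"
      by (intro order_integral_cong continuous_bounded_measurable) auto
    then show "order_integral (spectral_space T) \<mu> (\<lambda>z\<in>spectrum (capply T). z) = T"
      by (simp add: integral_id)
    show "unital_star_hom (spectrum (capply T)) (continuous_fun (spectrum (capply T)))
        (closed_unital_subalgebra hull {T, cconj T}) (order_integral (spectral_space T) \<mu>)"
      unfolding generated_eq by (intro unital_star_hom_order_integral continuous_fun_subset) simp
    show "bij_betw (order_integral (spectral_space T) \<mu>) (continuous_fun (spectrum (capply T)))
        (closed_unital_subalgebra hull {T, cconj T})"
      unfolding generated_eq
    proof (intro inj_on_imp_bij_betw inj_onI)
      fix f g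
      assume "f \<in> continuous_fun (spectrum (capply T))" "g \<in> continuous_fun (spectrum (capply T))"
        "order_integral (spectral_space T) \<mu> f = order_integral (spectral_space T) \<mu> g"
      \<comment> \<open>Members of \<open>continuous_fun\<close> agree off X by extensionality, so
        equality on X is enough.\<close>
      then show "f = g"
        using order_integral_inj by (intro extensionalityI[of f _ g]) (auto simp: continuous_fun_def)
    qed
    show "spectrum (capply (order_integral (spectral_space T) \<mu> f)) = f ` spectrum (capply T)"
      if "f \<in> continuous_fun (spectrum (capply T))" for f
      using that by (intro spectral_mapping cont)
    show "order_integral (spectral_space T) \<mu> f = 0 \<longleftrightarrow> order_AE (spectral_space T) \<mu> (\<lambda>z. f z = 0)"
      if "f \<in> bounded_borel (spectrum (capply T))" for f
      using that by (intro order_integral_eq_0_iff bounded_borel_measurable)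
  qed (auto intro: sigma_order_continuous)
qed

end
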